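(* Let $G$ be a non-trivial finite abelian group and $\mathbf A$ a commutative $\mathbb{Q}$-algebra with unit. The bijection $\mathsf{EDS}(G)(\mathbf A)\to\mathsf{DMR}(G)(\mathbf A)$, $Z_{\mathbf A}\mapsto\Phi_{Z_{\mathbf A}\circ\overline{\mathrm{reg}}}$, restricts to a bijection $$\mathsf{EDSD}(G)(\mathbf A)\longrightarrow\mathsf{DMRD}(G)(\mathbf A).$$
   Context: $G$ is written multiplicatively with identity $1$; $X_G=\{x_0\}\sqcup\{x_g: g\in G\}$ ($x_1$ is the letter attached to $1\in G$), and $X_G^*$ is the set of words in $X_G$. $\mathfrak{H}_G=\mathbb{Q}\langle X_G\rangle$ is the free associative unital algebra, $\mathfrak{H}^1_G=\mathbb{Q}+\sum_{g\in G}\mathfrak{H}_Gx_g$ and $\mathfrak{H}^0_G=\mathbb{Q}+\sum_{g\in G}x_0\mathfrak{H}_Gx_g+\sum_{g\in G\smallsetminus\{1\}}x_g\mathfrak{H}^1_G$. Put $y_{n,g}=x_0^{n-1}x_g$ ($n\geq1$, $g\in G$), $Y_G=\{y_{n,g}\}$; $\mathfrak{H}^1_G$ is the free algebra on $Y_G$. Shuffle product $\mathrm{sh}$ on $\mathfrak{H}_G$: $\mathbb{Q}$-bilinear, $1\,\mathrm{sh}\,w=w\,\mathrm{sh}\,1=w$, $uw_1\,\mathrm{sh}\,vw_2=u(w_1\,\mathrm{sh}\,vw_2)+v(uw_1\,\mathrm{sh}\,w_2)$ for letters $u,v\in X_G$ and words $w_1,w_2$. Harmonic product $*$ on $\mathfrak{H}^1_G$: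 $\mathbb{Q}$-bilinear, $1*w=w*1=w$, $y_{n_1,g_1}w_1*y_{n_2,g_2}w_2=y_{n_1,g_1}(w_1*y_{n_2,g_2}w_2)+y_{n_2,g_2}(y_{n_1,g_1}w_1*w_2)+y_{n_1+n_2,g_1g_2}(w_1*w_2)$. The commutative algebras $\mathfrak{H}_{G,\mathrm{sh}},\mathfrak{H}^1_{G,\mathrm{sh}},\mathfrak{H}^0_{G,\mathrm{sh}}$ and $\mathfrak{H}^1_{G,*}$ are the corresponding spaces with the indicated products. Algebra homomorphisms are unital. $\mathrm{q}_G$ is the $\mathbb{Q}$-linear automorphism of $\mathfrak{H}_G$ with $\mathrm{q}_G(x_0^{n_1-1}x_{g_1}x_0^{n_2-1}x_{g_2}\cdots x_0^{n_r-1}x_{g_r}x_0^{n_{r+1}-1})=x_0^{n_1-1}x_{g_1}x_0^{n_2-1}x_{g_2g_1^{-1}}\cdots x_0^{n_r-1}x_{g_rg_{r-1}^{-1}}x_0^{n_{r+1}-1}$; it restricts to $\mathfrak{H}^1_G$ and $\mathfrak{H}^0_G$. $\overline{\mathrm{reg}}^T:\mathfrak{H}_{G,\mathrm{sh}}\to\mathfrak{H}^0_{G,\mathrm{sh}}[T]$ is the unique $\mathbb{Q}$-algebra homomorphism that is the identity on $\mathfrak{H}^0_G$ and sends $x_0\mapsto0$, $x_1\mapsto T$; $\overline{\mathrm{reg}}:\mathfrak{H}_{G,\mathrm{sh}}\to\mathfrak{H}^0_{G,\mathrm{sh}}$ is its composition with evaluation at $T=0$. For a $\mathbb{Q}$-algebra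 homomorphism $Z_{\mathbf A}:\mathfrak{H}^0_{G,\mathrm{sh}}\to\mathbf A$, $\overline{Z}^{\mathrm{sh}}_{\mathbf A}:\mathfrak{H}_{G,\mathrm{sh}}\to\mathbf{A}[T]$ is $\overline{\mathrm{reg}}^T$ followed by applying $Z_{\mathbf A}$ to coefficients, and $Z^{\mathrm{sh}}_{\mathbf A}$ is its restriction to $\mathfrak{H}^1_G$. $\rho_{Z_{\mathbf A}}$ is the $\mathbf{A}$-module automorphism of $\mathbf{A}[T]$ determined (coefficientwise in a formal parameter $u$) by $\rho_{Z_{\mathbf A}}(\exp(Tu))=\exp\big(\sum_{n\geq2}\frac{(-1)^n}{n}Z_{\mathbf A}(x_0^{n-1}x_1)u^n\big)\exp(Tu)$. $\mathsf{EDS}(G)(\mathbf A)$ is the set of $\mathbb{Q}$-linear maps $Z_{\mathbf A}:\mathfrak{H}^0_G\to\mathbf A$ such that (a) $Z_{\mathbf A}:\mathfrak{H}^0_{G,\mathrm{sh}}\to\mathbf A$ is an algebra homomorphism, and (b) $\rho_{Z_{\mathbf A}}^{-1}\circ Z^{\mathrm{sh}}_{\mathbf A}\circ\mathrm{q}_G^{-1}:\mathfrak{H}^1_{G,*}\to\mathbf{A}[T]$ is an algebra homomorphism. For a $\mathbb{Q}$-linear map $Z_{\mathbf A}:\mathfrak{H}^0_G\to\mathbf A$, $\Phi_{Z_{\mathbf A}\circ\overline{\mathrm{reg}}}=\sum_{w\in X_G^*}Z_{\mathbf A}(\overline{\mathrm{reg}}(w))\,w\in\mathbf A\langle\langle X_G\rangle\rangle$,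 where $\mathbf A\langle\langle X_G\rangle\rangle$ is the algebra of non-commutative formal power series. $(\Phi\mid w)$ denotes the coefficient of the word $w$ in $\Phi$. $\mathbf A\langle\langle Y_G\rangle\rangle$ is the algebra of non-commutative formal power series in $Y_G$ (degree of $y_{n,g}$ is $n$), viewed as a subalgebra of $\mathbf A\langle\langle X_G\rangle\rangle$ via $y_{n,g}=x_0^{n-1}x_g$; one has $\mathbf A\langle\langle X_G\rangle\rangle=\mathbf A\langle\langle Y_G\rangle\rangle\oplus\mathbf A\langle\langle X_G\rangle\rangle x_0$, and $\pi_{Y_G}$ is the projection onto the first summand. $\mathbf{q}_G$ is the continuous $\mathbf A$-linear extension of $\mathrm{q}_G$ to $\mathbf A\langle\langle X_G\rangle\rangle$. $\widehat\Delta_{G,\mathrm{sh}}$ is the (continuous) $\mathbf A$-algebra homomorphism $\mathbf A\langle\langle X_G\rangle\rangle\to\mathbf A\langle\langle X_G\rangle\rangle^{\hat\otimes2}$ with $x_g\mapsto x_g\otimes1+1\otimes x_g$ for $g\in G\sqcup\{0\}$. $\widehat\Delta_{G,*}$ is the (continuous) $\mathbf A$-algebra homomorphism $\mathbf A\langle\langle Y_G\rangle\rangle\to\mathbf A\langle\langle Y_G\rangle\rangle^{\hat\otimes2}$ with $y_{n,g}\mapsto y_{n,g}\otimes1+1\otimes y_{n,g}+\sum_{k=1}^{n-1}\sum_{h\in G}y_{k,h}\otimes y_{n-k,gh^{-1}}$. $\mathsf{DMR}(G)(\mathbf A)$ is the set of $\Phi\in\mathbf A\langle\langle X_G\rangle\rangle$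 with $(\Phi\mid x_0)=(\Phi\mid x_1)=0$ such that (a) $\widehat\Delta_{G,\mathrm{sh}}(\Phi)=\Phi\otimes\Phi$ and $(\Phi\mid1)=1$; (b) $\widehat\Delta_{G,*}(\Phi_* )=\Phi_*\otimes\Phi_*$, where $\Phi_*=\Phi_{\mathrm{corr}}\cdot\pi_{Y_G}(\mathbf q_G(\Phi))$ and $\Phi_{\mathrm{corr}}=\exp\big(\sum_{n\geq2}\frac{(-1)^{n-1}}{n}(\Phi\mid x_0^{n-1}x_1)x_1^n\big)$. The map $\mathsf{EDS}(G)(\mathbf A)\to\mathsf{DMR}(G)(\mathbf A)$, $Z_{\mathbf A}\mapsto\Phi_{Z_{\mathbf A}\circ\overline{\mathrm{reg}}}$, is a bijection (a previously established result of the paper). For a positive divisor $d$ of $|G|$: $G^d=\{g^d: g\in G\}$, $p^d:G\to G^d$, $g\mapsto g^d$. Concatenation algebra homomorphisms: $i_d^\sharp:\mathfrak{H}_{G^d}\to\mathfrak{H}_G$, $x_0\mapsto x_0$, $x_h\mapsto x_h$ ($h\in G^d$); $p^d_\sharp:\mathfrak{H}_{G^d}\to\mathfrak{H}_G$, $x_0\mapsto|\ker(p^d)|x_0$, $x_h\mapsto\sum_{g^d=h}x_g$; and (continuous, $\mathbf A$-linear) $i_d^*:\mathbf A\langle\langle X_G\rangle\rangle\to\mathbf A\langle\langle X_{G^d}\rangle\rangle$, $x_0\mapsto x_0$, $x_g\mapsto x_g$ if $g\in G^d$ and $x_g\mapsto0$ if $g\in G\smallsetminus G^d$; $p^d_*:\mathbf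 A\langle\langle X_G\rangle\rangle\to\mathbf A\langle\langle X_{G^d}\rangle\rangle$, $x_0\mapsto|\ker(p^d)|x_0$, $x_g\mapsto x_{g^d}$. $\sigma_{Z_{\mathbf A}}$ (depending on $d$) is the $\mathbf A$-module automorphism of $\mathbf A[T]$ determined by $\sigma_{Z_{\mathbf A}}(\exp(Tu))=\exp\big(\sum_{g^d=1,\,g\neq1}Z_{\mathbf A}(x_g)u\big)\exp(Tu)$. $\mathsf{EDSD}(G)(\mathbf A)$ is the set of $Z_{\mathbf A}\in\mathsf{EDS}(G)(\mathbf A)$ satisfying the regularized distribution relations: for every divisor $d$ of $|G|$, $\overline{Z}^{\mathrm{sh}}_{\mathbf A}\circ p^d_\sharp=\sigma_{Z_{\mathbf A}}\circ\overline{Z}^{\mathrm{sh}}_{\mathbf A}\circ i_d^\sharp$ as $\mathbb{Q}$-linear maps $\mathfrak{H}_{G^d}\to\mathbf A[T]$. $\mathsf{DMRD}(G)(\mathbf A)$ is the set of $\Phi\in\mathsf{DMR}(G)(\mathbf A)$ such that for every divisor $d$ of $|G|$, $p^d_*(\Phi)=\exp\big(\sum_{g^d=1}(\Phi\mid x_g)x_1\big)\,i_d^*(\Phi)$. *)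

theory Defs
  imports
    "HOL-Algebra.Coset"
    "HOL-Library.Poly_Mapping"
    "HOL-Computational_Algebra.Polynomial"
    "HOL-Computational_Algebra.Formal_Power_Series"
begin

section \<open>Rational vector spaces and commutative algebras\<close>

class rat_vector = ab_group_add +
  fixes scaleQ :: "rat \<Rightarrow> 'a \<Rightarrow> 'a"  (infixr \<open>*\<^sub>Q\<close> 75)
  assumes scaleQ_add_right: "a *\<^sub>Q (x + y) = a *\<^sub>Q x + a *\<^sub>Q y"
    and scaleQ_add_left: "(a + b) *\<^sub>Q x = a *\<^sub>Q x + b *\<^sub>Q x"
    and scaleQ_scaleQ: "a *\<^sub>Q b *\<^sub>Q x = (a * b) *\<^sub>Q x"
    and scaleQ_one: "1 *\<^sub>Q x = x"
begin

lemma scaleQ_zero_right [simp]: "a *\<^sub>Q 0 = 0"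
  using scaleQ_add_right [of a 0 0] by simp

lemma scaleQ_zero_left [simp]: "0 *\<^sub>Q x = 0"
  using scaleQ_add_left [of 0 0 x] by simp

end

text \<open>
  The class \<^class>\<open>comm_ring_1\<close> is not used as a superclass since it
  excludes the zero ring, which is a commutative unital algebra, too.
\<close>

class comm_rat_algebra = rat_vector + comm_ring + comm_monoid_mult +
  assumes scaleQ_mult_left: "(a *\<^sub>Q x) * y = a *\<^sub>Q (x * y)"

instantiation rat :: comm_rat_algebra
begin

definition scaleQ_rat :: "rat \<Rightarrow> rat \<Rightarrow> rat" where
  "scaleQ_rat a x = a * x"

instance
  by standard (simp_all add: scaleQ_rat_def algebra_simps)

end

instantiation poly :: (rat_vector) rat_vector
begin

definition scaleQ_poly :: "rat \<Rightarrow> 'a poly \<Rightarrow> 'a poly" where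
  "scaleQ_poly a p = map_poly (\<lambda>x. a *\<^sub>Q x) p"

instance
  by standard (auto simp: scaleQ_poly_def poly_eq_iff coeff_map_poly
      scaleQ_add_left scaleQ_add_right scaleQ_scaleQ scaleQ_one)

end

instantiation poly_mapping :: (type, rat_vector) rat_vector
begin

lift_definition scaleQ_poly_mapping :: "rat \<Rightarrow> ('a \<Rightarrow>\<^sub>0 'b) \<Rightarrow> 'a \<Rightarrow>\<^sub>0 'b" is
  "\<lambda>a p k. a *\<^sub>Q p k"
  by (rule finite_subset [rotated]) auto

instance
  by standard (transfer; simp add: scaleQ_add_left scaleQ_add_right scaleQ_scaleQ scaleQ_one)+

end

definition qlinear_on :: "'v::rat_vector set \<Rightarrow> ('v \<Rightarrow> 'w::rat_vector) \<Rightarrow> bool" where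
  "qlinear_on S f \<longleftrightarrow>
     (\<forall>x\<in>S. \<forall>y\<in>S. f (x + y) = f x + f y) \<and> (\<forall>a. \<forall>x\<in>S. f (a *\<^sub>Q x) = a *\<^sub>Q f x)"

text \<open>
  Several products live on the same space, so the products and units of source
  and target are explicit arguments.
\<close>

definition alg_hom_on ::
  "'v::rat_vector set \<Rightarrow> ('v \<Rightarrow> 'v \<Rightarrow> 'v) \<Rightarrow> 'v \<Rightarrow> ('w \<Rightarrow> 'w \<Rightarrow> 'w) \<Rightarrow> 'w \<Rightarrow>
    ('v \<Rightarrow> 'w::rat_vector) \<Rightarrow> bool" where
  "alg_hom_on S mul1 one1 mul2 one2 f \<longleftrightarrow>
     qlinear_on S f \<and> f one1 = one2 \<and> (\<forall>x\<in>S. \<forall>y\<in>S. f (mul1 x y) = mul2 (f x) (f y))"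

definition lin_ext :: "('w \<Rightarrow> 'v::rat_vector) \<Rightarrow> ('w \<Rightarrow>\<^sub>0 rat) \<Rightarrow> 'v" where
  "lin_ext f p = (\<Sum>w\<in>Poly_Mapping.keys p. Poly_Mapping.lookup p w *\<^sub>Q f w)"

definition bilin_ext ::
  "('w \<Rightarrow> 'w \<Rightarrow> 'v::rat_vector) \<Rightarrow> ('w \<Rightarrow>\<^sub>0 rat) \<Rightarrow> ('w \<Rightarrow>\<^sub>0 rat) \<Rightarrow> 'v" where
  "bilin_ext f p q = lin_ext (\<lambda>u. lin_ext (f u) q) p"


section \<open>Words and non-commutative polynomials\<close>

datatype 'g letter = X0 | X 'g

type_synonym 'g xword = "'g letter list"
type_synonym 'g ncpoly = "'g xword \<Rightarrow>\<^sub>0 rat"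

definition xwords :: "'g set \<Rightarrow> 'g xword set" where
  "xwords S = lists (insert X0 (X ` S))"

definition words1 :: "'g set \<Rightarrow> 'g xword set" where
  "words1 S = insert [] {w @ [X g] | w g. w \<in> xwords S \<and> g \<in> S}"

definition words0 :: "('g, 'm) monoid_scheme \<Rightarrow> 'g xword set" where
  "words0 G = insert []
     ({X0 # w @ [X g] | w g. w \<in> xwords (carrier G) \<and> g \<in> carrier G} \<union>
      {X g # w | g w. g \<in> carrier G - {\<one>\<^bsub>G\<^esub>} \<and> w \<in> words1 (carrier G)})"

definition HX :: "'g set \<Rightarrow> 'g ncpoly set" where
  "HX S = {p. Poly_Mapping.keys p \<subseteq> xwords S}"

definition HX1 :: "'g set \<Rightarrow> 'g ncpoly set" where
  "HX1 S = {p. Poly_Mapping.keys p \<subseteq> words1 S}"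

definition HX0 :: "('g, 'm) monoid_scheme \<Rightarrow> 'g ncpoly set" where
  "HX0 G = {p. Poly_Mapping.keys p \<subseteq> words0 G}"

definition of_word :: "'g xword \<Rightarrow> 'g ncpoly" where
  "of_word w = Poly_Mapping.single w 1"

definition conc :: "'g ncpoly \<Rightarrow> 'g ncpoly \<Rightarrow> 'g ncpoly" where
  "conc = bilin_ext (\<lambda>u v. of_word (u @ v))"

text \<open>The concatenation algebra homomorphism with prescribed values on the letters.\<close>

definition conc_hom :: "('g letter \<Rightarrow> 'g ncpoly) \<Rightarrow> 'g ncpoly \<Rightarrow> 'g ncpoly" where
  "conc_hom f = lin_ext (\<lambda>w. foldr (\<lambda>a. conc (f a)) w (of_word []))"

fun sh_word :: "'g xword \<Rightarrow> 'g xword \<Rightarrow> 'g ncpoly" where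
  "sh_word [] v = of_word v"
| "sh_word u [] = of_word u"
| "sh_word (a # u) (b # v) =
     conc (of_word [a]) (sh_word u (b # v)) + conc (of_word [b]) (sh_word (a # u) v)"

definition sh :: "'g ncpoly \<Rightarrow> 'g ncpoly \<Rightarrow> 'g ncpoly" where
  "sh = bilin_ext sh_word"

text \<open>
  A word in the letters \<open>y\<^sub>n\<^sub>,\<^sub>g\<close> is a list of pairs \<open>(n, g)\<close> with \<open>n \<ge> 1\<close>.  On words
  which are empty or end in some \<^term>\<open>X g\<close>, \<open>y_of_x 1\<close> is inverse to \<open>x_of_y\<close>.
\<close>

definition yw :: "nat \<Rightarrow> 'g \<Rightarrow> 'g xword" where
  "yw n g = replicate (n - 1) X0 @ [X g]"

definition x_of_y :: "(nat \<times> 'g) list \<Rightarrow> 'g xword" where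
  "x_of_y w = concat (map (\<lambda>(n, g). yw n g) w)"

fun y_of_x :: "nat \<Rightarrow> 'g xword \<Rightarrow> (nat \<times> 'g) list" where
  "y_of_x n [] = []"
| "y_of_x n (X0 # w) = y_of_x (Suc n) w"
| "y_of_x n (X g # w) = (n, g) # y_of_x 1 w"

lemma y_of_x_x_of_y:
  assumes "\<forall>(n, g)\<in>set w. n \<ge> 1"
  shows "y_of_x 1 (x_of_y w) = w"
proof -
  have *: "y_of_x m (replicate k X0 @ X g # v) = (m + k, g) # y_of_x 1 v"
    for m k g and v :: "'a xword"
    by (induction k arbitrary: m) auto
  show ?thesis
    using assms by (induction w) (auto simp: x_of_y_def yw_def *)
qed

fun harm_word ::
  "('g, 'm) monoid_scheme \<Rightarrow> (nat \<times> 'g) list \<Rightarrow> (nat \<times> 'g) list \<Rightarrow> 'g ncpoly" where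
  "harm_word G [] v = of_word (x_of_y v)"
| "harm_word G u [] = of_word (x_of_y u)"
| "harm_word G ((m, g) # u) ((n, h) # v) =
     conc (of_word (yw m g)) (harm_word G u ((n, h) # v))
     + conc (of_word (yw n h)) (harm_word G ((m, g) # u) v)
     + conc (of_word (yw (m + n) (g \<otimes>\<^bsub>G\<^esub> h))) (harm_word G u v)"

text \<open>The harmonic product; meaningful on \<open>HX1 (carrier G)\<close> only.\<close>

definition harm :: "('g, 'm) monoid_scheme \<Rightarrow> 'g ncpoly \<Rightarrow> 'g ncpoly \<Rightarrow> 'g ncpoly" where
  "harm G = bilin_ext (\<lambda>u v. harm_word G (y_of_x 1 u) (y_of_x 1 v))"

text \<open>The argument \<open>h\<close> is the index of the last letter \<^term>\<open>X h\<close> passed.\<close>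

fun q_step :: "('g, 'm) monoid_scheme \<Rightarrow> 'g \<Rightarrow> 'g xword \<Rightarrow> 'g xword" where
  "q_step G h [] = []"
| "q_step G h (X0 # w) = X0 # q_step G h w"
| "q_step G h (X g # w) = X (g \<otimes>\<^bsub>G\<^esub> inv\<^bsub>G\<^esub> h) # q_step G g w"

definition q_word :: "('g, 'm) monoid_scheme \<Rightarrow> 'g xword \<Rightarrow> 'g xword" where
  "q_word G = q_step G \<one>\<^bsub>G\<^esub>"

definition q_map :: "('g, 'm) monoid_scheme \<Rightarrow> 'g ncpoly \<Rightarrow> 'g ncpoly" where
  "q_map G = lin_ext (\<lambda>w. of_word (q_word G w))"

definition q_inv :: "('g, 'm) monoid_scheme \<Rightarrow> 'g ncpoly \<Rightarrow> 'g ncpoly" where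
  "q_inv G = inv_into (HX (carrier G)) (q_map G)"


section \<open>Shuffle regularization\<close>

text \<open>
  The product of polynomials in \<open>T\<close> whose coefficients are multiplied by the
  shuffle product.
\<close>

definition sh_poly_mult :: "'g ncpoly poly \<Rightarrow> 'g ncpoly poly \<Rightarrow> 'g ncpoly poly" where
  "sh_poly_mult P Q =
     (\<Sum>i\<le>degree P. \<Sum>j\<le>degree Q. monom (sh (coeff P i) (coeff Q j)) (i + j))"

definition regT :: "('g, 'm) monoid_scheme \<Rightarrow> 'g ncpoly \<Rightarrow> 'g ncpoly poly" where
  "regT G = (THE f.
     f \<in> HX (carrier G) \<rightarrow>\<^sub>E {P. \<forall>n. coeff P n \<in> HX0 G} \<and>
     alg_hom_on (HX (carrier G)) sh (of_word []) sh_poly_mult [:of_word []:] f \<and>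
     (\<forall>p\<in>HX0 G. f p = [:p:]) \<and>
     f (of_word [X0]) = 0 \<and>
     f (of_word [X \<one>\<^bsub>G\<^esub>]) = monom (of_word []) 1)"

text \<open>Evaluation at \<open>T = 0\<close> is the constant coefficient.\<close>

definition reg :: "('g, 'm) monoid_scheme \<Rightarrow> 'g ncpoly \<Rightarrow> 'g ncpoly" where
  "reg G p = coeff (regT G p) 0"

definition Zsh ::
  "('g, 'm) monoid_scheme \<Rightarrow> ('g ncpoly \<Rightarrow> 'a::comm_rat_algebra) \<Rightarrow> 'g ncpoly \<Rightarrow> 'a poly" where
  "Zsh G Z p = map_poly Z (regT G p)"


section \<open>Module automorphisms of polynomials in \<open>T\<close>\<close>

text \<open>The exponential of a power series in \<open>u\<close> without constant term.\<close>

definition exp_fps :: "'a::comm_rat_algebra fps \<Rightarrow> 'a fps" where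
  "exp_fps S = Abs_fps (\<lambda>n. \<Sum>k\<le>n. (1 / fact k) *\<^sub>Q fps_nth (((*) S ^^ k) 1) n)"

definition exp_Tu :: "'a::comm_rat_algebra poly fps" where
  "exp_Tu = Abs_fps (\<lambda>n. monom ((1 / fact n) *\<^sub>Q 1) n)"

definition const_fps :: "'a::comm_rat_algebra fps \<Rightarrow> 'a poly fps" where
  "const_fps S = Abs_fps (\<lambda>n. [:fps_nth S n:])"

text \<open>
  The module endomorphism of polynomials in \<open>T\<close> which, coefficientwise in \<open>u\<close>, maps
  \<open>exp (T u)\<close> to \<open>S exp (T u)\<close>.  It is determined by this property as the
  \<open>n\<close>-th coefficient of \<open>exp (T u)\<close> is \<open>T\<^sup>n / n!\<close>.
\<close>

definition exp_op :: "'a::comm_rat_algebra fps \<Rightarrow> 'a poly \<Rightarrow> 'a poly" where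
  "exp_op S p =
     (\<Sum>n\<le>degree p. smult (fact n *\<^sub>Q coeff p n) (fps_nth (const_fps S * exp_Tu) n))"

lemma exp_op_altdef:
  assumes "degree p \<le> N"
  shows "exp_op S p =
    (\<Sum>n\<le>N. smult (fact n *\<^sub>Q coeff p n) (fps_nth (const_fps S * exp_Tu) n))"
  unfolding exp_op_def using assms
  by (intro sum.mono_neutral_left) (auto simp: coeff_eq_0)

lemma exp_op_add: "exp_op S (p + q) = exp_op S p + exp_op S q"
proof -
  define N where "N = max (degree p) (degree q)"
  have "degree p \<le> N" "degree q \<le> N" "degree (p + q) \<le> N"
    by (auto simp: N_def degree_add_le)
  then show ?thesis
    by (simp add: exp_op_altdef [of _ N] scaleQ_add_right smult_add_left sum.distrib)
qed

lemma scaleQ_mult_right: "(x::'a::comm_rat_algebra) * (a *\<^sub>Q y) = a *\<^sub>Q (x * y)"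
  using scaleQ_mult_left [of a y x] by (simp add: mult.commute)

lemma exp_op_smult: "exp_op S (smult c p) = smult c (exp_op S p)"
proof -
  have "degree (smult c p) \<le> degree p"
    by (rule degree_smult_le)
  moreover have "smult c (\<Sum>n\<in>A. f n) = (\<Sum>n\<in>A. smult c (f n))" for f :: "nat \<Rightarrow> 'a poly" and A
    by (induction A rule: infinite_finite_induct) (simp_all add: smult_add_right)
  ultimately show ?thesis
    by (simp add: exp_op_altdef [of _ "degree p"] scaleQ_mult_right)
qed

lemma exp_op_exp_Tu: "exp_op S (fps_nth exp_Tu n) = fps_nth (const_fps S * exp_Tu) n"
proof -
  have "degree (fps_nth (exp_Tu :: 'a poly fps) n) \<le> n"
    by (simp add: exp_Tu_def degree_monom_le)
  moreover have "(\<Sum>i\<le>n. smult (fact i *\<^sub>Q coeff (fps_nth (exp_Tu :: 'a poly fps) n) i) (f i)) = f n" for f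
  proof -
    have [simp]: "smult 1 p = p" for p :: "'a poly"
      by (rule poly_eqI) simp
    have "smult (fact i *\<^sub>Q coeff (fps_nth (exp_Tu :: 'a poly fps) n) i) (f i) =
        (if i = n then f n else 0)" for i
      by (simp add: exp_Tu_def scaleQ_scaleQ scaleQ_one)
    then show ?thesis
      by simp
  qed
  ultimately show ?thesis
    by (simp only: exp_op_altdef)
qed

definition rho :: "('g, 'm) monoid_scheme \<Rightarrow> ('g ncpoly \<Rightarrow> 'a::comm_rat_algebra) \<Rightarrow> 'a poly \<Rightarrow> 'a poly"
  where
  "rho G Z = exp_op (exp_fps (Abs_fps (\<lambda>n.
     if n \<ge> 2 then ((-1) ^ n / of_nat n) *\<^sub>Q Z (of_word (yw n \<one>\<^bsub>G\<^esub>)) else 0)))"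

definition pow_ker :: "('g, 'm) monoid_scheme \<Rightarrow> nat \<Rightarrow> 'g set" where
  "pow_ker G d = kernel G G (\<lambda>g. g [^]\<^bsub>G\<^esub> d)"

definition pow_img :: "('g, 'm) monoid_scheme \<Rightarrow> nat \<Rightarrow> 'g set" where
  "pow_img G d = (\<lambda>g. g [^]\<^bsub>G\<^esub> d) ` carrier G"

definition sigma ::
  "('g, 'm) monoid_scheme \<Rightarrow> nat \<Rightarrow> ('g ncpoly \<Rightarrow> 'a::comm_rat_algebra) \<Rightarrow> 'a poly \<Rightarrow> 'a poly" where
  "sigma G d Z = exp_op (exp_fps (Abs_fps (\<lambda>n.
     if n = 1 then \<Sum>g\<in>pow_ker G d - {\<one>\<^bsub>G\<^esub>}. Z (of_word [X g]) else 0)))"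


section \<open>Extended double shuffle and distribution relations\<close>

text \<open>
  A map on \<^term>\<open>HX0 G\<close> is represented by a function that is \<^const>\<open>undefined\<close>
  outside of it, so that equality of maps is equality of functions.
\<close>

definition EDS :: "('g, 'm) monoid_scheme \<Rightarrow> ('g ncpoly \<Rightarrow> 'a::comm_rat_algebra) set" where
  "EDS G = {Z \<in> extensional (HX0 G).
     qlinear_on (HX0 G) Z \<and>
     alg_hom_on (HX0 G) sh (of_word []) (*) 1 Z \<and>
     alg_hom_on (HX1 (carrier G)) (harm G) (of_word []) (*) [:1:]
       (inv_into UNIV (rho G Z) \<circ> Zsh G Z \<circ> q_inv G)}"

definition i_sharp :: "'g ncpoly \<Rightarrow> 'g ncpoly" where
  "i_sharp = conc_hom (\<lambda>a. of_word [a])"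

definition p_sharp :: "('g, 'm) monoid_scheme \<Rightarrow> nat \<Rightarrow> 'g ncpoly \<Rightarrow> 'g ncpoly" where
  "p_sharp G d = conc_hom (\<lambda>a. case a of
       X0 \<Rightarrow> of_nat (card (pow_ker G d)) *\<^sub>Q of_word [X0]
     | X h \<Rightarrow> \<Sum>g | g \<in> carrier G \<and> g [^]\<^bsub>G\<^esub> d = h. of_word [X g])"

definition EDSD :: "('g, 'm) monoid_scheme \<Rightarrow> ('g ncpoly \<Rightarrow> 'a::comm_rat_algebra) set" where
  "EDSD G = {Z \<in> EDS G. \<forall>d. d dvd Coset.order G \<longrightarrow>
     (\<forall>p\<in>HX (pow_img G d). Zsh G Z (p_sharp G d p) = sigma G d Z (Zsh G Z (i_sharp p)))}"


section \<open>Non-commutative formal power series\<close>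

text \<open>
  Series are coefficient functions on words; elements of the completed tensor square
  are coefficient functions on pairs of words.
\<close>

type_synonym ('g, 'a) series = "'g xword \<Rightarrow> 'a"
type_synonym ('g, 'a) series2 = "'g xword \<Rightarrow> 'g xword \<Rightarrow> 'a"

definition Xseries :: "'g set \<Rightarrow> ('g, 'a::comm_rat_algebra) series set" where
  "Xseries S = {\<Phi>. \<forall>w. w \<notin> xwords S \<longrightarrow> \<Phi> w = 0}"

definition ser_word :: "'g xword \<Rightarrow> ('g, 'a::comm_rat_algebra) series" where
  "ser_word w = (\<lambda>v. if v = w then 1 else 0)"

definition ser_mult ::
  "('g, 'a::comm_rat_algebra) series \<Rightarrow> ('g, 'a) series \<Rightarrow> ('g, 'a) series" where
  "ser_mult \<Phi> \<Psi> = (\<lambda>w. \<Sum>i\<le>length w. \<Phi> (take i w) * \<Psi> (drop i w))"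

text \<open>The exponential of a series without constant term.\<close>

definition ser_exp :: "('g, 'a::comm_rat_algebra) series \<Rightarrow> ('g, 'a) series" where
  "ser_exp \<Psi> = (\<lambda>w. \<Sum>k\<le>length w. (1 / fact k) *\<^sub>Q (ser_mult \<Psi> ^^ k) (ser_word []) w)"

definition tensor ::
  "('g, 'a::comm_rat_algebra) series \<Rightarrow> ('g, 'a) series \<Rightarrow> ('g, 'a) series2" where
  "tensor \<Phi> \<Psi> = (\<lambda>u v. \<Phi> u * \<Psi> v)"

definition ser2_mult ::
  "('g, 'a::comm_rat_algebra) series2 \<Rightarrow> ('g, 'a) series2 \<Rightarrow> ('g, 'a) series2" where
  "ser2_mult P Q = (\<lambda>u v. \<Sum>i\<le>length u. \<Sum>j\<le>length v.
     P (take i u) (take j v) * Q (drop i u) (drop j v))"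

text \<open>
  Continuous linear extensions of maps given on words.  In all uses below, the
  sums over all words \<open>w\<close> have finitely many non-zero terms if \<open>\<Phi>\<close> is supported
  on the words over a finite alphabet.
\<close>

definition ser_ext ::
  "('g xword \<Rightarrow> ('g, 'a::comm_rat_algebra) series) \<Rightarrow> ('g, 'a) series \<Rightarrow> ('g, 'a) series" where
  "ser_ext f \<Phi> = (\<lambda>v. Sum_any (\<lambda>w. \<Phi> w * f w v))"

definition ser2_ext ::
  "('g xword \<Rightarrow> ('g, 'a::comm_rat_algebra) series2) \<Rightarrow> ('g, 'a) series \<Rightarrow> ('g, 'a) series2" where
  "ser2_ext f \<Phi> = (\<lambda>u v. Sum_any (\<lambda>w. \<Phi> w * f w u v))"

definition ser_hom ::
  "('g letter \<Rightarrow> ('g, 'a::comm_rat_algebra) series) \<Rightarrow> ('g, 'a) series \<Rightarrow> ('g, 'a) series" where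
  "ser_hom f = ser_ext (\<lambda>w. foldr (\<lambda>a. ser_mult (f a)) w (ser_word []))"

definition Delta_sh :: "('g, 'a::comm_rat_algebra) series \<Rightarrow> ('g, 'a) series2" where
  "Delta_sh = ser2_ext (\<lambda>w. foldr (\<lambda>a. ser2_mult
       (\<lambda>u v. tensor (ser_word [a]) (ser_word []) u v + tensor (ser_word []) (ser_word [a]) u v))
     w (tensor (ser_word []) (ser_word [])))"

definition Delta_y ::
  "('g, 'm) monoid_scheme \<Rightarrow> nat \<Rightarrow> 'g \<Rightarrow> ('g, 'a::comm_rat_algebra) series2" where
  "Delta_y G n g = (\<lambda>u v.
     tensor (ser_word (yw n g)) (ser_word []) u v
     + tensor (ser_word []) (ser_word (yw n g)) u v
     + (\<Sum>k=1..<n. \<Sum>h\<in>carrier G.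
          tensor (ser_word (yw k h)) (ser_word (yw (n - k) (g \<otimes>\<^bsub>G\<^esub> inv\<^bsub>G\<^esub> h))) u v))"

text \<open>
  The harmonic coproduct; meaningful on series supported on
  \<open>words1 (carrier G)\<close>, that is, series in the letters \<open>y\<^sub>n\<^sub>,\<^sub>g\<close>.
\<close>

definition Delta_harm ::
  "('g, 'm) monoid_scheme \<Rightarrow> ('g, 'a::comm_rat_algebra) series \<Rightarrow> ('g, 'a) series2" where
  "Delta_harm G = ser2_ext (\<lambda>w. foldr (\<lambda>(n, g). ser2_mult (Delta_y G n g))
     (y_of_x 1 w) (tensor (ser_word []) (ser_word [])))"

definition pi_Y :: "'g set \<Rightarrow> ('g, 'a::comm_rat_algebra) series \<Rightarrow> ('g, 'a) series" where
  "pi_Y S \<Phi> = (\<lambda>w. if w \<in> words1 S then \<Phi> w else 0)"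

definition q_ser ::
  "('g, 'm) monoid_scheme \<Rightarrow> ('g, 'a::comm_rat_algebra) series \<Rightarrow> ('g, 'a) series" where
  "q_ser G = ser_ext (\<lambda>w. ser_word (q_word G w))"

definition Phi_corr ::
  "('g, 'm) monoid_scheme \<Rightarrow> ('g, 'a::comm_rat_algebra) series \<Rightarrow> ('g, 'a) series" where
  "Phi_corr G \<Phi> = ser_exp (\<lambda>w. let n = length w in
     if n \<ge> 2 \<and> w = replicate n (X \<one>\<^bsub>G\<^esub>)
     then ((-1) ^ (n - 1) / of_nat n) *\<^sub>Q \<Phi> (yw n \<one>\<^bsub>G\<^esub>) else 0)"

definition Phi_star ::
  "('g, 'm) monoid_scheme \<Rightarrow> ('g, 'a::comm_rat_algebra) series \<Rightarrow> ('g, 'a) series" where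
  "Phi_star G \<Phi> = ser_mult (Phi_corr G \<Phi>) (pi_Y (carrier G) (q_ser G \<Phi>))"

definition DMR :: "('g, 'm) monoid_scheme \<Rightarrow> ('g, 'a::comm_rat_algebra) series set" where
  "DMR G = {\<Phi> \<in> Xseries (carrier G).
     \<Phi> [X0] = 0 \<and> \<Phi> [X \<one>\<^bsub>G\<^esub>] = 0 \<and>
     Delta_sh \<Phi> = tensor \<Phi> \<Phi> \<and> \<Phi> [] = 1 \<and>
     Delta_harm G (Phi_star G \<Phi>) = tensor (Phi_star G \<Phi>) (Phi_star G \<Phi>)}"

definition i_star ::
  "('g, 'm) monoid_scheme \<Rightarrow> nat \<Rightarrow> ('g, 'a::comm_rat_algebra) series \<Rightarrow> ('g, 'a) series" where
  "i_star G d = ser_hom (\<lambda>a. case a of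
       X0 \<Rightarrow> ser_word [X0]
     | X g \<Rightarrow> (if g \<in> pow_img G d then ser_word [X g] else (\<lambda>_. 0)))"

definition p_star ::
  "('g, 'm) monoid_scheme \<Rightarrow> nat \<Rightarrow> ('g, 'a::comm_rat_algebra) series \<Rightarrow> ('g, 'a) series" where
  "p_star G d = ser_hom (\<lambda>a. case a of
       X0 \<Rightarrow> (\<lambda>w. of_nat (card (pow_ker G d)) *\<^sub>Q ser_word [X0] w)
     | X g \<Rightarrow> ser_word [X (g [^]\<^bsub>G\<^esub> d)])"

definition DMRD :: "('g, 'm) monoid_scheme \<Rightarrow> ('g, 'a::comm_rat_algebra) series set" where
  "DMRD G = {\<Phi> \<in> DMR G. \<forall>d. d dvd Coset.order G \<longrightarrow>
     p_star G d \<Phi> =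
       ser_mult (ser_exp (\<lambda>w. if w = [X \<one>\<^bsub>G\<^esub>] then \<Sum>g\<in>pow_ker G d. \<Phi> [X g] else 0))
         (i_star G d \<Phi>)}"

definition Phi_reg ::
  "('g, 'm) monoid_scheme \<Rightarrow> ('g ncpoly \<Rightarrow> 'a::comm_rat_algebra) \<Rightarrow> ('g, 'a) series" where
  "Phi_reg G Z = (\<lambda>w. if w \<in> xwords (carrier G) then Z (reg G (of_word w)) else 0)"

end

theory Submission
  imports Defs
begin

text \<open>
  A series \<open>\<Phi>\<close> is identified with the linear form \<open>lin_ext \<Phi>\<close> on polynomials whose value on a word is
  its coefficient.  Under this duality the coproducts are the transposes of the products, so
  \<open>\<Phi>\<close> is group-like for \<^const>\<open>Delta_sh\<close> iff it is a character of the shuffle algebra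
  (\<open>Delta_sh_tensor_iff\<close>), and a series in the letters \<open>y\<^sub>n\<^sub>,\<^sub>g\<close> is group-like for
  \<^const>\<open>Delta_harm\<close> iff it is a character of the harmonic algebra (\<open>Delta_harm_tensor_iff\<close>).

  Everything else rests on the operator \<open>D\<close> that removes a leading \<open>x\<^sub>1\<close> from a word and kills all
  other words.  It is a locally nilpotent derivation of the shuffle algebra with \<open>D x\<^sub>1 = 1\<close>.
  Hence \<open>\<Sum>\<^sub>n (- x\<^sub>1)\<^sup>n D\<^sup>n / n!\<close> is an algebra projection onto the kernel of \<open>D\<close>.  Combined with the
  analogous projection for the removal of a trailing \<open>x\<^sub>0\<close> it gives the projection \<open>reg0\<close> to the
  subalgebra \<^const>\<open>HX0\<close>, and the regularization map is
  \<open>p \<mapsto> \<Sum>\<^sub>n reg0 (D\<^sup>n p / n!) T\<^sup>n\<close> (\<open>regT_eq\<close>).  So homomorphisms \<open>Z\<close> on \<^const>\<open>HX0\<close> correspond to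
  shuffle characters \<open>\<Phi>\<close> vanishing on \<open>x\<^sub>0\<close> and \<open>x\<^sub>1\<close> (\<open>bij_betw_shuffle\<close>), and the \<open>n\<close>-th
  coefficient of the regularized map attached to \<open>Z\<close> is \<open>\<Phi> (D\<^sup>n p / n!)\<close> (\<open>coeff_Zsh\<close>).

  On polynomials in \<open>T\<close>, written in the basis \<open>T\<^sup>n / n!\<close>, the operators \<open>\<rho>\<close> and \<open>\<sigma>\<close> are power series
  in the derivative (\<open>coeff_exp_op\<close>), while multiplying a series from the left by a power series
  in \<open>x\<^sub>1\<close> is dual to applying that power series in \<open>D\<close>
  (\<open>lin_ext_ser_mult_letter_ser\<close>).  As \<open>D\<close> commutes with the change of indices, the map in the
  harmonic condition on \<open>Z\<close> is \<open>p \<mapsto> \<Sum>\<^sub>n \<Phi>\<^sub>* (D\<^sup>n p / n!) T\<^sup>n\<close> (\<open>rho_inv_Zsh\<close>).  Since \<open>D\<close> is also a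
  derivation of the harmonic product (\<open>dl_harm\<close>), this map is a homomorphism iff its constant term
  \<open>\<Phi>\<^sub>*\<close> is a harmonic character (\<open>harmonic_relations_iff\<close>).

  Finally, the constant term of the regularized distribution relation for \<open>Z\<close> is the
  distribution relation for \<open>\<Phi>\<close>.  As \<open>D\<close> commutes with \<^const>\<open>p_sharp\<close>, the coefficient of
  \<open>T\<^sup>n / n!\<close> at \<open>p\<close> is the constant term at \<open>D\<^sup>n p\<close>, so both relations are equivalent
  (\<open>distribution_relation_iff\<close>).
\<close>

section \<open>Rational linear maps and linear extension\<close>

lemma scaleQ_minus_left: "(- a) *\<^sub>Q x = - (a *\<^sub>Q (x::'v::rat_vector))"
  using scaleQ_add_left [of a "- a" x] by (simp add: eq_neg_iff_add_eq_0 add.commute)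

lemma scaleQ_sum_right: "a *\<^sub>Q (\<Sum>i\<in>A. f i) = (\<Sum>i\<in>A. a *\<^sub>Q (f i :: 'v::rat_vector))"
  by (induction A rule: infinite_finite_induct) (simp_all add: scaleQ_add_right)

lemma scaleQ_sum_left: "(\<Sum>i\<in>A. f i) *\<^sub>Q x = (\<Sum>i\<in>A. f i *\<^sub>Q (x :: 'v::rat_vector))"
  by (induction A rule: infinite_finite_induct) (simp_all add: scaleQ_add_left)

lemma lookup_scaleQ [simp]:
  "Poly_Mapping.lookup (a *\<^sub>Q p) w = a *\<^sub>Q Poly_Mapping.lookup p w"
  by transfer simp

lemma scaleQ_rat [simp]: "a *\<^sub>Q (b::rat) = a * b"
  by (simp add: scaleQ_rat_def)

lemma coeff_scaleQ [simp]: "coeff (a *\<^sub>Q p) n = a *\<^sub>Q coeff p n"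
  by (simp add: scaleQ_poly_def coeff_map_poly)

lemma qlinear_onI:
  "\<lbrakk>\<And>x y. \<lbrakk>x \<in> S; y \<in> S\<rbrakk> \<Longrightarrow> f (x + y) = f x + f y;
    \<And>a x. x \<in> S \<Longrightarrow> f (a *\<^sub>Q x) = a *\<^sub>Q f x\<rbrakk> \<Longrightarrow> qlinear_on S f"
  by (simp add: qlinear_on_def)

lemma qlinear_on_add: "\<lbrakk>qlinear_on S f; x \<in> S; y \<in> S\<rbrakk> \<Longrightarrow> f (x + y) = f x + f y"
  by (simp add: qlinear_on_def)

lemma qlinear_on_scaleQ: "\<lbrakk>qlinear_on S f; x \<in> S\<rbrakk> \<Longrightarrow> f (a *\<^sub>Q x) = a *\<^sub>Q f x"
  by (simp add: qlinear_on_def)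

lemma qlinear_zero: "qlinear_on UNIV f \<Longrightarrow> f 0 = 0"
  using qlinear_on_scaleQ [of UNIV f 0 0] by simp

lemma qlinear_sum:
  assumes "qlinear_on UNIV f"
  shows "f (\<Sum>i\<in>A. x i) = (\<Sum>i\<in>A. f (x i))"
  by (induction A rule: infinite_finite_induct)
     (use assms in \<open>simp_all add: qlinear_zero qlinear_on_add\<close>)

lemma qlinear_funpow:
  fixes f :: "'v::rat_vector \<Rightarrow> 'v"
  assumes "qlinear_on UNIV f"
  shows "qlinear_on UNIV (f ^^ n)"
  by (induction n) (use assms in \<open>simp_all add: qlinear_on_def\<close>)

lemma qlinear_compose:
  "\<lbrakk>qlinear_on UNIV f; qlinear_on UNIV g\<rbrakk> \<Longrightarrow> qlinear_on UNIV (\<lambda>x. f (g x))"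
  by (simp add: qlinear_on_def)

lemma qlinear_scale:
  assumes "qlinear_on UNIV f"
  shows "qlinear_on UNIV (\<lambda>x. a *\<^sub>Q f x)"
  using assms by (simp add: qlinear_on_def scaleQ_add_right scaleQ_scaleQ mult.commute)

lemma qlinear_sum_fun:
  assumes "\<And>i. i \<in> A \<Longrightarrow> qlinear_on UNIV (f i)"
  shows "qlinear_on UNIV (\<lambda>x. \<Sum>i\<in>A. f i x)"
  using assms by (simp add: qlinear_on_def sum.distrib scaleQ_sum_right)

lemma lin_ext_superset:
  assumes "finite A" "Poly_Mapping.keys p \<subseteq> A"
  shows "lin_ext f p = (\<Sum>w\<in>A. Poly_Mapping.lookup p w *\<^sub>Q f w)"
  unfolding lin_ext_def using assms
  by (intro sum.mono_neutral_left) (auto simp: in_keys_iff)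

lemma qlinear_lin_ext: "qlinear_on UNIV (lin_ext f)"
proof (rule qlinear_onI)
  fix p q :: "'a \<Rightarrow>\<^sub>0 rat"
  let ?A = "Poly_Mapping.keys p \<union> Poly_Mapping.keys q"
  have "Poly_Mapping.keys (p + q) \<subseteq> ?A"
    by (rule keys_add)
  then show "lin_ext f (p + q) = lin_ext f p + lin_ext f q"
    by (simp add: lin_ext_superset [of ?A] lookup_add scaleQ_add_left sum.distrib)
next
  fix a and p :: "'a \<Rightarrow>\<^sub>0 rat"
  have "Poly_Mapping.keys (a *\<^sub>Q p) \<subseteq> Poly_Mapping.keys p"
    by (auto simp: in_keys_iff)
  then show "lin_ext f (a *\<^sub>Q p) = a *\<^sub>Q lin_ext f p"
    by (simp add: lin_ext_superset [of "Poly_Mapping.keys p"] scaleQ_sum_right scaleQ_scaleQ)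
qed

lemmas lin_ext_add = qlinear_on_add [OF qlinear_lin_ext UNIV_I UNIV_I]
  and lin_ext_scaleQ = qlinear_on_scaleQ [OF qlinear_lin_ext UNIV_I]
  and lin_ext_zero [simp] = qlinear_zero [OF qlinear_lin_ext]
  and lin_ext_sum = qlinear_sum [OF qlinear_lin_ext]

lemma lookup_of_word: "Poly_Mapping.lookup (of_word w) v = (if v = w then 1 else 0)"
  by (simp add: of_word_def lookup_single when_def)

lemma keys_of_word [simp]: "Poly_Mapping.keys (of_word w) = {w}"
  by (simp add: of_word_def)

lemma lin_ext_of_word [simp]: "lin_ext f (of_word w) = f w"
  by (simp add: lin_ext_def lookup_of_word scaleQ_one)

lemma lin_ext_cong:
  "(\<And>w. w \<in> Poly_Mapping.keys p \<Longrightarrow> f w = g w) \<Longrightarrow> lin_ext f p = lin_ext g p"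
  by (simp add: lin_ext_def)

lemma lookup_lin_ext:
  "Poly_Mapping.lookup (lin_ext f p) v =
     (\<Sum>w\<in>Poly_Mapping.keys p. Poly_Mapping.lookup p w * Poly_Mapping.lookup (f w) v)"
  by (simp add: lin_ext_def lookup_sum)

lemma lin_ext_words: "lin_ext of_word p = p"
  by (rule poly_mapping_eqI)
     (simp add: lookup_lin_ext lookup_of_word in_keys_iff if_distrib cong: if_cong)

lemma lin_ext_fun_add: "lin_ext (\<lambda>w. f w + g w) p = lin_ext f p + lin_ext g p"
  by (simp add: lin_ext_def scaleQ_add_right sum.distrib)

lemma lin_ext_fun_scaleQ: "lin_ext (\<lambda>w. a *\<^sub>Q f w) p = a *\<^sub>Q lin_ext f p"
  by (simp add: lin_ext_def scaleQ_sum_right scaleQ_scaleQ mult.commute)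

lemma qlinear_lin_ext_commute:
  assumes "qlinear_on UNIV g"
  shows "g (lin_ext f p) = lin_ext (\<lambda>w. g (f w)) p"
  using assms by (simp add: lin_ext_def qlinear_sum qlinear_on_scaleQ)

text \<open>A linear map on the span of a set of words is determined by its values on these words.\<close>

lemma qlinear_on_words:
  fixes f :: "'g ncpoly \<Rightarrow> 'v::rat_vector"
  assumes f: "qlinear_on {p. Poly_Mapping.keys p \<subseteq> W} f" and p: "Poly_Mapping.keys p \<subseteq> W"
  shows "f p = lin_ext (\<lambda>w. f (of_word w)) p"
proof -
  let ?S = "{p. Poly_Mapping.keys p \<subseteq> W} :: 'g ncpoly set"
  have f0: "f 0 = 0"
    using qlinear_on_scaleQ [OF f, of 0 0] by simp
  have *: "(\<Sum>w\<in>A. Poly_Mapping.lookup p w *\<^sub>Q of_word w) \<in> ?S \<and>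
      f (\<Sum>w\<in>A. Poly_Mapping.lookup p w *\<^sub>Q of_word w) =
        (\<Sum>w\<in>A. Poly_Mapping.lookup p w *\<^sub>Q f (of_word w))"
    if "finite A" "A \<subseteq> W" for A
    using that
  proof (induction A rule: finite_induct)
    case (insert w A)
    let ?t = "Poly_Mapping.lookup p w *\<^sub>Q of_word w"
      and ?r = "\<Sum>w\<in>A. Poly_Mapping.lookup p w *\<^sub>Q of_word w"
    have w: "of_word w \<in> ?S" and t: "?t \<in> ?S" and r: "?r \<in> ?S"
      using insert by (auto simp: in_keys_iff lookup_of_word split: if_splits)
    moreover have "?t + ?r \<in> ?S"
      using t r keys_add [of ?t ?r] by blast
    ultimately show ?case
      using insert f by (simp add: qlinear_on_add qlinear_on_scaleQ)
  qed (use f0 in simp)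
  show ?thesis
    using * [of "Poly_Mapping.keys p"] p lin_ext_words [of p] by (simp add: lin_ext_def)
qed

lemma qlinear_eq_lin_ext:
  assumes "qlinear_on UNIV f"
  shows "f p = lin_ext (\<lambda>w. f (of_word w)) p"
  using qlinear_on_words [of UNIV f p] assms by simp

lemma qlinear_eqI:
  assumes "qlinear_on UNIV f" "qlinear_on UNIV g" "\<And>w. f (of_word w) = g (of_word w)"
  shows "f p = g p"
  using qlinear_eq_lin_ext [OF assms(1), of p] qlinear_eq_lin_ext [OF assms(2), of p] assms(3) by simp

text \<open>Two bilinear maps that agree on words are equal.\<close>

lemma bilinear_eqI:
  assumes "\<And>q. qlinear_on UNIV (\<lambda>p. f p q)" "\<And>p. qlinear_on UNIV (f p)"
    and "\<And>q. qlinear_on UNIV (\<lambda>p. g p q)" "\<And>p. qlinear_on UNIV (g p)"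
    and "\<And>u v. f (of_word u) (of_word v) = g (of_word u) (of_word v)"
  shows "f p q = g p q"
  by (rule qlinear_eqI [of "\<lambda>p. f p q" "\<lambda>p. g p q", OF assms(1,3)],
      rule qlinear_eqI [OF assms(2,4,5)])

lemma qlinear_bilin_ext_left: "qlinear_on UNIV (\<lambda>p. bilin_ext f p q)"
  unfolding bilin_ext_def by (rule qlinear_lin_ext)

lemma qlinear_bilin_ext_right: "qlinear_on UNIV (bilin_ext f p)"
  unfolding bilin_ext_def
  by (rule qlinear_onI)
     (simp_all add: lin_ext_add lin_ext_scaleQ lin_ext_fun_add lin_ext_fun_scaleQ)

lemma bilin_ext_of_word: "bilin_ext f (of_word u) (of_word v) = f u v"
  by (simp add: bilin_ext_def)

lemmas qlinear_sh_left = qlinear_bilin_ext_left [of sh_word, folded sh_def]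
  and qlinear_sh_right = qlinear_bilin_ext_right [of sh_word, folded sh_def]
  and sh_of_word = bilin_ext_of_word [of sh_word, folded sh_def]
  and qlinear_conc_left = qlinear_bilin_ext_left [of "\<lambda>u v. of_word (u @ v)", folded conc_def]
  and qlinear_conc_right = qlinear_bilin_ext_right [of "\<lambda>u v. of_word (u @ v)", folded conc_def]
  and conc_of_word = bilin_ext_of_word [of "\<lambda>u v. of_word (u @ v)", folded conc_def]

lemmas sh_add_left = qlinear_on_add [OF qlinear_sh_left UNIV_I UNIV_I]
  and sh_add_right = qlinear_on_add [OF qlinear_sh_right UNIV_I UNIV_I]
  and sh_scaleQ_left = qlinear_on_scaleQ [OF qlinear_sh_left UNIV_I]
  and sh_scaleQ_right = qlinear_on_scaleQ [OF qlinear_sh_right UNIV_I]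
  and sh_zero_left [simp] = qlinear_zero [OF qlinear_sh_left]
  and sh_zero_right [simp] = qlinear_zero [OF qlinear_sh_right]
  and sh_sum_left = qlinear_sum [OF qlinear_sh_left]
  and sh_sum_right = qlinear_sum [OF qlinear_sh_right]

lemma conc_word: "conc (of_word u) p = lin_ext (\<lambda>v. of_word (u @ v)) p"
  by (simp add: conc_def bilin_ext_def)

lemma lookup_conc_word:
  "Poly_Mapping.lookup (conc (of_word u) p) w =
     (if take (length u) w = u then Poly_Mapping.lookup p (drop (length u) w) else 0)"
proof -
  have "(w = u @ v) \<longleftrightarrow> (take (length u) w = u \<and> v = drop (length u) w)" for v
    using append_eq_conv_conj [of u v w] by auto
  then show ?thesis
    by (simp add: conc_word lookup_lin_ext lookup_of_word in_keys_iff if_distrib cong: if_cong)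
qed

lemma lookup_conc_letter:
  "Poly_Mapping.lookup (conc (of_word [a]) p) w =
     (case w of [] \<Rightarrow> 0 | b # v \<Rightarrow> if b = a then Poly_Mapping.lookup p v else 0)"
  by (cases w) (simp_all add: lookup_conc_word)


section \<open>Removing the first or the last letter\<close>

text \<open>
  The linear map that strips a leading letter \<open>a\<close> from a word and annihilates all words
  which do not start with \<open>a\<close>.
\<close>

lift_definition dl :: "'g letter \<Rightarrow> 'g ncpoly \<Rightarrow> 'g ncpoly" is
  "\<lambda>a p w. p (a # w)"
proof -
  fix a :: "'g letter" and p :: "'g xword \<Rightarrow> rat"
  assume "finite {w. p w \<noteq> 0}"
  then have "finite ((#) a -` {w. p w \<noteq> 0})"
    by (rule finite_vimageI) simp
  then show "finite {w. p (a # w) \<noteq> 0}"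
    by (simp add: vimage_def)
qed

text \<open>The same at the end of a word.\<close>

lift_definition dr :: "'g letter \<Rightarrow> 'g ncpoly \<Rightarrow> 'g ncpoly" is
  "\<lambda>a p w. p (w @ [a])"
proof -
  fix a :: "'g letter" and p :: "'g xword \<Rightarrow> rat"
  assume "finite {w. p w \<noteq> 0}"
  then have "finite ((\<lambda>w. w @ [a]) -` {w. p w \<noteq> 0})"
    by (rule finite_vimageI) (simp add: inj_def)
  then show "finite {w. p (w @ [a]) \<noteq> 0}"
    by (simp add: vimage_def)
qed

lemma lookup_dl [simp]: "Poly_Mapping.lookup (dl a p) w = Poly_Mapping.lookup p (a # w)"
  by transfer simp

lemma lookup_dr [simp]: "Poly_Mapping.lookup (dr a p) w = Poly_Mapping.lookup p (w @ [a])"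
  by transfer simp

lemma qlinear_dl: "qlinear_on UNIV (dl a)"
  by (rule qlinear_onI; rule poly_mapping_eqI) (simp_all add: lookup_add)

lemma qlinear_dr: "qlinear_on UNIV (dr a)"
  by (rule qlinear_onI; rule poly_mapping_eqI) (simp_all add: lookup_add)

lemmas dl_add = qlinear_on_add [OF qlinear_dl UNIV_I UNIV_I]
  and dl_scaleQ = qlinear_on_scaleQ [OF qlinear_dl UNIV_I]
  and dl_zero [simp] = qlinear_zero [OF qlinear_dl]
  and dr_add = qlinear_on_add [OF qlinear_dr UNIV_I UNIV_I]

lemma lookup_dl_funpow:
  "Poly_Mapping.lookup ((dl a ^^ n) p) w = Poly_Mapping.lookup p (replicate n a @ w)"
  by (induction n arbitrary: w) (simp_all add: replicate_app_Cons_same)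

lemma lookup_dr_funpow:
  "Poly_Mapping.lookup ((dr a ^^ n) p) w = Poly_Mapping.lookup p (w @ replicate n a)"
  by (induction n arbitrary: w) (simp_all add: replicate_app_Cons_same)

lemma dl_of_word_Nil [simp]: "dl a (of_word []) = 0"
  by (rule poly_mapping_eqI) (simp add: lookup_of_word)

lemma dl_of_word_Cons: "dl a (of_word (b # w)) = (if a = b then of_word w else 0)"
  by (rule poly_mapping_eqI) (simp add: lookup_of_word)

lemma dr_of_word_Nil [simp]: "dr a (of_word []) = 0"
  by (rule poly_mapping_eqI) (simp add: lookup_of_word)

lemma dr_of_word_snoc: "dr a (of_word (w @ [b])) = (if a = b then of_word w else 0)"
  by (rule poly_mapping_eqI) (simp add: lookup_of_word)

lemma dl_conc_letter: "dl a (conc (of_word [b]) p) = (if a = b then p else 0)"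
  by (rule poly_mapping_eqI) (simp add: lookup_conc_letter)

lemma dl_dr_commute: "dl a (dr b p) = dr b (dl a p)"
  by (rule poly_mapping_eqI) simp

lemma poly_mapping_eq_dlI:
  fixes p q :: "'g ncpoly"
  assumes "Poly_Mapping.lookup p [] = Poly_Mapping.lookup q []" "\<And>a. dl a p = dl a q"
  shows "p = q"
proof (rule poly_mapping_eqI)
  fix w
  show "Poly_Mapping.lookup p w = Poly_Mapping.lookup q w"
    using assms(1) arg_cong [OF assms(2) [of "hd w"], of "\<lambda>p. Poly_Mapping.lookup p (tl w)"]
    by (cases w) simp_all
qed


section \<open>The shuffle product\<close>

lemma sh_word_Nil_right [simp]: "sh_word u [] = of_word u"
  by (cases u) simp_all

lemma sh_one_left [simp]: "sh (of_word []) p = p"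
  by (rule qlinear_eqI [OF qlinear_sh_right]) (simp_all add: qlinear_on_def sh_of_word)

lemma sh_one_right [simp]: "sh p (of_word []) = p"
  by (rule qlinear_eqI [OF qlinear_sh_left]) (simp_all add: qlinear_on_def sh_of_word)

lemma lookup_sh_Nil:
  "Poly_Mapping.lookup (sh p q) [] = Poly_Mapping.lookup p [] * Poly_Mapping.lookup q []"
proof (rule bilinear_eqI [where f = "\<lambda>p q. Poly_Mapping.lookup (sh p q) []"
      and g = "\<lambda>p q. Poly_Mapping.lookup p [] * Poly_Mapping.lookup q []"])
  fix u v :: "'a xword"
  show "Poly_Mapping.lookup (sh (of_word u) (of_word v)) [] =
      Poly_Mapping.lookup (of_word u) [] * Poly_Mapping.lookup (of_word v) []"
    unfolding sh_of_word
    by (cases "(u, v)" rule: sh_word.cases) (simp_all add: lookup_of_word lookup_add lookup_conc_letter)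
qed (auto simp: qlinear_on_def lookup_add sh_add_left sh_add_right sh_scaleQ_left sh_scaleQ_right
    algebra_simps)

text \<open>
  This is the recursion of the shuffle product, extended to polynomials.  It allows to compare
  polynomials coefficientwise by induction on the word at which the coefficient is taken, with
  arbitrary arguments of the products; the following laws are proved in this way.
\<close>

lemma dl_sh: "dl a (sh p q) = sh (dl a p) q + sh p (dl a q)"
proof (rule bilinear_eqI [where f = "\<lambda>p q. dl a (sh p q)"
      and g = "\<lambda>p q. sh (dl a p) q + sh p (dl a q)"])
  fix u v :: "'a xword"
  show "dl a (sh (of_word u) (of_word v)) =
      sh (dl a (of_word u)) (of_word v) + sh (of_word u) (dl a (of_word v))"
    by (cases "(u, v)" rule: sh_word.cases)
       (simp_all add: sh_of_word dl_of_word_Cons dl_add dl_conc_letter)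
qed (auto simp: qlinear_on_def sh_add_left sh_add_right sh_scaleQ_left sh_scaleQ_right
    dl_add dl_scaleQ scaleQ_add_right algebra_simps)

lemma sh_commute: "sh p q = sh q p"
proof (rule poly_mapping_eqI)
  fix w
  show "Poly_Mapping.lookup (sh p q) w = Poly_Mapping.lookup (sh q p) w"
  proof (induction w arbitrary: p q)
    case (Cons a w)
    have "Poly_Mapping.lookup (dl a (sh p q)) w = Poly_Mapping.lookup (dl a (sh q p)) w"
      by (simp only: dl_sh lookup_add Cons.IH [of "dl a p"] Cons.IH [of p] add.commute)
    then show ?case
      by simp
  qed (simp add: lookup_sh_Nil)
qed

lemma sh_assoc: "sh (sh p q) r = sh p (sh q r)"
proof (rule poly_mapping_eqI)
  fix w
  show "Poly_Mapping.lookup (sh (sh p q) r) w = Poly_Mapping.lookup (sh p (sh q r)) w"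
  proof (induction w arbitrary: p q r)
    case (Cons a w)
    have "Poly_Mapping.lookup (dl a (sh (sh p q) r)) w = Poly_Mapping.lookup (dl a (sh p (sh q r))) w"
      by (simp only: dl_sh lookup_add sh_add_left sh_add_right Cons.IH add.assoc)
    then show ?case
      by simp
  qed (simp add: lookup_sh_Nil)
qed

lemma dr_sh: "dr b (sh p q) = sh (dr b p) q + sh p (dr b q)"
proof (rule poly_mapping_eqI)
  fix w
  show "Poly_Mapping.lookup (dr b (sh p q)) w =
      Poly_Mapping.lookup (sh (dr b p) q + sh p (dr b q)) w"
  proof (induction w arbitrary: p q)
    case Nil
    have "Poly_Mapping.lookup (dr b (sh p q)) [] = Poly_Mapping.lookup (dl b (sh p q)) []"
      by simp
    then show ?case
      by (simp only: dl_sh) (simp add: lookup_add lookup_sh_Nil)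
  next
    case (Cons a w)
    have "Poly_Mapping.lookup (dl a (dr b (sh p q))) w =
        Poly_Mapping.lookup (dl a (sh (dr b p) q + sh p (dr b q))) w"
      by (simp only: dl_dr_commute [of a b "sh p q"] dl_sh dl_add dr_add lookup_add Cons.IH
          dl_dr_commute add.assoc add.left_commute)
    then show ?case
      by simp
  qed
qed

lemma sh_left_commute: "sh p (sh q r) = sh q (sh p r)"
  by (metis sh_assoc sh_commute)

text \<open>The word \<open>a\<^sup>n\<close> is the \<open>n\<close>-th divided shuffle power of the letter \<open>a\<close>.\<close>

lemma sh_replicate:
  "sh (of_word (replicate i a)) (of_word (replicate j a)) =
     of_nat ((i + j) choose i) *\<^sub>Q of_word (replicate (i + j) a)"
proof (induction "i + j" arbitrary: i j)
  case (Suc n)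
  show ?case
  proof (cases i; cases j)
    fix i' j'
    assume [simp]: "i = Suc i'" "j = Suc j'"
    show ?thesis
    proof (rule poly_mapping_eq_dlI)
      show "dl b (sh (of_word (replicate i a)) (of_word (replicate j a))) =
          dl b (of_nat (i + j choose i) *\<^sub>Q of_word (replicate (i + j) a))" for b
        using Suc(1) [of i' j] Suc(1) [of i j'] Suc(2)
        by (simp add: dl_sh dl_add dl_of_word_Cons dl_scaleQ scaleQ_add_left add.commute)
    qed (simp add: lookup_sh_Nil lookup_of_word)
  qed (simp_all add: scaleQ_one)
qed (simp add: scaleQ_one)

lemma sh_word_letters: "w \<in> Poly_Mapping.keys (sh_word u v) \<Longrightarrow> set w = set u \<union> set v"
proof (induction u v arbitrary: w rule: sh_word.induct)
  case (3 a u b v)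
  obtain c w' where w: "w = c # w'"
    and *: "c = a \<and> w' \<in> Poly_Mapping.keys (sh_word u (b # v)) \<or>
      c = b \<and> w' \<in> Poly_Mapping.keys (sh_word (a # u) v)"
    using "3.prems" by (cases w) (auto simp: in_keys_iff lookup_add lookup_conc_letter split: if_splits)
  show ?case
    using * "3.IH" [of w'] unfolding w by auto
qed (auto simp: in_keys_iff lookup_of_word split: if_splits)

lemma keys_lin_ext:
  fixes f :: "'w \<Rightarrow> 'v \<Rightarrow>\<^sub>0 rat"
  shows
  "Poly_Mapping.keys (lin_ext f p) \<subseteq> (\<Union>w\<in>Poly_Mapping.keys p. Poly_Mapping.keys (f w))"
proof
  fix v
  assume "v \<in> Poly_Mapping.keys (lin_ext f p)"
  then have "(\<Sum>w\<in>Poly_Mapping.keys p. Poly_Mapping.lookup p w * Poly_Mapping.lookup (f w) v) \<noteq> 0"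
    by (simp add: in_keys_iff lookup_lin_ext)
  then obtain w where "w \<in> Poly_Mapping.keys p" "Poly_Mapping.lookup (f w) v \<noteq> 0"
    by (metis (no_types, lifting) mult_zero_right sum.neutral)
  then show "v \<in> (\<Union>w\<in>Poly_Mapping.keys p. Poly_Mapping.keys (f w))"
    by (auto simp: in_keys_iff)
qed


section \<open>Locally nilpotent derivations of the shuffle algebra\<close>

lemma leibniz_funpow:
  fixes D :: "'v::rat_vector \<Rightarrow> 'v"
  assumes lin: "qlinear_on UNIV D"
    and closed: "\<And>p. p \<in> W \<Longrightarrow> D p \<in> W"
    and leibniz: "\<And>p q. \<lbrakk>p \<in> W; q \<in> W\<rbrakk> \<Longrightarrow> D (mul p q) = mul (D p) q + mul p (D q)"
    and "p \<in> W" "q \<in> W"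
  shows "(D ^^ n) (mul p q) =
    (\<Sum>i\<le>n. of_nat (n choose i) *\<^sub>Q mul ((D ^^ i) p) ((D ^^ (n - i)) q))"
proof (induction n)
  case (Suc n)
  define f where "f i j = mul ((D ^^ i) p) ((D ^^ j) q)" for i j
  have W: "(D ^^ i) r \<in> W" if "r \<in> W" for i r
    by (induction i) (use that closed in auto)
  have D: "D (f i j) = f (Suc i) j + f i (Suc j)" for i j
    by (simp add: f_def leibniz W assms)
  have "(D ^^ Suc n) (mul p q) = D (\<Sum>i\<le>n. of_nat (n choose i) *\<^sub>Q f i (n - i))"
    using Suc by (simp add: f_def)
  also have "\<dots> = (\<Sum>i\<le>n. of_nat (n choose i) *\<^sub>Q f (Suc i) (n - i)) +
      (\<Sum>i\<le>n. of_nat (n choose i) *\<^sub>Q f i (Suc n - i))"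
    by (simp add: qlinear_sum [OF lin] qlinear_on_scaleQ [OF lin] D scaleQ_add_right sum.distrib
        Suc_diff_le)
  also have "(\<Sum>i\<le>n. of_nat (n choose i) *\<^sub>Q f i (Suc n - i)) =
      (\<Sum>i\<le>Suc n. of_nat (n choose i) *\<^sub>Q f i (Suc n - i))"
    by (simp add: binomial_eq_0)
  also have "\<dots> = f 0 (Suc n) + (\<Sum>i\<le>n. of_nat (n choose Suc i) *\<^sub>Q f (Suc i) (n - i))"
    by (simp add: sum.atMost_Suc_shift scaleQ_one del: sum.atMost_Suc)
  finally have "(D ^^ Suc n) (mul p q) =
      f 0 (Suc n) + (\<Sum>i\<le>n. of_nat (Suc n choose Suc i) *\<^sub>Q f (Suc i) (n - i))"
    by (simp add: scaleQ_add_left sum.distrib algebra_simps)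
  also have "\<dots> = (\<Sum>i\<le>Suc n. of_nat (Suc n choose i) *\<^sub>Q f i (Suc n - i))"
    by (simp add: sum.atMost_Suc_shift scaleQ_one del: sum.atMost_Suc binomial_Suc_Suc)
  finally show ?case
    by (simp add: f_def)
qed (simp add: scaleQ_one)

text \<open>The divided powers \<open>D\<^sup>n / n!\<close> of an endomorphism.\<close>

definition dpow :: "('v \<Rightarrow> 'v) \<Rightarrow> nat \<Rightarrow> 'v::rat_vector \<Rightarrow> 'v" where
  "dpow D n p = (1 / fact n) *\<^sub>Q (D ^^ n) p"

lemma dpow_0 [simp]: "dpow D 0 p = p"
  by (simp add: dpow_def scaleQ_one)

lemma qlinear_dpow: "qlinear_on UNIV D \<Longrightarrow> qlinear_on UNIV (dpow D n)"
  unfolding dpow_def by (intro qlinear_scale qlinear_funpow)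

lemma dpow_leibniz:
  fixes D :: "'v::rat_vector \<Rightarrow> 'v"
  assumes lin: "qlinear_on UNIV D"
    and closed: "\<And>p. p \<in> W \<Longrightarrow> D p \<in> W"
    and leibniz: "\<And>p q. \<lbrakk>p \<in> W; q \<in> W\<rbrakk> \<Longrightarrow> D (mul p q) = mul (D p) q + mul p (D q)"
    and mul: "\<And>q. qlinear_on UNIV (\<lambda>p. mul p q)" "\<And>p. qlinear_on UNIV (mul p)"
    and pq: "p \<in> W" "q \<in> W"
  shows "dpow D n (mul p q) = (\<Sum>i\<le>n. mul (dpow D i p) (dpow D (n - i) q))"
proof -
  have "of_nat (n choose i) / (fact n :: rat) = 1 / fact i * (1 / fact (n - i))" if "i \<le> n" for i
    using that by (simp add: binomial_fact)
  moreover have "(D ^^ n) (mul p q) =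
      (\<Sum>i\<le>n. of_nat (n choose i) *\<^sub>Q mul ((D ^^ i) p) ((D ^^ (n - i)) q))"
    by (rule leibniz_funpow [of D W mul, OF lin closed leibniz pq])
  ultimately show ?thesis
    by (simp add: dpow_def scaleQ_sum_right scaleQ_scaleQ qlinear_on_scaleQ [OF mul(1)]
        qlinear_on_scaleQ [OF mul(2)] mult.commute)
qed

lemma D_dpow:
  fixes D :: "'v::rat_vector \<Rightarrow> 'v"
  assumes "qlinear_on UNIV D"
  shows "D (dpow D n p) = of_nat (Suc n) *\<^sub>Q dpow D (Suc n) p"
  using assms by (simp add: dpow_def qlinear_on_scaleQ scaleQ_scaleQ)

text \<open>The length of the longest word in the support.\<close>

definition maxlen :: "'g ncpoly \<Rightarrow> nat" where
  "maxlen p = Max (insert 0 (length ` Poly_Mapping.keys p))"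

lemma length_le_maxlen: "w \<in> Poly_Mapping.keys p \<Longrightarrow> length w \<le> maxlen p"
  by (simp add: maxlen_def)

text \<open>A sum over a square with zero terms above the antidiagonal, rearranged by antidiagonals.\<close>

lemma sum_square_eq_triangle:
  fixes f :: "nat \<Rightarrow> nat \<Rightarrow> 'v::comm_monoid_add"
  assumes "\<And>i j. i + j > N \<Longrightarrow> f i j = 0"
  shows "(\<Sum>i\<le>N. \<Sum>j\<le>N. f i j) = (\<Sum>n\<le>N. \<Sum>i\<le>n. f i (n - i))"
proof -
  have "(\<Sum>n\<le>N. \<Sum>i\<le>n. f i (n - i)) = (\<Sum>(i, j)\<in>{(i, j). i + j \<le> N}. f i j)"
    by (rule sum.triangle_reindex_eq [symmetric])
  also have "\<dots> = (\<Sum>(i, j)\<in>{..N} \<times> {..N}. f i j)"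
    by (rule sum.mono_neutral_left) (auto simp: not_le intro!: assms)
  finally show ?thesis
    by (simp add: sum.cartesian_product)
qed

text \<open>
  A derivation \<open>D\<close> of the shuffle algebra with \<open>D a = 1\<close> for some letter \<open>a\<close> such that \<open>D\<^sup>n\<close>
  kills all polynomials of length less than \<open>n\<close>, and a subalgebra \<open>U\<close> which contains \<open>a\<close> and is
  stable under \<open>D\<close>.
\<close>

locale shuffle_derivation =
  fixes D :: "'g ncpoly \<Rightarrow> 'g ncpoly" and a :: "'g letter" and U :: "'g ncpoly set"
  assumes lin: "qlinear_on UNIV D"
    and leibniz: "D (sh p q) = sh (D p) q + sh p (D q)"
    and D_one: "D (of_word []) = 0"
    and D_letter: "D (of_word [a]) = of_word []"
    and nilpotent: "n > maxlen p \<Longrightarrow> (D ^^ n) p = 0"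
    and U_add: "\<lbrakk>p \<in> U; q \<in> U\<rbrakk> \<Longrightarrow> p + q \<in> U"
    and U_scaleQ: "p \<in> U \<Longrightarrow> c *\<^sub>Q p \<in> U"
    and U_sh: "\<lbrakk>p \<in> U; q \<in> U\<rbrakk> \<Longrightarrow> sh p q \<in> U"
    and U_D: "p \<in> U \<Longrightarrow> D p \<in> U"
    and U_one: "of_word [] \<in> U"
    and U_letter: "of_word [a] \<in> U"
begin

lemma D_zero [simp]: "D 0 = 0"
  by (rule qlinear_zero [OF lin])

lemma dpow_eq_0: "n > maxlen p \<Longrightarrow> dpow D n p = 0"
  by (simp add: dpow_def nilpotent)

text \<open>By the next lemma, \<open>p \<mapsto> \<Sum>\<^sub>n (D\<^sup>n p / n!) T\<^sup>n\<close> is an algebra homomorphism.\<close>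

lemma dpow_sh: "dpow D n (sh p q) = (\<Sum>i\<le>n. sh (dpow D i p) (dpow D (n - i) q))"
  by (rule dpow_leibniz [where W = UNIV])
     (simp_all add: lin leibniz qlinear_sh_left qlinear_sh_right)

lemma U_dpow: "p \<in> U \<Longrightarrow> dpow D n p \<in> U"
proof -
  assume "p \<in> U"
  then have "(D ^^ n) p \<in> U"
    by (induction n) (simp_all add: U_D)
  then show ?thesis
    by (simp add: dpow_def U_scaleQ)
qed

lemma dpow_ker: "D p = 0 \<Longrightarrow> dpow D n p = (if n = 0 then p else 0)"
  by (cases n) (simp_all add: dpow_def scaleQ_one funpow_swap1 qlinear_zero [OF qlinear_funpow [OF lin]])

text \<open>The \<open>n\<close>-th shuffle power of \<open>- a\<close>.\<close>

definition pw :: "nat \<Rightarrow> 'g ncpoly" where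
  "pw n = ((- 1) ^ n * fact n) *\<^sub>Q of_word (replicate n a)"

lemma pw_0 [simp]: "pw 0 = of_word []"
  by (simp add: pw_def scaleQ_one)

lemma pw_add: "sh (pw i) (pw j) = pw (i + j)"
proof -
  have "(fact i * fact j * of_nat (i + j choose i) :: rat) = fact (i + j)"
    using binomial_fact [of i "i + j", where ?'a = rat] by simp
  then have *: "(- 1) ^ i * fact i * ((- 1) ^ j * fact j) * of_nat (i + j choose i) =
      ((- 1) ^ (i + j) * fact (i + j) :: rat)"
    by (simp add: power_add ac_simps)
  have "sh (pw i) (pw j) = ((- 1) ^ i * fact i * ((- 1) ^ j * fact j) * of_nat (i + j choose i)) *\<^sub>Q
      of_word (replicate (i + j) a)"
    by (simp add: pw_def sh_scaleQ_left sh_scaleQ_right sh_replicate scaleQ_scaleQ ac_simps)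
  then show ?thesis
    by (simp only: * pw_def)
qed

lemma pw_Suc: "pw (Suc n) = sh (pw n) ((- 1) *\<^sub>Q of_word [a])"
  using pw_add [of n 1] by (simp add: pw_def)

lemma U_pw: "pw n \<in> U"
proof (induction n)
  case (Suc n)
  then show ?case
    unfolding pw_Suc by (intro U_sh U_scaleQ U_letter)
qed (simp add: U_one)

lemma D_pw: "D (pw (Suc n)) = - of_nat (Suc n) *\<^sub>Q pw n"
proof (induction n)
  case 0
  show ?case
    by (simp add: pw_Suc qlinear_on_scaleQ [OF lin] D_letter)
next
  case (Suc n)
  have 1: "D (pw 1) = (- 1) *\<^sub>Q of_word []"
    by (simp add: pw_def qlinear_on_scaleQ [OF lin] D_letter)
  have 2: "sh (pw n) (pw 1) = pw (Suc n)" "sh (pw (Suc n)) (pw 1) = pw (Suc (Suc n))"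
    by (simp_all add: pw_add)
  have "D (pw (Suc (Suc n))) = (- of_nat (Suc n)) *\<^sub>Q pw (Suc n) + (- 1) *\<^sub>Q pw (Suc n)"
    using leibniz [of "pw (Suc n)" "pw 1"]
    by (simp only: 2 Suc.IH 1 sh_scaleQ_left sh_scaleQ_right sh_one_right)
  also have "\<dots> = (- of_nat (Suc (Suc n))) *\<^sub>Q pw (Suc n)"
    by (simp flip: scaleQ_add_left)
  finally show ?case .
qed

text \<open>
  As \<open>D\<close> is locally nilpotent and \<open>D a = 1\<close>, the Taylor expansion at \<open>- a\<close>, that is, the series
  \<open>\<Sum>\<^sub>n (- a)\<^sup>n D\<^sup>n / n!\<close>, is an algebra homomorphism onto the kernel of \<open>D\<close>.
\<close>

definition proj :: "'g ncpoly \<Rightarrow> 'g ncpoly" where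
  "proj p = (\<Sum>n\<le>maxlen p. sh (pw n) (dpow D n p))"

lemma proj_eq: "maxlen p \<le> N \<Longrightarrow> proj p = (\<Sum>n\<le>N. sh (pw n) (dpow D n p))"
  unfolding proj_def by (rule sum.mono_neutral_left) (auto simp: dpow_eq_0)

lemma qlinear_proj: "qlinear_on UNIV proj"
proof (rule qlinear_onI)
  fix p q :: "'g ncpoly"
  define N where "N = max (maxlen p) (max (maxlen q) (maxlen (p + q)))"
  have "maxlen p \<le> N" "maxlen q \<le> N" "maxlen (p + q) \<le> N"
    by (simp_all add: N_def)
  then show "proj (p + q) = proj p + proj q"
    by (simp add: proj_eq [of _ N] qlinear_on_add [OF qlinear_dpow [OF lin]] sh_add_right sum.distrib)
next
  fix c and p :: "'g ncpoly"
  define N where "N = max (maxlen p) (maxlen (c *\<^sub>Q p))"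
  have "maxlen p \<le> N" "maxlen (c *\<^sub>Q p) \<le> N"
    by (simp_all add: N_def)
  then show "proj (c *\<^sub>Q p) = c *\<^sub>Q proj p"
    by (simp add: proj_eq [of _ N] qlinear_on_scaleQ [OF qlinear_dpow [OF lin]] sh_scaleQ_right
        scaleQ_sum_right)
qed

lemma proj_sh: "proj (sh p q) = sh (proj p) (proj q)"
proof -
  define N where "N = max (maxlen p + maxlen q) (maxlen (sh p q))"
  have N: "maxlen p + maxlen q \<le> N" "maxlen (sh p q) \<le> N"
    by (simp_all add: N_def)
  have zero: "sh (sh (pw i) (dpow D i p)) (sh (pw j) (dpow D j q)) = 0" if "N < i + j" for i j
  proof -
    have "maxlen p < i \<or> maxlen q < j"
      using that N(1) by linarith
    then show ?thesis
      by (auto simp: dpow_eq_0)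
  qed
  have "proj (sh p q) = (\<Sum>n\<le>N. \<Sum>i\<le>n. sh (pw n) (sh (dpow D i p) (dpow D (n - i) q)))"
    by (simp add: proj_eq [OF N(2)] dpow_sh sh_sum_right)
  also have "\<dots> = (\<Sum>n\<le>N. \<Sum>i\<le>n. sh (sh (pw i) (dpow D i p)) (sh (pw (n - i)) (dpow D (n - i) q)))"
  proof (intro sum.cong refl)
    fix n i :: nat
    assume "i \<in> {..n}"
    then have "pw n = sh (pw i) (pw (n - i))"
      by (simp add: pw_add)
    then show "sh (pw n) (sh (dpow D i p) (dpow D (n - i) q)) =
        sh (sh (pw i) (dpow D i p)) (sh (pw (n - i)) (dpow D (n - i) q))"
      by (simp only: sh_assoc sh_left_commute)
  qed
  also have "\<dots> = (\<Sum>i\<le>N. \<Sum>j\<le>N. sh (sh (pw i) (dpow D i p)) (sh (pw j) (dpow D j q)))"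
    by (rule sum_square_eq_triangle [symmetric]) (rule zero)
  also have "\<dots> = sh (proj p) (proj q)"
    using N(1) by (simp add: proj_eq [of _ N] sh_sum_left sh_sum_right) (rule sum.swap)
  finally show ?thesis .
qed

lemma D_proj: "D (proj p) = 0"
proof -
  \<comment> \<open>By the product rule, \<open>D\<close> applied to the summands of \<open>proj p\<close> gives a telescoping sum.\<close>
  define T where "T n = of_nat n *\<^sub>Q sh (pw (n - 1)) (dpow D n p)" for n
  have step: "D (sh (pw n) (dpow D n p)) = T (Suc n) - T n" for n
  proof (cases n)
    case 0
    then show ?thesis
      by (simp add: T_def D_one D_dpow [OF lin, of 0, simplified])
  next
    case (Suc m)
    then show ?thesis
      by (simp add: leibniz D_pw D_dpow [OF lin] T_def sh_scaleQ_left sh_scaleQ_right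
          scaleQ_minus_left [symmetric])
  qed
  have "D (proj p) = (\<Sum>n\<le>maxlen p. T (Suc n) - T n)"
    by (simp add: proj_def qlinear_sum [OF lin] step)
  also have "\<dots> = T (Suc (maxlen p)) - T 0"
    using sum_lessThan_telescope [of T "Suc (maxlen p)"] by (simp only: lessThan_Suc_atMost)
  also have "\<dots> = 0"
    by (simp add: T_def dpow_eq_0)
  finally show ?thesis .
qed

lemma proj_ker: "D p = 0 \<Longrightarrow> proj p = p"
  by (simp add: proj_def dpow_ker if_distrib [of "sh _"] cong: if_cong)

lemma proj_letter: "proj (of_word [a]) = 0"
proof -
  have "proj (of_word [a]) = (\<Sum>n\<le>1. sh (pw n) (dpow D n (of_word [a])))"
    by (rule proj_eq) (simp add: maxlen_def)
  also have "\<dots> = of_word [a] + (- 1) *\<^sub>Q of_word [a]"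
    by (simp add: pw_def dpow_def D_letter scaleQ_one)
  finally show ?thesis
    by (simp add: scaleQ_minus_left scaleQ_one)
qed

lemma U_sum: "(\<And>i. i \<in> A \<Longrightarrow> f i \<in> U) \<Longrightarrow> (\<Sum>i\<in>A. f i) \<in> U"
proof (induction A rule: infinite_finite_induct)
  case (insert x A)
  then show ?case
    by (simp add: U_add)
qed (use U_scaleQ [OF U_one, of 0] in simp_all)

lemma U_proj: "p \<in> U \<Longrightarrow> proj p \<in> U"
  unfolding proj_def by (intro U_sum U_sh U_pw U_dpow)

lemma proj_commute:
  assumes E: "qlinear_on UNIV E" "\<And>p q. E (sh p q) = sh (E p) q + sh p (E q)"
    "E (of_word []) = 0" "E (of_word [a]) = 0" and comm: "\<And>p. E (D p) = D (E p)"
  shows "E (proj p) = proj (E p)"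
proof -
  define N where "N = max (maxlen p) (maxlen (E p))"
  have N: "maxlen p \<le> N" "maxlen (E p) \<le> N"
    by (simp_all add: N_def)
  have "E (pw n) = 0" for n :: nat
    by (induction n) (simp_all add: pw_Suc E qlinear_on_scaleQ [OF E(1)])
  moreover have "E ((D ^^ n) q) = (D ^^ n) (E q)" for n q
    by (induction n) (simp_all add: comm)
  ultimately show ?thesis
    by (simp add: proj_eq [OF N(1)] proj_eq [OF N(2)] qlinear_sum [OF E(1)] E(2) dpow_def
        qlinear_on_scaleQ [OF E(1)])
qed

text \<open>The algebra \<open>U\<close> is generated by \<open>a\<close> and the kernel of \<open>D\<close>.\<close>

lemma generated:
  assumes V_add: "\<And>p q. \<lbrakk>p \<in> V; q \<in> V\<rbrakk> \<Longrightarrow> p + q \<in> V"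
    and V_scaleQ: "\<And>p c. p \<in> V \<Longrightarrow> c *\<^sub>Q p \<in> V"
    and V_sh: "\<And>p q. \<lbrakk>p \<in> V; q \<in> V\<rbrakk> \<Longrightarrow> sh p q \<in> V"
    and V_letter: "of_word [a] \<in> V"
    and V_ker: "\<And>p. \<lbrakk>p \<in> U; D p = 0\<rbrakk> \<Longrightarrow> p \<in> V"
    and p: "p \<in> U"
  shows "p \<in> V"
proof -
  have V_one: "of_word [] \<in> V"
    by (intro V_ker U_one D_one)
  have V_pw: "pw n \<in> V" for n
  proof (induction n)
    case (Suc n)
    then show ?case
      unfolding pw_Suc by (intro V_sh V_scaleQ V_letter)
  qed (simp add: V_one)
  have V_sum: "(\<Sum>i\<in>A. f i) \<in> V" if "\<And>i. i \<in> A \<Longrightarrow> f i \<in> V" for f and A :: "nat set"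
    using that
  proof (induction A rule: infinite_finite_induct)
    case (insert x A)
    then show ?case
      by (simp add: V_add)
  qed (use V_scaleQ [OF V_one, of 0] in simp_all)
  \<comment> \<open>In the Taylor expansion, \<open>p\<close> differs from \<open>proj p\<close> by products of powers of \<open>a\<close> with
    divided derivatives of \<open>p\<close>, which are annihilated by lower powers of \<open>D\<close>.\<close>
  have "p \<in> V" if "p \<in> U" "(D ^^ n) p = 0" for n
    using that
  proof (induction n arbitrary: p)
    case 0
    then show ?case
      using V_scaleQ [OF V_one, of 0] by simp
  next
    case (Suc n)
    have dpow: "dpow D (Suc i) p \<in> V" for i
    proof (rule Suc.IH)
      show "dpow D (Suc i) p \<in> U"
        by (rule U_dpow) (rule Suc.prems)
      have "(D ^^ n) ((D ^^ Suc i) p) = (D ^^ i) ((D ^^ Suc n) p)"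
        by (metis add.commute add_Suc_right funpow_add o_apply)
      also have "\<dots> = 0"
        unfolding Suc.prems(2) by (rule qlinear_zero [OF qlinear_funpow [OF lin]])
      finally show "(D ^^ n) (dpow D (Suc i) p) = 0"
        by (simp add: dpow_def qlinear_on_scaleQ [OF qlinear_funpow [OF lin]])
    qed
    have "proj p = (\<Sum>n\<le>Suc (maxlen p). sh (pw n) (dpow D n p))"
      by (rule proj_eq) simp
    also have "\<dots> = p + (\<Sum>n\<le>maxlen p. sh (pw (Suc n)) (dpow D (Suc n) p))"
      by (simp add: sum.atMost_Suc_shift del: sum.atMost_Suc)
    finally have "p = proj p + (- 1) *\<^sub>Q (\<Sum>n\<le>maxlen p. sh (pw (Suc n)) (dpow D (Suc n) p))"
      by (simp add: scaleQ_minus_left scaleQ_one)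
    moreover have "proj p \<in> V"
      by (intro V_ker U_proj D_proj Suc.prems)
    ultimately show ?case
      using V_add V_scaleQ V_sum V_sh V_pw dpow by (metis (no_types, lifting))
  qed
  from this [OF p nilpotent [OF lessI]] show ?thesis .
qed

end


section \<open>Spaces spanned by words\<close>

lemma xwords_iff: "w \<in> xwords S \<longleftrightarrow> set w \<subseteq> insert X0 (X ` S)"
  by (auto simp: xwords_def)

lemma words1_iff: "w \<in> words1 S \<longleftrightarrow> w \<in> xwords S \<and> (\<forall>v. w \<noteq> v @ [X0])"
proof (cases w rule: rev_cases)
  case (snoc v a)
  then show ?thesis
    by (cases a) (auto simp: words1_def xwords_iff)
qed (simp add: words1_def xwords_iff)

text \<open>The words of \<^const>\<open>HX0\<close> are those which neither start with \<open>X \<one>\<close> nor end with \<open>X0\<close>.\<close>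

lemma words0_iff:
  assumes "\<one>\<^bsub>G\<^esub> \<in> carrier G"
  shows "w \<in> words0 G \<longleftrightarrow>
    w \<in> xwords (carrier G) \<and> (\<forall>v. w \<noteq> X \<one>\<^bsub>G\<^esub> # v) \<and> (\<forall>v. w \<noteq> v @ [X0])"
proof (cases w)
  case (Cons a v)
  show ?thesis
  proof (cases a)
    case X0
    then show ?thesis
      unfolding Cons by (cases v rule: rev_cases) (auto simp: words0_def xwords_iff words1_iff
          elim: letter.exhaust)
  next
    case (X g)
    then show ?thesis
      unfolding Cons by (cases v rule: rev_cases) (auto simp: words0_def xwords_iff words1_iff)
  qed
qed (simp add: words0_def xwords_iff)

lemma keys_subset_add:
  fixes p q :: "'w \<Rightarrow>\<^sub>0 rat"
  shows "\<lbrakk>Poly_Mapping.keys p \<subseteq> W; Poly_Mapping.keys q \<subseteq> W\<rbrakk> \<Longrightarrow> Poly_Mapping.keys (p + q) \<subseteq> W"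
  using keys_add [of p q] by blast

lemma keys_scaleQ_subset: "Poly_Mapping.keys (c *\<^sub>Q (p :: 'w \<Rightarrow>\<^sub>0 rat)) \<subseteq> Poly_Mapping.keys p"
  by (auto simp: in_keys_iff)

lemma keys_bilin_ext:
  fixes f :: "'w \<Rightarrow> 'w \<Rightarrow> 'v \<Rightarrow>\<^sub>0 rat"
  assumes "\<And>u v. \<lbrakk>u \<in> Poly_Mapping.keys p; v \<in> Poly_Mapping.keys q\<rbrakk> \<Longrightarrow>
      Poly_Mapping.keys (f u v) \<subseteq> W"
  shows "Poly_Mapping.keys (bilin_ext f p q) \<subseteq> W"
proof -
  have "Poly_Mapping.keys (lin_ext (f u) q) \<subseteq> W" if "u \<in> Poly_Mapping.keys p" for u
    using keys_lin_ext [of "f u" q] assms [OF that] by blast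
  then show ?thesis
    using keys_lin_ext [of "\<lambda>u. lin_ext (f u) q" p] unfolding bilin_ext_def by blast
qed

lemma keys_dl: "w \<in> Poly_Mapping.keys (dl a p) \<longleftrightarrow> a # w \<in> Poly_Mapping.keys p"
  by (simp add: in_keys_iff)

lemma keys_dr: "w \<in> Poly_Mapping.keys (dr a p) \<longleftrightarrow> w @ [a] \<in> Poly_Mapping.keys p"
  by (simp add: in_keys_iff)


lemma HX_add: "\<lbrakk>p \<in> HX S; q \<in> HX S\<rbrakk> \<Longrightarrow> p + q \<in> HX S"
  by (simp add: HX_def keys_subset_add)

lemma HX_scaleQ: "p \<in> HX S \<Longrightarrow> c *\<^sub>Q p \<in> HX S"
  using keys_scaleQ_subset [of c p] by (auto simp: HX_def)

lemma HX_of_word: "of_word w \<in> HX S \<longleftrightarrow> w \<in> xwords S"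
  by (simp add: HX_def)

lemma keys_sh_word_subset: "\<lbrakk>u \<in> xwords S; v \<in> xwords S\<rbrakk> \<Longrightarrow> Poly_Mapping.keys (sh_word u v) \<subseteq> xwords S"
  using sh_word_letters [of _ u v] by (auto simp: xwords_iff)

lemma HX_sh: "\<lbrakk>p \<in> HX S; q \<in> HX S\<rbrakk> \<Longrightarrow> sh p q \<in> HX S"
  unfolding HX_def sh_def mem_Collect_eq
  by (rule keys_bilin_ext, rule keys_sh_word_subset) blast+

lemma HX_dl: "p \<in> HX S \<Longrightarrow> dl a p \<in> HX S"
  by (fastforce simp: HX_def keys_dl xwords_iff)

lemma HX_dr: "p \<in> HX S \<Longrightarrow> dr a p \<in> HX S"
  by (fastforce simp: HX_def keys_dr xwords_iff)

text \<open>Hence \<^const>\<open>HX0\<close> is the common kernel of two derivations.\<close>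

lemma HX0_iff:
  assumes "\<one>\<^bsub>G\<^esub> \<in> carrier G"
  shows "p \<in> HX0 G \<longleftrightarrow> p \<in> HX (carrier G) \<and> dl (X \<one>\<^bsub>G\<^esub>) p = 0 \<and> dr X0 p = 0"
proof -
  have "dl a p = 0 \<longleftrightarrow> (\<forall>w. a # w \<notin> Poly_Mapping.keys p)"
    "dr a p = 0 \<longleftrightarrow> (\<forall>w. w @ [a] \<notin> Poly_Mapping.keys p)" for a
    by (auto simp: poly_mapping_eq_iff fun_eq_iff in_keys_iff)
  then show ?thesis
    unfolding HX0_def HX_def subset_iff mem_Collect_eq words0_iff [OF assms] by blast
qed

lemma shuffle_derivation_dl:
  "X g = a \<Longrightarrow> g \<in> S \<Longrightarrow> shuffle_derivation (dl a) a (HX S)"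
proof unfold_locales
  fix n and p :: "'a ncpoly"
  assume "maxlen p < n"
  then have "replicate n a @ w \<notin> Poly_Mapping.keys p" for w
    using length_le_maxlen [of "replicate n a @ w" p] by auto
  then show "(dl a ^^ n) p = 0"
    by (intro poly_mapping_eqI) (simp add: lookup_dl_funpow in_keys_iff)
qed (auto simp: qlinear_dl dl_sh dl_of_word_Cons HX_add HX_scaleQ HX_sh HX_dl HX_of_word xwords_iff)

lemma dr_of_word_single: "dr a (of_word [b]) = (if a = b then of_word [] else 0)"
  using dr_of_word_snoc [of a "[]" b] by simp

lemma nilpotent_dr: "n > maxlen p \<Longrightarrow> (dr a ^^ n) p = 0"
proof -
  assume "n > maxlen p"
  then have "w @ replicate n a \<notin> Poly_Mapping.keys p" for w
    using length_le_maxlen [of "w @ replicate n a" p] by auto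
  then show ?thesis
    by (intro poly_mapping_eqI) (simp add: lookup_dr_funpow in_keys_iff)
qed

lemma shuffle_derivation_dr: "shuffle_derivation (dr X0) X0 (HX S)"
  by unfold_locales (auto simp: qlinear_dr dr_sh dr_of_word_single HX_add HX_scaleQ HX_sh HX_dr
      HX_of_word xwords_iff nilpotent_dr)

text \<open>
  The removal of a trailing \<open>X0\<close> is used on the whole shuffle algebra and, to see that
  \<^const>\<open>HX0\<close> and the two letters generate it, on the kernel of the removal of a leading letter.
\<close>

lemma shuffle_derivation_dr_ker:
  "shuffle_derivation (dr X0) X0 {p \<in> HX S. dl (X g) p = 0}"
  by unfold_locales (auto simp: qlinear_dr dr_sh dr_of_word_single HX_add HX_scaleQ HX_sh HX_dr
      HX_of_word xwords_iff nilpotent_dr dl_add dl_scaleQ dl_sh dl_dr_commute dl_of_word_Cons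
      qlinear_zero [OF qlinear_dr])


section \<open>Shuffle regularization\<close>

lemma coeff_sh_poly_mult:
  "coeff (sh_poly_mult P Q) n = (\<Sum>i\<le>n. sh (coeff P i) (coeff Q (n - i)))"
proof -
  have inner: "(\<Sum>j\<le>degree Q. coeff (monom (sh (coeff P i) (coeff Q j)) (i + j)) n) =
      (if i \<le> n then sh (coeff P i) (coeff Q (n - i)) else 0)" for i
  proof -
    have "coeff (monom (sh (coeff P i) (coeff Q j)) (i + j)) n =
        (if j = n - i then if i \<le> n then sh (coeff P i) (coeff Q j) else 0 else 0)" for j
      by auto
    then show ?thesis
      by (simp add: coeff_eq_0)
  qed
  have "coeff (sh_poly_mult P Q) n =
      (\<Sum>i\<le>degree P. if i \<le> n then sh (coeff P i) (coeff Q (n - i)) else 0)"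
    by (simp only: sh_poly_mult_def coeff_sum inner)
  also have "\<dots> = (\<Sum>i\<le>max n (degree P). if i \<le> n then sh (coeff P i) (coeff Q (n - i)) else 0)"
    by (rule sum.mono_neutral_left) (auto simp: coeff_eq_0)
  also have "\<dots> = (\<Sum>i\<le>n. sh (coeff P i) (coeff Q (n - i)))"
    by (rule sum.mono_neutral_cong_right) auto
  finally show ?thesis .
qed

text \<open>
  A character that kills \<open>a\<close> kills all terms of positive index in the projection, so it does not
  see the projection.
\<close>

lemma (in shuffle_derivation) character_proj:
  fixes F :: "'g ncpoly \<Rightarrow> 'a::comm_rat_algebra"
  assumes F: "qlinear_on UNIV F" "\<And>p q. F (sh p q) = F p * F q" "F (of_word [a]) = 0"
  shows "F (proj p) = F p"
proof -
  have F0: "F (pw (Suc n)) = 0" for n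
    by (simp add: pw_Suc F(2,3) qlinear_on_scaleQ [OF F(1)])
  have "F (proj p) = F (\<Sum>n\<le>Suc (maxlen p). sh (pw n) (dpow D n p))"
    by (rule arg_cong [OF proj_eq]) simp
  also have "\<dots> = F p"
    by (simp add: sum.atMost_Suc_shift qlinear_on_add [OF F(1)] qlinear_sum [OF F(1)] F(2) F0
        del: sum.atMost_Suc)
  finally show ?thesis .
qed

locale finite_comm_group = comm_group G for G :: "('g, 'm) monoid_scheme" (structure) +
  assumes finite_carrier: "finite (carrier G)"
begin

text \<open>The removal of a leading \<open>x\<^sub>1\<close>.\<close>

abbreviation D1 :: "'g ncpoly \<Rightarrow> 'g ncpoly" where
  "D1 \<equiv> dl (X \<one>)"

sublocale L: shuffle_derivation D1 "X \<one>" "HX (carrier G)"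
  by (rule shuffle_derivation_dl [OF refl one_closed])

sublocale R: shuffle_derivation "dr X0" X0 "HX (carrier G)"
  by (rule shuffle_derivation_dr)

text \<open>
  The projection of the shuffle algebra to \<open>HX0 G\<close> that kills the letters \<open>X0\<close> and \<open>X \<one>\<close>, and
  the resulting explicit form of the regularization with values in polynomials.
\<close>

definition reg0 :: "'g ncpoly \<Rightarrow> 'g ncpoly" where
  "reg0 p = L.proj (R.proj p)"

definition regP :: "'g ncpoly \<Rightarrow> 'g ncpoly poly" where
  "regP p = Abs_poly (\<lambda>n. reg0 (dpow D1 n p))"

lemma qlinear_reg0: "qlinear_on UNIV reg0"
  unfolding reg0_def by (rule qlinear_compose [OF L.qlinear_proj R.qlinear_proj])

lemma reg0_zero [simp]: "reg0 0 = 0"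
  by (rule qlinear_zero [OF qlinear_reg0])

lemma reg0_sh: "reg0 (sh p q) = sh (reg0 p) (reg0 q)"
  by (simp add: reg0_def L.proj_sh R.proj_sh)

lemma HX0_iff': "p \<in> HX0 G \<longleftrightarrow> p \<in> HX (carrier G) \<and> D1 p = 0 \<and> dr X0 p = 0"
  by (rule HX0_iff) simp

lemma reg0_in_HX0:
  assumes "p \<in> HX (carrier G)"
  shows "reg0 p \<in> HX0 G"
proof -
  have "dr X0 (L.proj (R.proj p)) = L.proj (dr X0 (R.proj p))"
    by (rule L.proj_commute) (simp_all add: qlinear_dr dr_sh dr_of_word_single dl_dr_commute)
  then have "dr X0 (reg0 p) = 0"
    by (simp add: reg0_def R.D_proj qlinear_zero [OF L.qlinear_proj])
  then show ?thesis
    using assms by (simp add: HX0_iff' reg0_def L.U_proj R.U_proj L.D_proj)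
qed

lemma reg0_id: "p \<in> HX0 G \<Longrightarrow> reg0 p = p"
  by (simp add: HX0_iff' reg0_def L.proj_ker R.proj_ker)

lemma reg0_X0: "reg0 (of_word [X0]) = 0"
  by (simp add: reg0_def R.proj_letter qlinear_zero [OF L.qlinear_proj])

lemma reg0_X1: "reg0 (of_word [X \<one>]) = 0"
  by (simp add: reg0_def R.proj_ker dr_of_word_single L.proj_letter)

lemma HX0_one: "of_word [] \<in> HX0 G"
  by (simp add: HX0_iff' HX_of_word xwords_iff)

lemma HX0_sh: "\<lbrakk>p \<in> HX0 G; q \<in> HX0 G\<rbrakk> \<Longrightarrow> sh p q \<in> HX0 G"
  by (simp add: HX0_iff' HX_sh dl_sh dr_sh)

lemma HX0_add: "\<lbrakk>p \<in> HX0 G; q \<in> HX0 G\<rbrakk> \<Longrightarrow> p + q \<in> HX0 G"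
  by (simp add: HX0_iff' HX_add dl_add dr_add)

lemma HX0_scaleQ: "p \<in> HX0 G \<Longrightarrow> c *\<^sub>Q p \<in> HX0 G"
  by (simp add: HX0_iff' HX_scaleQ dl_scaleQ qlinear_on_scaleQ [OF qlinear_dr])

lemma HX0_subset_HX: "HX0 G \<subseteq> HX (carrier G)"
  by (auto simp: HX0_iff')

lemma coeff_regP: "coeff (regP p) n = reg0 (dpow D1 n p)"
  unfolding regP_def by (subst coeff_Abs_poly [of "maxlen p"]) (simp_all add: L.dpow_eq_0)

lemma qlinear_regP: "qlinear_on UNIV regP"
  by (rule qlinear_onI; rule poly_eqI)
     (simp_all add: coeff_regP qlinear_on_add [OF qlinear_reg0] qlinear_on_scaleQ [OF qlinear_reg0]
       qlinear_on_add [OF qlinear_dpow [OF L.lin]] qlinear_on_scaleQ [OF qlinear_dpow [OF L.lin]])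

lemma regP_sh: "regP (sh p q) = sh_poly_mult (regP p) (regP q)"
  by (rule poly_eqI)
     (simp add: coeff_regP coeff_sh_poly_mult L.dpow_sh qlinear_sum [OF qlinear_reg0] reg0_sh)

lemma regP_HX0:
  assumes "p \<in> HX0 G"
  shows "regP p = [:p:]"
proof (rule poly_eqI)
  fix n
  show "coeff (regP p) n = coeff [:p:] n"
    using assms by (cases n) (simp_all add: coeff_regP L.dpow_ker HX0_iff' reg0_id)
qed

lemma regP_X0: "regP (of_word [X0]) = 0"
  by (rule poly_eqI) (simp add: coeff_regP L.dpow_ker dl_of_word_Cons reg0_X0)

lemma regP_X1: "regP (of_word [X \<one>]) = monom (of_word []) 1"
proof (rule poly_eqI)
  fix n
  have "dpow D1 n (of_word [X \<one>]) = 0" if "n > 1"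
    using that by (intro L.dpow_eq_0) (simp add: maxlen_def)
  moreover have "dpow D1 1 (of_word [X \<one>]) = of_word []"
    by (simp add: dpow_def L.D_letter scaleQ_one)
  ultimately show "coeff (regP (of_word [X \<one>])) n = coeff (monom (of_word []) 1) n"
    by (cases "n = 0"; cases "n = 1") (simp_all add: coeff_regP reg0_X1 reg0_id HX0_one)
qed

theorem regT_eq: "regT G = restrict regP (HX (carrier G))"
  unfolding regT_def
proof (rule the_equality, intro conjI ballI)
  let ?H = "HX (carrier G)"
  have in_H: "of_word [X0] \<in> ?H" "of_word [X \<one>] \<in> ?H" "of_word [] \<in> ?H"
    by (simp_all add: HX_of_word xwords_iff)
  show "restrict regP ?H \<in> ?H \<rightarrow>\<^sub>E {P. \<forall>n. coeff P n \<in> HX0 G}"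
    by (auto simp: coeff_regP intro!: reg0_in_HX0 L.U_dpow)
  show "alg_hom_on ?H sh (of_word []) sh_poly_mult [:of_word []:] (restrict regP ?H)"
    using qlinear_regP
    by (simp add: alg_hom_on_def qlinear_on_def in_H HX_add HX_scaleQ HX_sh regP_sh regP_HX0 HX0_one)
  show "restrict regP ?H p = [:p:]" if "p \<in> HX0 G" for p
    using that HX0_subset_HX by (auto simp: regP_HX0)
  show "restrict regP ?H (of_word [X0]) = 0" "restrict regP ?H (of_word [X \<one>]) = monom (of_word []) 1"
    using in_H by (simp_all add: regP_X0 regP_X1)
  fix f
  assume "f \<in> ?H \<rightarrow>\<^sub>E {P. \<forall>n. coeff P n \<in> HX0 G} \<and>
     alg_hom_on ?H sh (of_word []) sh_poly_mult [:of_word []:] f \<and>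
     (\<forall>p\<in>HX0 G. f p = [:p:]) \<and> f (of_word [X0]) = 0 \<and> f (of_word [X \<one>]) = monom (of_word []) 1"
  then have ext: "f \<in> extensional ?H"
    and add: "\<And>p q. \<lbrakk>p \<in> ?H; q \<in> ?H\<rbrakk> \<Longrightarrow> f (p + q) = f p + f q"
    and scale: "\<And>c p. p \<in> ?H \<Longrightarrow> f (c *\<^sub>Q p) = c *\<^sub>Q f p"
    and mult: "\<And>p q. \<lbrakk>p \<in> ?H; q \<in> ?H\<rbrakk> \<Longrightarrow> f (sh p q) = sh_poly_mult (f p) (f q)"
    and H0: "\<And>p. p \<in> HX0 G \<Longrightarrow> f p = [:p:]"
    and letters: "f (of_word [X0]) = 0" "f (of_word [X \<one>]) = monom (of_word []) 1"
    by (auto simp: alg_hom_on_def qlinear_on_def PiE_iff)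
  \<comment> \<open>Both maps agree on a subalgebra which contains \<open>HX0 G\<close> and the letters \<open>X0\<close> and \<open>X \<one>\<close>.\<close>
  define V where "V = {p \<in> ?H. f p = regP p}"
  have V_add: "p + q \<in> V" and V_sh: "sh p q \<in> V" if "p \<in> V" "q \<in> V" for p q
    using that by (simp_all add: V_def HX_add HX_sh add mult regP_sh qlinear_on_add [OF qlinear_regP])
  have V_scaleQ: "c *\<^sub>Q p \<in> V" if "p \<in> V" for p c
    using that by (simp add: V_def HX_scaleQ scale qlinear_on_scaleQ [OF qlinear_regP])
  interpret K: shuffle_derivation "dr X0" X0 "{p \<in> ?H. D1 p = 0}"
    by (rule shuffle_derivation_dr_ker)
  have V_letters: "of_word [X0] \<in> V" "of_word [X \<one>] \<in> V"
    using in_H letters by (simp_all add: V_def regP_X0 regP_X1)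
  have V_HX0: "p \<in> V" if "p \<in> HX0 G" for p
    using that HX0_subset_HX by (auto simp: V_def H0 regP_HX0)
  have "p \<in> V" if "p \<in> ?H" "D1 p = 0" for p
    by (rule K.generated) (use that V_letters in \<open>auto intro: V_add V_scaleQ V_sh V_HX0 simp: HX0_iff'\<close>)
  then have "p \<in> V" if "p \<in> ?H" for p
    by (intro L.generated [where V = V, OF V_add V_scaleQ V_sh V_letters(2) _ that])
  then show "f = restrict regP ?H"
    using ext by (intro extensionalityI [of f ?H]) (simp_all add: V_def)
qed

lemma regT_HX: "p \<in> HX (carrier G) \<Longrightarrow> regT G p = regP p"
  by (simp add: regT_eq)

lemma reg_HX: "p \<in> HX (carrier G) \<Longrightarrow> reg G p = reg0 p"
  by (simp add: reg_def regT_HX coeff_regP)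

end


section \<open>Characters of the shuffle algebra\<close>

text \<open>A series is a character if pairing with it is multiplicative for the shuffle product.\<close>

definition sh_character :: "('g, 'a::comm_rat_algebra) series \<Rightarrow> bool" where
  "sh_character \<Phi> \<longleftrightarrow> (\<forall>u v. lin_ext \<Phi> (sh_word u v) = \<Phi> u * \<Phi> v)"

lemma sh_character_mult:
  assumes "sh_character \<Phi>"
  shows "lin_ext \<Phi> (sh p q) = lin_ext \<Phi> p * lin_ext \<Phi> q"
proof (rule bilinear_eqI [where f = "\<lambda>p q. lin_ext \<Phi> (sh p q)"
      and g = "\<lambda>p q. lin_ext \<Phi> p * lin_ext \<Phi> q"])
qed (use assms in \<open>auto simp: sh_character_def qlinear_on_def lin_ext_add lin_ext_scaleQ sh_add_left
    sh_add_right sh_scaleQ_left sh_scaleQ_right sh_of_word algebra_simps scaleQ_mult_left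
    scaleQ_mult_right\<close>)

context finite_comm_group
begin

text \<open>
  The homomorphisms on \<^const>\<open>HX0\<close>, and the characters of the shuffle algebra which vanish on
  \<open>X0\<close> and \<open>X \<one>\<close>: the two sides of the bijection when only the shuffle relations are imposed.
\<close>

definition shuffle_maps :: "('g ncpoly \<Rightarrow> 'a::comm_rat_algebra) set" where
  "shuffle_maps = {Z \<in> extensional (HX0 G). alg_hom_on (HX0 G) sh (of_word []) (*) 1 Z}"

definition shuffle_series :: "('g, 'a::comm_rat_algebra) series set" where
  "shuffle_series = {\<Phi> \<in> Xseries (carrier G).
     \<Phi> [X0] = 0 \<and> \<Phi> [X \<one>] = 0 \<and> \<Phi> [] = 1 \<and> sh_character \<Phi>}"

lemma shuffle_mapsD:
  assumes "Z \<in> shuffle_maps"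
  shows "qlinear_on (HX0 G) Z" "Z (of_word []) = 1"
    "\<And>p q. \<lbrakk>p \<in> HX0 G; q \<in> HX0 G\<rbrakk> \<Longrightarrow> Z (sh p q) = Z p * Z q"
  using assms by (simp_all add: shuffle_maps_def alg_hom_on_def)

lemma lin_ext_Phi_reg:
  assumes "Z \<in> shuffle_maps" and p: "p \<in> HX (carrier G)"
  shows "lin_ext (Phi_reg G Z) p = Z (reg0 p)"
proof -
  have "qlinear_on (HX (carrier G)) (\<lambda>p. Z (reg0 p))"
    using shuffle_mapsD(1) [OF assms(1)] qlinear_reg0
    by (simp add: qlinear_on_def reg0_in_HX0)
  then have "Z (reg0 p) = lin_ext (\<lambda>w. Z (reg0 (of_word w))) p"
    using p unfolding HX_def by (intro qlinear_on_words) auto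
  also have "\<dots> = lin_ext (Phi_reg G Z) p"
    using p by (intro lin_ext_cong) (auto simp: Phi_reg_def reg_HX HX_of_word HX_def)
  finally show ?thesis ..
qed

lemma Phi_reg_HX0: "\<lbrakk>Z \<in> shuffle_maps; p \<in> HX0 G\<rbrakk> \<Longrightarrow> lin_ext (Phi_reg G Z) p = Z p"
  using HX0_subset_HX by (auto simp: lin_ext_Phi_reg reg0_id)

lemma Phi_reg_shuffle_series:
  assumes "Z \<in> shuffle_maps"
  shows "Phi_reg G Z \<in> shuffle_series"
proof -
  let ?\<Phi> = "Phi_reg G Z"
  have word: "?\<Phi> w = Z (reg0 (of_word w))" if "w \<in> xwords (carrier G)" for w
    using that by (simp add: Phi_reg_def reg_HX HX_of_word)
  have outside: "?\<Phi> w = 0" if "w \<notin> xwords (carrier G)" for w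
    using that by (simp add: Phi_reg_def)
  have Z0: "Z 0 = 0"
    using qlinear_on_scaleQ [OF shuffle_mapsD(1) [OF assms] HX0_one, of 0] by simp
  have "lin_ext ?\<Phi> (sh_word u v) = ?\<Phi> u * ?\<Phi> v" for u v
  proof (cases "u \<in> xwords (carrier G) \<and> v \<in> xwords (carrier G)")
    case True
    then have "of_word u \<in> HX (carrier G)" "of_word v \<in> HX (carrier G)"
      by (simp_all add: HX_of_word)
    moreover from this have "sh_word u v \<in> HX (carrier G)"
      using HX_sh [of "of_word u" _ "of_word v"] by (simp add: sh_of_word)
    ultimately show ?thesis
      using True reg0_sh [of "of_word u" "of_word v"]
      by (simp add: lin_ext_Phi_reg assms word reg0_in_HX0 shuffle_mapsD(3) sh_of_word)
  next
    case False
    then have "w \<notin> xwords (carrier G)" if "w \<in> Poly_Mapping.keys (sh_word u v)" for w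
      using sh_word_letters [OF that] by (simp add: xwords_iff)
    then have "lin_ext ?\<Phi> (sh_word u v) = 0"
      by (simp add: lin_ext_def outside)
    then show ?thesis
      using False outside by auto
  qed
  then show ?thesis
    using shuffle_mapsD(2) [OF assms] HX0_one
    by (simp add: shuffle_series_def sh_character_def Xseries_def outside word xwords_iff reg0_X0
        reg0_X1 Z0 reg0_id)
qed

lemma shuffle_series_reg0:
  assumes "\<Phi> \<in> shuffle_series"
  shows "lin_ext \<Phi> (reg0 p) = lin_ext \<Phi> p"
  using assms sh_character_mult [of \<Phi>] unfolding reg0_def
  by (simp add: shuffle_series_def L.character_proj R.character_proj qlinear_lin_ext)

theorem bij_betw_shuffle: "bij_betw (Phi_reg G) shuffle_maps shuffle_series"
proof (rule bij_betw_byWitness [where f' = "\<lambda>\<Phi>. restrict (lin_ext \<Phi>) (HX0 G)"])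
  show "\<forall>Z\<in>shuffle_maps. restrict (lin_ext (Phi_reg G Z)) (HX0 G) = Z"
    by (auto simp: fun_eq_iff Phi_reg_HX0 restrict_def shuffle_maps_def extensional_def)
  have maps: "restrict (lin_ext \<Phi>) (HX0 G) \<in> shuffle_maps" if "\<Phi> \<in> shuffle_series" for \<Phi>
    using that sh_character_mult [of \<Phi>] qlinear_lin_ext [of \<Phi>]
    by (auto simp: shuffle_maps_def alg_hom_on_def qlinear_on_def HX0_add HX0_scaleQ HX0_sh HX0_one
        shuffle_series_def)
  then show "(\<lambda>\<Phi>. restrict (lin_ext \<Phi>) (HX0 G)) ` shuffle_series \<subseteq> shuffle_maps"
    by blast
  show "Phi_reg G ` shuffle_maps \<subseteq> shuffle_series"
    using Phi_reg_shuffle_series by blast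
  show "\<forall>\<Phi>\<in>shuffle_series. Phi_reg G (restrict (lin_ext \<Phi>) (HX0 G)) = \<Phi>"
  proof (intro ballI ext)
    fix \<Phi> :: "('g, 'b) series" and w
    assume "\<Phi> \<in> shuffle_series"
    then show "Phi_reg G (restrict (lin_ext \<Phi>) (HX0 G)) w = \<Phi> w"
      using shuffle_series_reg0 [of \<Phi> "of_word w"]
      by (auto simp: Phi_reg_def reg_HX HX_of_word reg0_in_HX0 shuffle_series_def Xseries_def)
  qed
qed

lemma coeff_Zsh:
  assumes "Z \<in> shuffle_maps" "p \<in> HX (carrier G)"
  shows "coeff (Zsh G Z p) n = lin_ext (Phi_reg G Z) (dpow D1 n p)"
proof -
  have "Z 0 = 0"
    using qlinear_on_scaleQ [OF shuffle_mapsD(1) [OF assms(1)] HX0_one, of 0] by simp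
  then show ?thesis
    using assms by (simp add: Zsh_def coeff_map_poly regT_HX coeff_regP lin_ext_Phi_reg L.U_dpow)
qed

end


section \<open>Exponentials of power series\<close>

unbundle fps_syntax

text \<open>
  The coefficients may form the zero ring, so power series over them are not an instance of
  \<^class>\<open>comm_ring_1\<close>.  Powers appear as iterated products.
\<close>

lemma fps_one_mult: "1 * (S :: 'a::comm_rat_algebra fps) = S"
proof (rule fps_ext)
  fix n
  have "(1 * S) $ n = (\<Sum>i=0..n. if i = 0 then S $ n else 0)"
    unfolding fps_mult_nth by (intro sum.cong) auto
  then show "(1 * S) $ n = S $ n"
    by simp
qed

lemma fps_funpow_add:
  fixes S :: "'a::comm_rat_algebra fps"
  shows "((*) S ^^ k) 1 * ((*) S ^^ l) 1 = ((*) S ^^ (k + l)) 1"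
  by (induction k) (simp_all add: fps_one_mult mult.assoc)

lemma fps_funpow_uminus_nth:
  fixes S :: "'a::comm_rat_algebra fps"
  shows "((*) (- S) ^^ k) 1 $ n = (- 1) ^ k *\<^sub>Q ((*) S ^^ k) 1 $ n"
proof (induction k arbitrary: n)
  case (Suc k)
  then show ?case
    by (simp add: fps_mult_nth scaleQ_mult_right scaleQ_sum_right scaleQ_minus_left sum_negf)
qed (simp add: scaleQ_one)

lemma fps_funpow_nth_eq_0:
  fixes S :: "'a::comm_rat_algebra fps"
  assumes "S $ 0 = 0" "n < k"
  shows "((*) S ^^ k) 1 $ n = 0"
  using assms(2)
proof (induction k arbitrary: n)
  case (Suc k)
  have "S $ i * ((*) S ^^ k) 1 $ (n - i) = 0" if "i \<le> n" for i
    using that Suc.IH [of "n - i"] Suc.prems assms(1) by (cases "i = 0") auto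
  then show ?case
    by (simp add: fps_mult_nth)
qed simp

lemma exp_fps_uminus:
  fixes S :: "'a::comm_rat_algebra fps"
  assumes S0: "S $ 0 = 0"
  shows "exp_fps S * exp_fps (- S) = 1"
proof (rule fps_ext)
  fix n
  define p where "p k = ((*) S ^^ k) 1" for k
  define c where "c k l = (1 / fact k * ((- 1) ^ l / fact l) :: rat)" for k l :: nat
  have p0: "p k $ i = 0" if "i < k" for k i
    using that S0 by (simp add: p_def fps_funpow_nth_eq_0)
  have E: "exp_fps S $ i = (\<Sum>k\<le>n. (1 / fact k) *\<^sub>Q p k $ i)" if "i \<le> n" for i
    using that unfolding exp_fps_def fps_nth_Abs_fps p_def [symmetric]
    by (intro sum.mono_neutral_left) (auto simp: p0)
  have R: "exp_fps (- S) $ i = (\<Sum>l\<le>n. ((- 1) ^ l / fact l) *\<^sub>Q p l $ i)" if "i \<le> n" for i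
    using that unfolding exp_fps_def fps_nth_Abs_fps fps_funpow_uminus_nth p_def [symmetric] scaleQ_scaleQ
    by (simp, intro sum.mono_neutral_left) (auto simp: p0)
  have "(exp_fps S * exp_fps (- S)) $ n =
      (\<Sum>i=0..n. \<Sum>k\<le>n. \<Sum>l\<le>n. c k l *\<^sub>Q (p k $ i * p l $ (n - i)))"
    by (simp add: fps_mult_nth E R sum_product c_def scaleQ_mult_left scaleQ_mult_right scaleQ_scaleQ
        mult.commute)
  also have "\<dots> = (\<Sum>k\<le>n. \<Sum>l\<le>n. \<Sum>i=0..n. c k l *\<^sub>Q (p k $ i * p l $ (n - i)))"
    by (rule trans [OF sum.swap]) (rule sum.cong [OF refl], rule sum.swap)
  also have "\<dots> = (\<Sum>k\<le>n. \<Sum>l\<le>n. c k l *\<^sub>Q (p k * p l) $ n)"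
    by (simp add: fps_mult_nth scaleQ_sum_right)
  also have "\<dots> = (\<Sum>k\<le>n. \<Sum>l\<le>n. c k l *\<^sub>Q p (k + l) $ n)"
    by (simp add: p_def fps_funpow_add)
  also have "\<dots> = (\<Sum>m\<le>n. \<Sum>k\<le>m. c k (m - k) *\<^sub>Q p (k + (m - k)) $ n)"
    by (rule sum_square_eq_triangle) (simp add: p0)
  also have "\<dots> = (\<Sum>m\<le>n. (\<Sum>k\<le>m. c k (m - k)) *\<^sub>Q p m $ n)"
    by (simp add: scaleQ_sum_left)
  \<comment> \<open>For \<open>m > 0\<close> the inner sum is \<open>(1 - 1)\<^sup>m / m!\<close>.\<close>
  also have "\<dots> = (\<Sum>m\<le>n. if m = 0 then p 0 $ n else 0)"
  proof (intro sum.cong refl)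
    fix m
    have "(\<Sum>k\<le>m. c k (m - k)) = (\<Sum>k\<le>m. of_nat (m choose k) * 1 ^ k * (- 1) ^ (m - k)) / fact m"
      unfolding sum_divide_distrib by (intro sum.cong refl) (simp add: c_def binomial_fact)
    also have "\<dots> = (1 + - 1) ^ m / fact m"
      by (simp only: binomial_ring)
    finally show "(\<Sum>k\<le>m. c k (m - k)) *\<^sub>Q p m $ n = (if m = 0 then p 0 $ n else 0)"
      by (simp add: scaleQ_one power_0_left)
  qed
  also have "\<dots> = 1 $ n"
    by (simp add: p_def)
  finally show "(exp_fps S * exp_fps (- S)) $ n = 1 $ n" .
qed

lemma coeff_const_fps_exp_Tu:
  "coeff (fps_nth (const_fps S * exp_Tu) n) m = (if m \<le> n then (1 / fact m) *\<^sub>Q S $ (n - m) else 0)"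
proof -
  have "coeff (fps_nth (const_fps S * exp_Tu) n) m =
      (\<Sum>i=0..n. S $ i * coeff (monom ((1 / fact (n - i)) *\<^sub>Q 1) (n - i)) m)"
    by (simp add: fps_mult_nth coeff_sum const_fps_def exp_Tu_def)
  also have "\<dots> = (\<Sum>i=0..n. if i = n - m then if m \<le> n then (1 / fact m) *\<^sub>Q S $ (n - m) else 0 else 0)"
    by (intro sum.cong refl) (auto simp: scaleQ_mult_right)
  finally show ?thesis
    by simp
qed

text \<open>
  In terms of the divided coefficients \<open>n! c\<^sub>n\<close>, the operator that multiplies \<open>exp (T u)\<close> by
  \<open>S\<close> is the constant coefficient differential operator with symbol \<open>S\<close>.
\<close>

lemma coeff_exp_op:
  assumes "degree P \<le> N"
  shows "fact m *\<^sub>Q coeff (exp_op S P) m = (\<Sum>i\<le>N. S $ i * (fact (m + i) *\<^sub>Q coeff P (m + i)))"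
proof -
  have "fact m *\<^sub>Q ((fact n *\<^sub>Q c) * ((1 / fact m) *\<^sub>Q s)) = s * (fact n *\<^sub>Q c)"
    for n and c s :: 'a
    by (simp add: scaleQ_mult_right scaleQ_scaleQ scaleQ_one mult.commute)
  then have "fact m *\<^sub>Q coeff (exp_op S P) m =
      (\<Sum>n\<le>m + N. if m \<le> n then S $ (n - m) * (fact n *\<^sub>Q coeff P n) else 0)"
    using assms unfolding exp_op_altdef [of P "m + N", OF trans_le_add2 [OF assms]] coeff_sum scaleQ_sum_right
    by (intro sum.cong refl) (simp add: coeff_const_fps_exp_Tu)
  also have "\<dots> = (\<Sum>n\<in>{m..m + N}. S $ (n - m) * (fact n *\<^sub>Q coeff P n))"
    by (rule sum.mono_neutral_cong_right) auto
  also have "\<dots> = (\<Sum>i\<le>N. S $ i * (fact (m + i) *\<^sub>Q coeff P (m + i)))"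
    by (rule sum.reindex_bij_witness [of _ "\<lambda>i. m + i" "\<lambda>n. n - m"]) auto
  finally show ?thesis .
qed

text \<open>
  Applying to a sequence first \<open>R\<close> and then \<open>S\<close>, both read as power series in the shift operator,
  amounts to applying their product.
\<close>

lemma fps_inverse_shift:
  fixes S R :: "'a::comm_rat_algebra fps"
  assumes SR: "S * R = 1" and g: "\<And>n. n > N \<Longrightarrow> g n = 0"
  shows "(\<Sum>i\<le>N. S $ i * (\<Sum>j\<le>N. R $ j * g (i + j))) = g 0"
proof -
  have "(\<Sum>i\<le>N. S $ i * (\<Sum>j\<le>N. R $ j * g (i + j))) =
      (\<Sum>i\<le>N. \<Sum>j\<le>N. S $ i * R $ j * g (i + j))"
    by (simp add: sum_distrib_left mult.assoc)
  also have "\<dots> = (\<Sum>n\<le>N. \<Sum>i\<le>n. S $ i * R $ (n - i) * g (i + (n - i)))"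
    by (rule sum_square_eq_triangle) (simp add: g)
  also have "\<dots> = (\<Sum>n\<le>N. (S * R) $ n * g n)"
    by (simp add: fps_mult_nth sum_distrib_right atMost_atLeast0)
  also have "\<dots> = (\<Sum>n\<le>N. if n = 0 then g 0 else 0)"
    unfolding SR by (intro sum.cong) auto
  finally show ?thesis
    by simp
qed

lemma poly_eq_divided_coeffI:
  fixes P Q :: "'a::rat_vector poly"
  assumes "\<And>m. fact m *\<^sub>Q coeff P m = fact m *\<^sub>Q coeff Q m"
  shows "P = Q"
proof (rule poly_eqI)
  fix m
  have "(1 / fact m) *\<^sub>Q fact m *\<^sub>Q coeff P m = (1 / fact m) *\<^sub>Q fact m *\<^sub>Q coeff Q m"
    by (simp only: assms)
  then show "coeff P m = coeff Q m"
    by (simp add: scaleQ_scaleQ scaleQ_one)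
qed

lemma inj_exp_op:
  fixes S R :: "'a::comm_rat_algebra fps"
  assumes "R * S = 1"
  shows "inj (exp_op S)"
proof (rule inj_on_inverseI)
  fix P
  define N where "N = max (degree P) (degree (exp_op S P))"
  have N: "degree P \<le> N" "degree (exp_op S P) \<le> N"
    by (simp_all add: N_def)
  show "exp_op R (exp_op S P) = P"
  proof (rule poly_eq_divided_coeffI)
    fix m
    have "fact m *\<^sub>Q coeff (exp_op R (exp_op S P)) m =
        (\<Sum>i\<le>N. R $ i * (\<Sum>j\<le>N. S $ j * (fact (m + (i + j)) *\<^sub>Q coeff P (m + (i + j)))))"
      by (simp only: coeff_exp_op [OF N(2)] coeff_exp_op [OF N(1)] add.assoc)
    also have "\<dots> = fact (m + 0) *\<^sub>Q coeff P (m + 0)"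
      by (rule fps_inverse_shift [OF assms]) (use N in \<open>simp add: coeff_eq_0\<close>)
    finally show "fact m *\<^sub>Q coeff (exp_op R (exp_op S P)) m = fact m *\<^sub>Q coeff P m"
      by simp
  qed
qed


section \<open>Series in a single letter\<close>

text \<open>The non-commutative series obtained by substituting the letter \<open>a\<close> in a power series.\<close>

definition letter_ser :: "'g letter \<Rightarrow> 'a::comm_rat_algebra fps \<Rightarrow> ('g, 'a) series" where
  "letter_ser a S = (\<lambda>w. if w = replicate (length w) a then S $ length w else 0)"

lemma letter_ser_replicate [simp]: "letter_ser a S (replicate n a) = S $ n"
  by (simp add: letter_ser_def)

lemma ser_mult_letter_ser:
  "ser_mult (letter_ser a S) \<Theta> w =
     (\<Sum>i\<le>length w. if take i w = replicate i a then S $ i * \<Theta> (drop i w) else 0)"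
  unfolding ser_mult_def
  by (intro sum.cong refl) (auto simp: letter_ser_def min_def)

lemma ser_mult_letter_ser_letter_ser:
  "ser_mult (letter_ser a S) (letter_ser a R) = letter_ser a (S * R)"
proof
  fix w
  show "ser_mult (letter_ser a S) (letter_ser a R) w = letter_ser a (S * R) w"
  proof (cases "w = replicate (length w) a")
    case True
    then obtain n where w: "w = replicate n a"
      by blast
    show ?thesis
      unfolding ser_mult_letter_ser w
      by (simp add: min_def fps_mult_nth atMost_atLeast0)
  next
    case False
    have "\<not> (take i w = replicate i a \<and> drop i w = replicate (length w - i) a)" if "i \<le> length w" for i
    proof
      assume "take i w = replicate i a \<and> drop i w = replicate (length w - i) a"
      then have "w = replicate i a @ replicate (length w - i) a"
        by (metis append_take_drop_id)
      with False that show False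
        by (simp flip: replicate_add)
    qed
    then have "(if take i w = replicate i a then S $ i * letter_ser a R (drop i w) else 0) = 0"
      if "i \<le> length w" for i
      using that by (auto simp: letter_ser_def)
    then show ?thesis
      using False by (simp add: ser_mult_letter_ser) (simp add: letter_ser_def)
  qed
qed

lemma ser_exp_letter_ser: "ser_exp (letter_ser a S) = letter_ser a (exp_fps S)"
proof
  fix w
  have one: "ser_word [] = letter_ser a 1"
    by (auto simp: fun_eq_iff ser_word_def letter_ser_def)
  have "(ser_mult (letter_ser a S) ^^ k) (ser_word []) = letter_ser a (((*) S ^^ k) 1)" for k
    by (induction k) (simp_all add: one ser_mult_letter_ser_letter_ser)
  then show "ser_exp (letter_ser a S) w = letter_ser a (exp_fps S) w"
    by (simp add: ser_exp_def exp_fps_def letter_ser_def)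
qed

lemma dl_funpow_of_word:
  "(dl a ^^ n) (of_word w) = (if take n w = replicate n a \<and> n \<le> length w then of_word (drop n w) else 0)"
proof (rule poly_mapping_eqI)
  fix v
  have "replicate n a @ v = w \<longleftrightarrow> take n w = replicate n a \<and> n \<le> length w \<and> v = drop n w"
    by (metis append_eq_conv_conj append_take_drop_id length_replicate length_append le_add1)
  then show "Poly_Mapping.lookup ((dl a ^^ n) (of_word w)) v =
      Poly_Mapping.lookup (if take n w = replicate n a \<and> n \<le> length w then of_word (drop n w) else 0) v"
    by (auto simp: lookup_dl_funpow lookup_of_word)
qed

text \<open>
  Left multiplication by a series in the letter \<open>a\<close> is adjoint to the operator obtained from the
  power series by substituting the removal of a leading \<open>a\<close>.
\<close>

lemma lin_ext_ser_mult_letter_ser: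
  assumes "maxlen p \<le> N"
  shows "lin_ext (ser_mult (letter_ser a S) \<Theta>) p = (\<Sum>i\<le>N. S $ i * lin_ext \<Theta> ((dl a ^^ i) p))"
proof -
  have "lin_ext (ser_mult (letter_ser a S) \<Theta>) p =
      lin_ext (\<lambda>w. \<Sum>i\<le>N. S $ i * lin_ext \<Theta> ((dl a ^^ i) (of_word w))) p"
  proof (rule lin_ext_cong)
    fix w
    assume "w \<in> Poly_Mapping.keys p"
    then have "length w \<le> N"
      using length_le_maxlen [of w p] assms by linarith
    then show "ser_mult (letter_ser a S) \<Theta> w = (\<Sum>i\<le>N. S $ i * lin_ext \<Theta> ((dl a ^^ i) (of_word w)))"
      unfolding ser_mult_letter_ser
      by (intro sum.mono_neutral_cong_left) (auto simp: dl_funpow_of_word)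
  qed
  also have "\<dots> = (\<Sum>i\<le>N. S $ i * lin_ext \<Theta> ((dl a ^^ i) p))"
  proof (rule qlinear_eq_lin_ext [symmetric])
    have "qlinear_on UNIV (\<lambda>p. S $ i * lin_ext \<Theta> ((dl a ^^ i) p))" for i
      using qlinear_compose [OF qlinear_lin_ext [of \<Theta>] qlinear_funpow [OF qlinear_dl [of a], of i]]
      by (simp add: qlinear_on_def scaleQ_mult_right algebra_simps)
    then show "qlinear_on UNIV (\<lambda>p. \<Sum>i\<le>N. S $ i * lin_ext \<Theta> ((dl a ^^ i) p))"
      by (intro qlinear_sum_fun)
  qed
  finally show ?thesis .
qed


section \<open>Coproducts and products\<close>

text \<open>
  If the coefficients of a continuous linear map at a fixed target are those of a polynomial,
  then the map is the pairing with this polynomial, and its defining sum is finite.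
\<close>

lemma Sum_any_lin_ext:
  fixes \<Phi> :: "'w \<Rightarrow> 'a::comm_rat_algebra"
  shows "Sum_any (\<lambda>w. \<Phi> w * (Poly_Mapping.lookup p w *\<^sub>Q 1)) = lin_ext \<Phi> p"
proof -
  have "Sum_any (\<lambda>w. \<Phi> w * (Poly_Mapping.lookup p w *\<^sub>Q 1)) =
      (\<Sum>w\<in>Poly_Mapping.keys p. \<Phi> w * (Poly_Mapping.lookup p w *\<^sub>Q 1))"
    by (rule Sum_any.expand_superset) (auto simp: in_keys_iff intro: ccontr)
  then show ?thesis
    by (simp add: lin_ext_def scaleQ_mult_right)
qed

lemma ser2_mult_tensor_word:
  "ser2_mult (tensor (ser_word a) (ser_word b)) Q u v =
     (if take (length a) u = a \<and> take (length b) v = b then Q (drop (length a) u) (drop (length b) v)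
      else 0)"
proof -
  have take_iff: "take i u = a \<longleftrightarrow> i = length a \<and> take (length a) u = a" if "i \<le> length u"
    for i and a u :: "'a xword"
    using that by auto
  have "ser2_mult (tensor (ser_word a) (ser_word b)) Q u v =
      (\<Sum>i\<le>length u. \<Sum>j\<le>length v. if j = length b then if i = length a then
        if take (length a) u = a \<and> take (length b) v = b then Q (drop (length a) u) (drop (length b) v)
        else 0 else 0 else 0)"
    unfolding ser2_mult_def tensor_def ser_word_def
    by (intro sum.cong refl) (auto simp: take_iff)
  also have "\<dots> = (if length b \<le> length v then if length a \<le> length u then
        if take (length a) u = a \<and> take (length b) v = b then Q (drop (length a) u) (drop (length b) v)
        else 0 else 0 else 0)"
    by (simp add: if_distrib [of "sum _"] cong: if_cong)
  also have "\<dots> = (if take (length a) u = a \<and> take (length b) v = b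
        then Q (drop (length a) u) (drop (length b) v) else 0)"
    by (auto dest: arg_cong [of _ _ length])
  finally show ?thesis .
qed

lemma ser2_mult_add: "ser2_mult (\<lambda>u v. P u v + P' u v) Q u v = ser2_mult P Q u v + ser2_mult P' Q u v"
  by (simp add: ser2_mult_def algebra_simps sum.distrib)

lemma ser2_mult_sum:
  "ser2_mult (\<lambda>u v. \<Sum>i\<in>A. P i u v) Q u v = (\<Sum>i\<in>A. ser2_mult (P i) Q u v)"
proof (induction A rule: infinite_finite_induct)
  case (insert x A)
  then show ?case
    using ser2_mult_add [of "P x" "\<lambda>u v. \<Sum>i\<in>A. P i u v" Q u v] by simp
qed (simp_all add: ser2_mult_def)

text \<open>The shuffle coproduct of a word is the transpose of the shuffle product.\<close>

lemma Delta_sh_coeff: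
  fixes u v :: "'g xword"
  shows "foldr (\<lambda>a. ser2_mult
       (\<lambda>u v. tensor (ser_word [a]) (ser_word []) u v + tensor (ser_word []) (ser_word [a]) u v))
     w (tensor (ser_word []) (ser_word [])) u v =
   (Poly_Mapping.lookup (sh (of_word u) (of_word v)) w *\<^sub>Q 1 :: 'a::comm_rat_algebra)"
    (is "foldr ?f w ?e u v = _")
proof (induction w arbitrary: u v)
  case Nil
  then show ?case
    by (simp add: tensor_def ser_word_def lookup_sh_Nil lookup_of_word scaleQ_one)
next
  case (Cons a w)
  have dl_take: "dl a (of_word u) = (if take 1 u = [a] then of_word (drop 1 u) else 0)" for u
    by (cases u) (auto simp: dl_of_word_Cons)
  have "Poly_Mapping.lookup (sh (of_word u) (of_word v)) (a # w) =
      Poly_Mapping.lookup (dl a (sh (of_word u) (of_word v))) w"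
    by simp
  also have "\<dots> = Poly_Mapping.lookup (sh (dl a (of_word u)) (of_word v)) w +
      Poly_Mapping.lookup (sh (of_word u) (dl a (of_word v))) w"
    by (simp only: dl_sh lookup_add)
  moreover have "foldr ?f (a # w) ?e u v = ?f a (foldr ?f w ?e) u v"
    by (simp only: foldr.simps o_apply)
  ultimately show ?case
    unfolding ser2_mult_add ser2_mult_tensor_word Cons.IH
    by (simp add: dl_take scaleQ_add_left)
qed

lemma Delta_sh_eq: "Delta_sh \<Phi> u v = lin_ext \<Phi> (sh_word u v)"
  by (simp add: Delta_sh_def ser2_ext_def Delta_sh_coeff Sum_any_lin_ext sh_of_word)

lemma Delta_sh_tensor_iff: "Delta_sh \<Phi> = tensor \<Phi> \<Phi> \<longleftrightarrow> sh_character \<Phi>"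
  by (simp add: fun_eq_iff Delta_sh_eq sh_character_def tensor_def)


section \<open>Words in the letters of the harmonic algebra\<close>

text \<open>The numeral in \<^term>\<open>y_of_x 1\<close> should not be rewritten to a successor.\<close>

declare One_nat_def [simp del]

text \<open>The words in the letters \<open>y\<^sub>n\<^sub>,\<^sub>g\<close> with \<open>g\<close> in \<open>S\<close>.\<close>

definition ywords :: "'g set \<Rightarrow> (nat \<times> 'g) list set" where
  "ywords S = lists ({1..} \<times> S)"

lemma ywords_Nil [simp]: "[] \<in> ywords S"
  by (simp add: ywords_def)

lemma ywords_Cons: "(n, g) # w \<in> ywords S \<longleftrightarrow> n \<ge> 1 \<and> g \<in> S \<and> w \<in> ywords S"
  by (auto simp: ywords_def)

lemma x_of_y_Nil [simp]: "x_of_y [] = []"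
  by (simp add: x_of_y_def)

lemma x_of_y_Cons: "x_of_y ((n, g) # w) = yw n g @ x_of_y w"
  by (simp add: x_of_y_def)

lemma yw_neq_Nil [simp]: "yw n g \<noteq> []" "[] \<noteq> yw n g"
  by (simp_all add: yw_def)

lemma x_of_y_eq_Nil [simp]: "x_of_y w = [] \<longleftrightarrow> w = []" "[] = x_of_y w \<longleftrightarrow> w = []"
  by (cases w; force simp: x_of_y_Cons)+

lemma y_of_x_of_y: "w \<in> ywords S \<Longrightarrow> y_of_x 1 (x_of_y w) = w"
  by (rule y_of_x_x_of_y) (auto simp: ywords_def)

lemma words1_Nil [simp]: "[] \<in> words1 S"
  by (simp add: words1_def)

lemma yw_append_words1: "g \<in> S \<Longrightarrow> yw n g @ w \<in> words1 S \<longleftrightarrow> w \<in> words1 S"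
  by (cases w rule: rev_cases) (auto simp: words1_iff yw_def xwords_iff)

lemma X_Cons_words1: "X g # w \<in> words1 S \<longleftrightarrow> g \<in> S \<and> w \<in> words1 S"
  by (cases w rule: rev_cases) (auto simp: words1_iff xwords_iff)

lemma x_of_y_words1: "w \<in> ywords S \<Longrightarrow> x_of_y w \<in> words1 S"
proof (induction w)
  case (Cons a w)
  then show ?case
    by (cases a) (simp add: x_of_y_Cons ywords_Cons yw_append_words1)
qed simp

text \<open>
  The argument \<open>m\<close> of \<^const>\<open>y_of_x\<close> stands for \<open>m - 1\<close> letters \<open>X0\<close> that have been passed.  The
  empty word is exceptional, as these letters are lost there.
\<close>

lemma y_of_x_aux:
  "\<lbrakk>w \<in> words1 S; m \<ge> 1\<rbrakk> \<Longrightarrow> y_of_x m w \<in> ywords S \<and>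
     (w \<noteq> [] \<longrightarrow> x_of_y (y_of_x m w) = replicate (m - 1) X0 @ w)"
proof (induction m w rule: y_of_x.induct)
  case (2 n w)
  have w: "w \<in> words1 S" "w \<noteq> []"
    using "2.prems"(1) by (cases w rule: rev_cases; auto simp: words1_iff xwords_iff)+
  have "replicate n X0 = replicate (n - 1) X0 @ [X0]"
    using "2.prems"(2) by (metis Suc_pred' less_eq_Suc_le One_nat_def replicate_append_same replicate_Suc)
  then show ?case
    using "2.IH" [OF w(1)] w(2) by simp
next
  case (3 n g w)
  then have w: "w \<in> words1 S" "g \<in> S"
    by (simp_all add: X_Cons_words1)
  then show ?case
    using "3.IH" [OF w(1)] "3.prems"(2)
    by (cases "w = []") (auto simp: ywords_Cons x_of_y_Cons yw_def)
qed simp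

lemma y_of_x_ywords: "w \<in> words1 S \<Longrightarrow> y_of_x 1 w \<in> ywords S"
  by (simp add: y_of_x_aux)

lemma x_of_y_of_x: "w \<in> words1 S \<Longrightarrow> x_of_y (y_of_x 1 w) = w"
  using y_of_x_aux [of w S 1] by (cases "w = []") simp_all

lemma words1_cases:
  assumes "w \<in> words1 S"
  obtains u where "u \<in> ywords S" "w = x_of_y u" "y_of_x 1 w = u"
  using assms y_of_x_ywords x_of_y_of_x by metis

lemma yw_prefix:
  assumes "n \<ge> 1" "m \<ge> 1"
  shows "take (length (yw n g)) (yw m h @ w) = yw n g \<longleftrightarrow> n = m \<and> g = h"
proof
  assume "take (length (yw n g)) (yw m h @ w) = yw n g"
  then have eq: "yw m h @ w = yw n g @ drop (length (yw n g)) (yw m h @ w)"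
    by (metis append_take_drop_id)
  have "y_of_x 1 (yw k f @ v) = (k, f) # y_of_x 1 v" if "k \<ge> 1" for k f and v :: "'a xword"
  proof -
    have "y_of_x l (replicate i X0 @ X f # v) = (l + i, f) # y_of_x 1 v" for l i
      by (induction i arbitrary: l) auto
    then show ?thesis
      using that by (simp add: yw_def)
  qed
  then show "n = m \<and> g = h"
    using arg_cong [OF eq, of "y_of_x 1"] assms by simp
qed (simp add: yw_def)

lemma lookup_conc_yw:
  assumes "n \<ge> 1" "m \<ge> 1"
  shows "Poly_Mapping.lookup (conc (of_word (yw m h)) p) (yw n g @ w) =
    (if n = m \<and> g = h then Poly_Mapping.lookup p w else 0)"
proof -
  have "length (yw n g) = length (yw m h)" if "n = m"
    using that by (simp add: yw_def)
  then show ?thesis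
    using yw_prefix [of m n h g w] assms by (auto simp: lookup_conc_word)
qed


section \<open>The harmonic product\<close>

lemma harm_word_Nil_right [simp]: "harm_word G u [] = of_word (x_of_y u)"
  by (cases u) simp_all

lemma qlinear_harm_left: "qlinear_on UNIV (\<lambda>p. harm G p q)"
  unfolding harm_def by (rule qlinear_bilin_ext_left)

lemma qlinear_harm_right: "qlinear_on UNIV (harm G p)"
  unfolding harm_def by (rule qlinear_bilin_ext_right)

lemma harm_of_word: "harm G (of_word u) (of_word v) = harm_word G (y_of_x 1 u) (y_of_x 1 v)"
  unfolding harm_def by (rule bilin_ext_of_word)

lemmas harm_zero [simp] = qlinear_zero [OF qlinear_harm_left] qlinear_zero [OF qlinear_harm_right]

lemma harm_one_left:
  assumes "p \<in> HX1 S"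
  shows "harm G (of_word []) p = p"
proof -
  have "harm G (of_word []) p = lin_ext (\<lambda>w. harm G (of_word []) (of_word w)) p"
    by (rule qlinear_eq_lin_ext) (rule qlinear_harm_right)
  also have "\<dots> = lin_ext of_word p"
    using assms by (intro lin_ext_cong) (auto simp: HX1_def harm_of_word x_of_y_of_x)
  finally show ?thesis
    by (simp add: lin_ext_words)
qed

lemma harm_one_right:
  assumes "p \<in> HX1 S"
  shows "harm G p (of_word []) = p"
proof -
  have "harm G p (of_word []) = lin_ext (\<lambda>w. harm G (of_word w) (of_word [])) p"
    by (rule qlinear_eq_lin_ext) (rule qlinear_harm_left)
  also have "\<dots> = lin_ext of_word p"
    using assms by (intro lin_ext_cong) (auto simp: HX1_def harm_of_word x_of_y_of_x)
  finally show ?thesis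
    by (simp add: lin_ext_words)
qed

lemma bilinear_on_eqI:
  assumes "\<And>q. qlinear_on UNIV (\<lambda>p. f p q)" "\<And>p. qlinear_on UNIV (f p)"
    and "\<And>q. qlinear_on UNIV (\<lambda>p. g p q)" "\<And>p. qlinear_on UNIV (g p)"
    and "\<And>u v. \<lbrakk>u \<in> W; v \<in> W\<rbrakk> \<Longrightarrow> f (of_word u) (of_word v) = g (of_word u) (of_word v)"
    and "Poly_Mapping.keys p \<subseteq> W" "Poly_Mapping.keys q \<subseteq> W"
  shows "f p q = g p q"
proof -
  have expand: "h p q = lin_ext (\<lambda>u. lin_ext (\<lambda>v. h (of_word u) (of_word v)) q) p"
    if "\<And>q. qlinear_on UNIV (\<lambda>p. h p q)" "\<And>p. qlinear_on UNIV (h p)" for h :: "'a ncpoly \<Rightarrow> 'a ncpoly \<Rightarrow> 'b"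
  proof -
    have "h p q = lin_ext (\<lambda>u. h (of_word u) q) p"
      by (rule qlinear_eq_lin_ext) (rule that(1))
    moreover have "h (of_word u) q = lin_ext (\<lambda>v. h (of_word u) (of_word v)) q" for u
      by (rule qlinear_eq_lin_ext) (rule that(2))
    ultimately show ?thesis
      by simp
  qed
  show ?thesis
    unfolding expand [of f, OF assms(1,2)] expand [of g, OF assms(3,4)]
    by (intro lin_ext_cong assms(5)) (use assms(6,7) in auto)
qed

lemma dl_conc_yw:
  assumes "m \<ge> 1"
  shows "dl (X h) (conc (of_word (yw m g)) p) = (if m = 1 \<and> g = h then p else 0)"
proof (rule poly_mapping_eqI)
  fix w
  have "Poly_Mapping.lookup (conc (of_word (yw m g)) p) (yw 1 h @ w) =
      (if 1 = m \<and> h = g then Poly_Mapping.lookup p w else 0)"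
    by (rule lookup_conc_yw) (use assms in simp_all)
  then show "Poly_Mapping.lookup (dl (X h) (conc (of_word (yw m g)) p)) w =
      Poly_Mapping.lookup (if m = 1 \<and> g = h then p else 0) w"
    by (auto simp: yw_def)
qed

lemma dl_x_of_y:
  "n \<ge> 1 \<Longrightarrow> dl (X h) (of_word (x_of_y ((n, g) # u))) = (if n = 1 \<and> g = h then of_word (x_of_y u) else 0)"
  using dl_conc_yw [of n h g "of_word (x_of_y u)"] by (simp add: conc_of_word x_of_y_Cons)

lemma HX1_dl: "p \<in> HX1 S \<Longrightarrow> dl (X g) p \<in> HX1 S"
  by (fastforce simp: HX1_def keys_dl X_Cons_words1)

text \<open>
  The letters \<open>X g\<close> are the generators \<open>y\<^sub>1\<^sub>,\<^sub>g\<close>.  Since the indices of the contracted letters in a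
  harmonic product add up to at least 2, removing a leading \<open>X g\<close> is a derivation.
\<close>

lemma dl_harm:
  assumes "p \<in> HX1 S" "q \<in> HX1 S"
  shows "dl (X a) (harm G p q) = harm G (dl (X a) p) q + harm G p (dl (X a) q)"
proof (rule bilinear_on_eqI [where f = "\<lambda>p q. dl (X a) (harm G p q)"
      and g = "\<lambda>p q. harm G (dl (X a) p) q + harm G p (dl (X a) q)" and W = "words1 S"])
  fix u v
  assume "u \<in> words1 S" "v \<in> words1 S"
  then obtain u' v' where u': "u' \<in> ywords S" "u = x_of_y u'" and v': "v' \<in> ywords S" "v = x_of_y v'"
    by (metis words1_cases)
  show "dl (X a) (harm G (of_word u) (of_word v)) =
      harm G (dl (X a) (of_word u)) (of_word v) + harm G (of_word u) (dl (X a) (of_word v))"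
  proof (cases "u' = [] \<or> v' = []")
    case True
    have "of_word u \<in> HX1 S" "of_word v \<in> HX1 S"
      using u' v' by (simp_all add: HX1_def x_of_y_words1)
    then show ?thesis
      using True HX1_dl [of "of_word u" S a] HX1_dl [of "of_word v" S a]
      by (auto simp: u'(2) v'(2) harm_one_left harm_one_right)
  next
    case False
    then obtain m g u'' n h v'' where *: "u' = (m, g) # u''" "v' = (n, h) # v''"
      by (metis neq_Nil_conv surj_pair)
    then have mn: "m \<ge> 1" "n \<ge> 1" "u'' \<in> ywords S" "v'' \<in> ywords S"
      using u' v' by (simp_all add: ywords_Cons)
    have harm: "harm G (of_word (x_of_y s)) (of_word (x_of_y t)) = harm_word G s t"
      if "s \<in> ywords S" "t \<in> ywords S" for s t
      using that by (simp add: harm_of_word y_of_x_of_y)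
    show ?thesis
      unfolding u'(2) v'(2) harm [OF u'(1) v'(1)] unfolding *
      using mn u'(1) v'(1) unfolding *
      by (auto simp: dl_x_of_y dl_conc_yw dl_add harm)
  qed
qed (use assms in \<open>auto simp: HX1_def qlinear_on_def dl_add dl_scaleQ scaleQ_add_right
    qlinear_on_add [OF qlinear_harm_left] qlinear_on_add [OF qlinear_harm_right]
    qlinear_on_scaleQ [OF qlinear_harm_left] qlinear_on_scaleQ [OF qlinear_harm_right]\<close>)

lemma keys_conc_yw:
  assumes "g \<in> S" "Poly_Mapping.keys p \<subseteq> words1 S"
  shows "Poly_Mapping.keys (conc (of_word (yw n g)) p) \<subseteq> words1 S"
  unfolding conc_def by (rule keys_bilin_ext) (use assms in \<open>auto simp: yw_append_words1\<close>)

lemma keys_harm_word: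
  "\<lbrakk>monoid G; u \<in> ywords (carrier G); v \<in> ywords (carrier G)\<rbrakk> \<Longrightarrow>
     Poly_Mapping.keys (harm_word G u v) \<subseteq> words1 (carrier G)"
proof (induction G u v rule: harm_word.induct)
  case (3 G m g u n h v)
  then have "g \<otimes>\<^bsub>G\<^esub> h \<in> carrier G"
    by (auto simp: ywords_Cons intro: monoid.m_closed)
  with 3 show ?case
    unfolding harm_word.simps
    by (intro keys_subset_add keys_conc_yw) (auto simp: ywords_Cons)
qed (simp_all add: x_of_y_words1)

lemma HX1_harm:
  "\<lbrakk>monoid G; p \<in> HX1 (carrier G); q \<in> HX1 (carrier G)\<rbrakk> \<Longrightarrow> harm G p q \<in> HX1 (carrier G)"
  unfolding HX1_def harm_def mem_Collect_eq
  by (rule keys_bilin_ext, rule keys_harm_word) (auto intro: y_of_x_ywords)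

context finite_comm_group
begin

text \<open>The harmonic product of two words of the harmonic algebra, and zero for other words.\<close>

definition harm1 :: "'g xword \<Rightarrow> 'g xword \<Rightarrow> 'g ncpoly" where
  "harm1 u v = (if u \<in> words1 (carrier G) \<and> v \<in> words1 (carrier G)
     then harm_word G (y_of_x 1 u) (y_of_x 1 v) else 0)"

text \<open>
  The coefficient of a harmonic product at a word starting with \<open>y\<^sub>n\<^sub>,\<^sub>g\<close>: this letter comes from
  the first factor, from the second factor, or from the contraction of two letters.
\<close>

lemma lookup_harm1_yw:
  assumes n: "n \<ge> 1" and g: "g \<in> carrier G"
  shows "Poly_Mapping.lookup (harm1 u v) (yw n g @ w) =
     (if take (length (yw n g)) u = yw n g
      then Poly_Mapping.lookup (harm1 (drop (length (yw n g)) u) v) w else 0)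
   + (if take (length (yw n g)) v = yw n g
      then Poly_Mapping.lookup (harm1 u (drop (length (yw n g)) v)) w else 0)
   + (\<Sum>k=1..<n. \<Sum>h\<in>carrier G.
        if take (length (yw k h)) u = yw k h \<and>
          take (length (yw (n - k) (g \<otimes> inv h))) v = yw (n - k) (g \<otimes> inv h)
        then Poly_Mapping.lookup (harm1 (drop (length (yw k h)) u)
          (drop (length (yw (n - k) (g \<otimes> inv h))) v)) w else 0)"
proof -
  let ?W = "words1 (carrier G)" and ?L = "\<lambda>k h. length (yw k h)"
  have drop_words1: "drop (?L k h) s \<in> ?W \<longleftrightarrow> s \<in> ?W"
    if "take (?L k h) s = yw k h" "h \<in> carrier G" for k h s
    using yw_append_words1 [OF that(2), of k "drop (?L k h) s"] that(1) by (metis append_take_drop_id)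
  have lookup_word: "Poly_Mapping.lookup (of_word s) (yw n g @ w) =
      (if take (?L n g) s = yw n g then Poly_Mapping.lookup (of_word (drop (?L n g) s)) w else 0)" for s
    using append_eq_conv_conj [of "yw n g" w s] by (auto simp: lookup_of_word)
  have Nil: "harm1 [] s = of_word s" "harm1 s [] = of_word s" if "s \<in> ?W" for s
    using that by (simp_all add: harm1_def x_of_y_of_x)
  show ?thesis
  proof (cases "u \<in> ?W \<and> v \<in> ?W")
    case False
    then show ?thesis
      using g by (auto simp: harm1_def drop_words1 intro!: sum.neutral)
  next
    case True
    then obtain u' v' where u': "u' \<in> ywords (carrier G)" "u = x_of_y u'"
      and v': "v' \<in> ywords (carrier G)" "v = x_of_y v'"
      by (metis words1_cases)
    consider "u' = []" | "v' = []" | m a u'' l b v'' where "u' = (m, a) # u''" "v' = (l, b) # v''"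
      by (metis neq_Nil_conv surj_pair)
    then show ?thesis
    proof cases
      case 1
      then have "u = []"
        by (simp add: u')
      then show ?thesis
        using True g by (simp add: Nil lookup_word drop_words1)
    next
      case 2
      then have "v = []"
        by (simp add: v')
      then show ?thesis
        using True g by (simp add: Nil lookup_word drop_words1)
    next
      case 3
      then have ml: "m \<ge> 1" "l \<ge> 1" "a \<in> carrier G" "b \<in> carrier G"
        and Y: "u'' \<in> ywords (carrier G)" "v'' \<in> ywords (carrier G)"
        using u' v' by (simp_all add: ywords_Cons)
      have harm1: "harm1 (x_of_y s) (x_of_y t) = harm_word G s t"
        if "s \<in> ywords (carrier G)" "t \<in> ywords (carrier G)" for s t
        using that by (simp add: harm1_def x_of_y_words1 y_of_x_of_y)
      have u: "u = yw m a @ x_of_y u''" and v: "v = yw l b @ x_of_y v''"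
        by (simp_all add: u' v' 3 x_of_y_Cons)
      have "Poly_Mapping.lookup (harm1 u v) (yw n g @ w) =
          (if n = m \<and> g = a then Poly_Mapping.lookup (harm1 (x_of_y u'') v) w else 0)
        + (if n = l \<and> g = b then Poly_Mapping.lookup (harm1 u (x_of_y v'')) w else 0)
        + (if n = m + l \<and> g = a \<otimes> b then Poly_Mapping.lookup (harm1 (x_of_y u'') (x_of_y v'')) w else 0)"
        unfolding u'(2) v'(2) harm1 [OF u'(1) v'(1)] harm1 [OF Y(1) v'(1)] harm1 [OF u'(1) Y(2)]
          harm1 [OF Y] unfolding 3 harm_word.simps lookup_add
        using ml n by (simp add: lookup_conc_yw)
      moreover have "(\<Sum>k=1..<n. \<Sum>h\<in>carrier G.
          if take (?L k h) u = yw k h \<and> take (?L (n - k) (g \<otimes> inv h)) v = yw (n - k) (g \<otimes> inv h)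
          then Poly_Mapping.lookup (harm1 (drop (?L k h) u) (drop (?L (n - k) (g \<otimes> inv h)) v)) w else 0) =
        (if n = m + l \<and> g = a \<otimes> b then Poly_Mapping.lookup (harm1 (x_of_y u'') (x_of_y v'')) w else 0)"
        (is "?S = (if _ then ?c else 0)")
      proof -
        have "?S = (\<Sum>k=1..<n. \<Sum>h\<in>carrier G.
            if h = a then if k = m then if n - m = l \<and> g \<otimes> inv a = b then ?c else 0 else 0 else 0)"
        proof (intro sum.cong refl)
          fix k h
          assume "k \<in> {1..<n}"
          then have "take (?L k h) u = yw k h \<longleftrightarrow> k = m \<and> h = a"
            "take (?L (n - k) (g \<otimes> inv h)) v = yw (n - k) (g \<otimes> inv h) \<longleftrightarrow> n - k = l \<and> g \<otimes> inv h = b"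
            using ml yw_prefix [of k m h a "x_of_y u''"] yw_prefix [of "n - k" l "g \<otimes> inv h" b "x_of_y v''"]
            unfolding u v by auto
          moreover have "drop (?L m a) u = x_of_y u''" "drop (?L l b) v = x_of_y v''"
            by (simp_all add: u v)
          ultimately show "(if take (?L k h) u = yw k h \<and>
                take (?L (n - k) (g \<otimes> inv h)) v = yw (n - k) (g \<otimes> inv h)
              then Poly_Mapping.lookup (harm1 (drop (?L k h) u)
                (drop (?L (n - k) (g \<otimes> inv h)) v)) w else 0) =
              (if h = a then if k = m then if n - m = l \<and> g \<otimes> inv a = b then ?c else 0 else 0 else 0)"
            by (cases "k = m \<and> h = a"; cases "n - k = l \<and> g \<otimes> inv h = b") auto
        qed
        also have "\<dots> = (\<Sum>k=1..<n. if k = m then if n - m = l \<and> g \<otimes> inv a = b then ?c else 0 else 0)"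
          using ml finite_carrier by simp
        also have "\<dots> = (if m \<in> {1..<n} \<and> n - m = l \<and> g \<otimes> inv a = b then ?c else 0)"
          by simp
        also have "g \<otimes> inv a = b \<longleftrightarrow> g = a \<otimes> b"
          using ml g inv_solve_right [of b g a] m_comm [of a b] by auto
        also have "m \<in> {1..<n} \<and> n - m = l \<and> g = a \<otimes> b \<longleftrightarrow> n = m + l \<and> g = a \<otimes> b"
          using ml by auto
        finally show ?thesis .
      qed
      moreover have "(if take (?L n g) u = yw n g then Poly_Mapping.lookup (harm1 (drop (?L n g) u) v) w else 0) =
          (if n = m \<and> g = a then Poly_Mapping.lookup (harm1 (x_of_y u'') v) w else 0)"
        using yw_prefix [OF n ml(1), of g a "x_of_y u''", folded u] u by auto
      moreover have "(if take (?L n g) v = yw n g then Poly_Mapping.lookup (harm1 u (drop (?L n g) v)) w else 0) =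
          (if n = l \<and> g = b then Poly_Mapping.lookup (harm1 u (x_of_y v'')) w else 0)"
        using yw_prefix [OF n ml(2), of g b "x_of_y v''", folded v] v by auto
      ultimately show ?thesis
        by (simp only:)
    qed
  qed
qed

lemma ser2_mult_Delta_y:
  "ser2_mult (Delta_y G n g) Q u v =
     (if take (length (yw n g)) u = yw n g then Q (drop (length (yw n g)) u) v else 0)
   + (if take (length (yw n g)) v = yw n g then Q u (drop (length (yw n g)) v) else 0)
   + (\<Sum>k=1..<n. \<Sum>h\<in>carrier G.
        if take (length (yw k h)) u = yw k h \<and>
          take (length (yw (n - k) (g \<otimes> inv h))) v = yw (n - k) (g \<otimes> inv h)
        then Q (drop (length (yw k h)) u) (drop (length (yw (n - k) (g \<otimes> inv h))) v) else 0)"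
  unfolding Delta_y_def ser2_mult_add ser2_mult_sum ser2_mult_tensor_word by simp

text \<open>The harmonic coproduct of a word is the transpose of the harmonic product.\<close>

lemma Delta_harm_coeff:
  fixes u v :: "'g xword"
  assumes "w \<in> ywords (carrier G)"
  shows "foldr (\<lambda>(n, g). ser2_mult (Delta_y G n g)) w (tensor (ser_word []) (ser_word [])) u v =
   (Poly_Mapping.lookup (harm1 u v) (x_of_y w) *\<^sub>Q 1 :: 'a::comm_rat_algebra)"
    (is "foldr ?f w ?e u v = _")
  using assms
proof (induction w arbitrary: u v)
  case Nil
  have "Poly_Mapping.lookup (harm_word G s t) [] = (if s = [] \<and> t = [] then 1 else 0)" for s t
    by (cases "(G, s, t)" rule: harm_word.cases)
       (auto simp: lookup_of_word lookup_add lookup_conc_word)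
  moreover have "y_of_x 1 s = [] \<longleftrightarrow> s = []" if "s \<in> words1 (carrier G)" for s
    using x_of_y_of_x [OF that] by auto
  ultimately show ?case
    by (auto simp: tensor_def ser_word_def harm1_def scaleQ_one lookup_of_word x_of_y_of_x)
next
  case (Cons a w)
  obtain n g where a: "a = (n, g)"
    by force
  with Cons.prems have n: "n \<ge> 1" and g: "g \<in> carrier G" and w: "w \<in> ywords (carrier G)"
    by (simp_all add: ywords_Cons)
  have "foldr ?f (a # w) ?e u v = ser2_mult (Delta_y G n g) (foldr ?f w ?e) u v"
    by (simp only: foldr.simps o_apply a prod.case)
  then show ?case
    unfolding ser2_mult_Delta_y Cons.IH [OF w]
    unfolding a x_of_y_Cons lookup_harm1_yw [OF n g] scaleQ_add_left scaleQ_sum_left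
    by (simp add: if_distrib [of "\<lambda>c. c *\<^sub>Q _"] cong: if_cong)
qed

lemma Delta_harm_eq:
  fixes \<Psi> :: "('g, 'a::comm_rat_algebra) series"
  assumes "\<And>w. w \<notin> words1 (carrier G) \<Longrightarrow> \<Psi> w = 0"
  shows "Delta_harm G \<Psi> u v = lin_ext \<Psi> (harm1 u v)"
proof -
  have "\<Psi> w * foldr (\<lambda>(n, g). ser2_mult (Delta_y G n g)) (y_of_x 1 w)
        (tensor (ser_word []) (ser_word [])) u v =
      \<Psi> w * (Poly_Mapping.lookup (harm1 u v) w *\<^sub>Q 1)" for w
  proof (cases "w \<in> words1 (carrier G)")
    case True
    then show ?thesis
      by (simp add: Delta_harm_coeff y_of_x_ywords x_of_y_of_x)
  qed (simp add: assms)
  then show ?thesis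
    by (simp add: Delta_harm_def ser2_ext_def Sum_any_lin_ext)
qed

lemma Delta_harm_tensor_iff:
  fixes \<Psi> :: "('g, 'a::comm_rat_algebra) series"
  assumes supp: "\<And>w. w \<notin> words1 (carrier G) \<Longrightarrow> \<Psi> w = 0"
  shows "Delta_harm G \<Psi> = tensor \<Psi> \<Psi> \<longleftrightarrow>
    (\<forall>p\<in>HX1 (carrier G). \<forall>q\<in>HX1 (carrier G).
      lin_ext \<Psi> (harm G p q) = lin_ext \<Psi> p * lin_ext \<Psi> q)" (is "?L \<longleftrightarrow> ?R")
proof
  assume ?L
  then have "lin_ext \<Psi> (harm1 u v) = \<Psi> u * \<Psi> v" for u v
    using Delta_harm_eq [of \<Psi> u v, OF supp] by (simp add: tensor_def)
  then have word: "lin_ext \<Psi> (harm G (of_word u) (of_word v)) = lin_ext \<Psi> (of_word u) * lin_ext \<Psi> (of_word v)"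
    if "u \<in> words1 (carrier G)" "v \<in> words1 (carrier G)" for u v
    using that by (simp add: harm_of_word) (metis harm1_def)
  show ?R
  proof (intro ballI)
    fix p q
    assume "p \<in> HX1 (carrier G)" "q \<in> HX1 (carrier G)"
    then show "lin_ext \<Psi> (harm G p q) = lin_ext \<Psi> p * lin_ext \<Psi> q"
      unfolding HX1_def mem_Collect_eq
    proof (rule bilinear_on_eqI [rotated 5])
      show "qlinear_on UNIV (\<lambda>p. lin_ext \<Psi> (harm G p q))" for q
        by (rule qlinear_compose [OF qlinear_lin_ext qlinear_harm_left])
      show "qlinear_on UNIV (\<lambda>q. lin_ext \<Psi> (harm G p q))" for p
        by (rule qlinear_compose [OF qlinear_lin_ext qlinear_harm_right])
      show "qlinear_on UNIV (\<lambda>p. lin_ext \<Psi> p * lin_ext \<Psi> q)" for q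
        by (simp add: qlinear_on_def lin_ext_add lin_ext_scaleQ scaleQ_mult_left distrib_right)
      show "qlinear_on UNIV (\<lambda>q. lin_ext \<Psi> p * lin_ext \<Psi> q)" for p
        by (simp add: qlinear_on_def lin_ext_add lin_ext_scaleQ scaleQ_mult_right distrib_left)
    qed (rule word)
  qed
next
  assume R: ?R
  show ?L
  proof (intro ext)
    fix u v
    show "Delta_harm G \<Psi> u v = tensor \<Psi> \<Psi> u v"
    proof (cases "u \<in> words1 (carrier G) \<and> v \<in> words1 (carrier G)")
      case True
      then show ?thesis
        using R [rule_format, of "of_word u" "of_word v"] Delta_harm_eq [OF supp]
        by (simp add: HX1_def harm_of_word harm1_def tensor_def)
    next
      case False
      then show ?thesis
        using supp Delta_harm_eq [OF supp] by (auto simp: harm1_def tensor_def)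
    qed
  qed
qed

end


section \<open>The change of indices q\<close>

context finite_comm_group
begin

text \<open>The inverse of \<open>q_step\<close>: the indices become the partial products.\<close>

fun r_step :: "'g \<Rightarrow> 'g xword \<Rightarrow> 'g xword" where
  "r_step h [] = []"
| "r_step h (X0 # w) = X0 # r_step h w"
| "r_step h (X g # w) = X (g \<otimes> h) # r_step (g \<otimes> h) w"

lemma r_step_q_step: "\<lbrakk>w \<in> xwords (carrier G); h \<in> carrier G\<rbrakk> \<Longrightarrow> r_step h (q_step G h w) = w"
proof (induction w arbitrary: h)
  case (Cons a w)
  then show ?case
    by (cases a) (auto simp: xwords_iff m_assoc)
qed (simp_all add: xwords_iff)

lemma q_step_r_step: "\<lbrakk>w \<in> xwords (carrier G); h \<in> carrier G\<rbrakk> \<Longrightarrow> q_step G h (r_step h w) = w"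
proof (induction w arbitrary: h)
  case (Cons a w)
  then show ?case
    by (cases a) (auto simp: xwords_iff m_assoc)
qed (simp_all add: xwords_iff)

lemma r_step_xwords: "\<lbrakk>w \<in> xwords (carrier G); h \<in> carrier G\<rbrakk> \<Longrightarrow> r_step h w \<in> xwords (carrier G)"
proof (induction w arbitrary: h)
  case (Cons a w)
  then show ?case
    by (cases a) (auto simp: xwords_iff m_assoc)
qed (simp_all add: xwords_iff)

text \<open>Its linear extension with initial index \<open>\<one>\<close>, the inverse of \<open>q_map\<close> by the lemmas below.\<close>

definition r_map :: "'g ncpoly \<Rightarrow> 'g ncpoly" where
  "r_map = lin_ext (\<lambda>w. of_word (r_step \<one> w))"

lemma qlinear_r_map: "qlinear_on UNIV r_map"
  unfolding r_map_def by (rule qlinear_lin_ext)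

lemma r_map_HX: "p \<in> HX (carrier G) \<Longrightarrow> r_map p \<in> HX (carrier G)"
  using keys_lin_ext [of "\<lambda>w. of_word (r_step \<one> w)" p] r_step_xwords [OF _ one_closed]
  by (fastforce simp: HX_def r_map_def)

lemma q_map_r_map:
  assumes "p \<in> HX (carrier G)"
  shows "q_map G (r_map p) = p"
proof -
  have "q_map G (r_map p) = lin_ext (\<lambda>w. q_map G (of_word (r_step \<one> w))) p"
    unfolding r_map_def by (rule qlinear_lin_ext_commute) (simp add: q_map_def qlinear_lin_ext)
  also have "\<dots> = lin_ext of_word p"
    using assms by (intro lin_ext_cong) (auto simp: q_map_def q_word_def HX_def q_step_r_step)
  finally show ?thesis
    by (simp add: lin_ext_words)
qed

lemma r_map_q_map:
  assumes "p \<in> HX (carrier G)"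
  shows "r_map (q_map G p) = p"
proof -
  have "r_map (q_map G p) = lin_ext (\<lambda>w. r_map (of_word (q_word G w))) p"
    unfolding q_map_def by (rule qlinear_lin_ext_commute) (rule qlinear_r_map)
  also have "\<dots> = lin_ext of_word p"
    using assms by (intro lin_ext_cong) (auto simp: r_map_def q_word_def HX_def r_step_q_step)
  finally show ?thesis
    by (simp add: lin_ext_words)
qed

lemma q_inv_eq: "p \<in> HX (carrier G) \<Longrightarrow> q_inv G p = r_map p"
  unfolding q_inv_def
  by (rule inv_into_f_eq) (auto intro: inj_on_inverseI [of _ r_map] simp: r_map_q_map r_map_HX q_map_r_map)

text \<open>A word starts with \<open>x\<^sub>1\<close> iff its image does, and then the remaining index changes are the same.\<close>

lemma D1_r_map:
  assumes "p \<in> HX (carrier G)"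
  shows "D1 (r_map p) = r_map (D1 p)"
proof -
  have "D1 (r_map p) = lin_ext (\<lambda>w. D1 (of_word (r_step \<one> w))) p"
    unfolding r_map_def by (rule qlinear_lin_ext_commute) (rule qlinear_dl)
  also have "\<dots> = lin_ext (\<lambda>w. r_map (D1 (of_word w))) p"
  proof (rule lin_ext_cong)
    fix w
    assume "w \<in> Poly_Mapping.keys p"
    then have "w \<in> xwords (carrier G)"
      using assms by (auto simp: HX_def)
    then show "D1 (of_word (r_step \<one> w)) = r_map (D1 (of_word w))"
      by (cases "(\<one>, w)" rule: r_step.cases)
         (auto simp: dl_of_word_Cons qlinear_zero [OF qlinear_r_map] r_map_def xwords_iff)
  qed
  also have "\<dots> = r_map (D1 p)"
    by (rule qlinear_eq_lin_ext [symmetric]) (rule qlinear_compose [OF qlinear_r_map qlinear_dl])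
  finally show ?thesis .
qed

lemma D1_funpow_r_map:
  assumes "p \<in> HX (carrier G)"
  shows "(D1 ^^ n) (r_map p) = r_map ((D1 ^^ n) p)"
proof (induction n)
  case (Suc n)
  have "(D1 ^^ n) p \<in> HX (carrier G)"
    by (induction n) (simp_all add: assms HX_dl)
  then show ?case
    using Suc by (simp add: D1_r_map)
qed simp

lemma words1_subset_xwords: "words1 S \<subseteq> xwords S"
  by (auto simp: words1_iff)

lemma HX1_subset_HX: "HX1 S \<subseteq> HX S"
  using words1_subset_xwords by (fastforce simp: HX1_def HX_def)

lemma q_ser_eq:
  fixes \<Phi> :: "('g, 'a::comm_rat_algebra) series"
  assumes "\<Phi> \<in> Xseries (carrier G)" "v \<in> xwords (carrier G)"
  shows "q_ser G \<Phi> v = \<Phi> (r_step \<one> v)"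
proof -
  have "\<Phi> w * ser_word (q_word G w) v = (if w = r_step \<one> v then \<Phi> w else 0)" for w
  proof (cases "w \<in> xwords (carrier G)")
    case True
    then have "v = q_word G w \<longleftrightarrow> w = r_step \<one> v"
      using assms(2) r_step_q_step [OF True one_closed] q_step_r_step [OF assms(2) one_closed]
      by (auto simp: q_word_def)
    then show ?thesis
      by (simp add: ser_word_def)
  next
    case False
    then show ?thesis
      using assms by (auto simp: Xseries_def)
  qed
  then have "q_ser G \<Phi> v = Sum_any (\<lambda>w. if w = r_step \<one> v then \<Phi> w else 0)"
    by (simp add: q_ser_def ser_ext_def)
  also have "\<dots> = (\<Sum>w\<in>{r_step \<one> v}. if w = r_step \<one> v then \<Phi> w else 0)"
    by (rule Sum_any.expand_superset) auto
  finally show ?thesis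
    by simp
qed

lemma lin_ext_pi_q:
  fixes \<Phi> :: "('g, 'a::comm_rat_algebra) series"
  assumes "\<Phi> \<in> Xseries (carrier G)" "p \<in> HX1 (carrier G)"
  shows "lin_ext (pi_Y (carrier G) (q_ser G \<Phi>)) p = lin_ext \<Phi> (r_map p)"
proof -
  have "lin_ext \<Phi> (r_map p) = lin_ext (\<lambda>w. \<Phi> (r_step \<one> w)) p"
    unfolding r_map_def by (simp add: qlinear_lin_ext_commute [OF qlinear_lin_ext])
  also have "\<dots> = lin_ext (pi_Y (carrier G) (q_ser G \<Phi>)) p"
  proof (rule lin_ext_cong)
    fix w
    assume "w \<in> Poly_Mapping.keys p"
    then have w: "w \<in> words1 (carrier G)"
      using assms(2) by (auto simp: HX1_def)
    then have "w \<in> xwords (carrier G)"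
      using words1_subset_xwords by blast
    then show "\<Phi> (r_step \<one> w) = pi_Y (carrier G) (q_ser G \<Phi>) w"
      using w q_ser_eq [OF assms(1)] by (simp add: pi_Y_def)
  qed
  finally show ?thesis ..
qed


section \<open>Comparison of the harmonic relations\<close>

text \<open>The exponent of \<^const>\<open>Phi_corr\<close> as a power series; up to sign it is the exponent of \<^const>\<open>rho\<close>.\<close>

definition corr_exponent :: "('g, 'a::comm_rat_algebra) series \<Rightarrow> 'a fps" where
  "corr_exponent \<Phi> = Abs_fps (\<lambda>n.
     if n \<ge> 2 then ((- 1) ^ (n - 1) / of_nat n) *\<^sub>Q \<Phi> (yw n \<one>) else 0)"

lemma Phi_corr_eq: "Phi_corr G \<Phi> = letter_ser (X \<one>) (exp_fps (corr_exponent \<Phi>))"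
proof -
  have "(\<lambda>w. let n = length w in if n \<ge> 2 \<and> w = replicate n (X \<one>)
      then ((- 1) ^ (n - 1) / of_nat n) *\<^sub>Q \<Phi> (yw n \<one>) else 0) = letter_ser (X \<one>) (corr_exponent \<Phi>)"
    by (auto simp: fun_eq_iff letter_ser_def corr_exponent_def Let_def)
  then show ?thesis
    by (simp add: Phi_corr_def ser_exp_letter_ser)
qed

lemma rho_eq:
  assumes "Z \<in> shuffle_maps"
  shows "rho G Z = exp_op (exp_fps (- corr_exponent (Phi_reg G Z)))"
proof -
  have "((- 1) ^ n / of_nat n) *\<^sub>Q Z (of_word (yw n \<one>)) =
      - ((- 1) ^ (n - 1) / of_nat n) *\<^sub>Q Phi_reg G Z (yw n \<one>)" if n: "n \<ge> 2" for n
  proof -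
    have "yw n \<one> = X0 # replicate (n - 2) X0 @ [X \<one>]"
      using n by (cases n; cases "n - 1") (auto simp: yw_def)
    then have "of_word (yw n \<one>) \<in> HX0 G"
      unfolding HX0_iff' HX_of_word
      by (simp add: xwords_iff set_replicate_conv_if dl_of_word_Cons dr_of_word_snoc [of _ "X0 # replicate (n - 2) X0", simplified])
    then have "Phi_reg G Z (yw n \<one>) = Z (of_word (yw n \<one>))"
      using Phi_reg_HX0 [OF assms, of "of_word (yw n \<one>)"] by simp
    moreover have "(- 1 :: rat) ^ n = - ((- 1) ^ (n - 1))"
      using n by (cases n) simp_all
    ultimately show ?thesis
      by (simp add: scaleQ_minus_left)
  qed
  then show ?thesis
    unfolding rho_def corr_exponent_def
    by (intro arg_cong [where f = exp_op] arg_cong [where f = exp_fps] fps_ext) (simp add: scaleQ_minus_left)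
qed

lemma Phi_star_support:
  assumes "w \<notin> words1 (carrier G)"
  shows "Phi_star G \<Phi> w = 0"
proof -
  have "pi_Y (carrier G) (q_ser G \<Phi>) (drop i w) = 0" if "take i w = replicate i (X \<one>)" for i
  proof -
    have "replicate i (X \<one>) @ v \<in> words1 (carrier G) \<longleftrightarrow> v \<in> words1 (carrier G)" for v
      by (induction i) (simp_all add: X_Cons_words1)
    then have "drop i w \<notin> words1 (carrier G)"
      using assms that by (metis append_take_drop_id)
    then show ?thesis
      by (simp add: pi_Y_def)
  qed
  then show ?thesis
    unfolding Phi_star_def Phi_corr_eq ser_mult_letter_ser by (intro sum.neutral) simp
qed

lemma HX1_D1_funpow: "p \<in> HX1 S \<Longrightarrow> (D1 ^^ n) p \<in> HX1 S"
  by (induction n) (simp_all add: HX1_dl)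

lemma lin_ext_Phi_star:
  fixes \<Phi> :: "('g, 'a::comm_rat_algebra) series"
  assumes "\<Phi> \<in> Xseries (carrier G)" and p: "p \<in> HX1 (carrier G)" and N: "maxlen p \<le> N"
  shows "lin_ext (Phi_star G \<Phi>) p =
    (\<Sum>i\<le>N. exp_fps (corr_exponent \<Phi>) $ i * lin_ext \<Phi> ((D1 ^^ i) (r_map p)))"
  using assms subsetD [OF HX1_subset_HX p]
  by (simp add: Phi_star_def Phi_corr_eq lin_ext_ser_mult_letter_ser [OF N] lin_ext_pi_q
      HX1_D1_funpow D1_funpow_r_map)

text \<open>
  The polynomial with divided coefficients \<open>lin_ext \<Psi> (D1\<^sup>n p)\<close>; it is the pairing of \<open>p\<close> with the
  series \<open>exp (T x\<^sub>1) \<Psi>\<close>.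
\<close>

definition exp_pairing :: "('g, 'a::comm_rat_algebra) series \<Rightarrow> 'g ncpoly \<Rightarrow> 'a poly" where
  "exp_pairing \<Psi> p = Abs_poly (\<lambda>n. lin_ext \<Psi> (dpow D1 n p))"

lemma coeff_exp_pairing: "coeff (exp_pairing \<Psi> p) n = lin_ext \<Psi> (dpow D1 n p)"
  unfolding exp_pairing_def by (subst coeff_Abs_poly [of "maxlen p"]) (simp_all add: L.dpow_eq_0)

lemma degree_exp_pairing: "degree (exp_pairing \<Psi> p) \<le> maxlen p"
  by (rule degree_le) (simp add: coeff_exp_pairing L.dpow_eq_0)

lemma divided_coeff_exp_pairing: "fact n *\<^sub>Q coeff (exp_pairing \<Psi> p) n = lin_ext \<Psi> ((D1 ^^ n) p)"
  by (simp add: coeff_exp_pairing dpow_def lin_ext_scaleQ scaleQ_scaleQ scaleQ_one)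

lemma qlinear_exp_pairing: "qlinear_on UNIV (exp_pairing \<Psi>)"
  by (rule qlinear_onI; rule poly_eqI)
     (simp_all add: coeff_exp_pairing lin_ext_add lin_ext_scaleQ
       qlinear_on_add [OF qlinear_dpow [OF L.lin]] qlinear_on_scaleQ [OF qlinear_dpow [OF L.lin]])

lemma exp_pairing_one: "\<Psi> [] = 1 \<Longrightarrow> exp_pairing \<Psi> (of_word []) = [:1:]"
proof (rule poly_eqI)
  fix n
  assume "\<Psi> [] = 1"
  then show "coeff (exp_pairing \<Psi> (of_word [])) n = coeff [:1:] n"
    by (cases n) (simp_all add: coeff_exp_pairing L.dpow_ker)
qed

lemma Zsh_eq_exp_pairing:
  "\<lbrakk>Z \<in> shuffle_maps; p \<in> HX (carrier G)\<rbrakk> \<Longrightarrow> Zsh G Z p = exp_pairing (Phi_reg G Z) p"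
  by (rule poly_eqI) (simp add: coeff_Zsh coeff_exp_pairing)

lemma maxlen_D1_funpow: "maxlen ((D1 ^^ n) p) \<le> maxlen p"
proof -
  have "length w \<le> maxlen p" if "w \<in> Poly_Mapping.keys ((D1 ^^ n) p)" for w
    using that length_le_maxlen [of "replicate n (X \<one>) @ w" p] by (simp add: in_keys_iff lookup_dl_funpow)
  then show ?thesis
    unfolding maxlen_def [of "(D1 ^^ n) p"] by (intro Max.boundedI) auto
qed

lemma corr_exponent_0: "corr_exponent \<Phi> $ 0 = 0"
  by (simp add: corr_exponent_def)

text \<open>
  With \<open>E\<close> and \<open>R\<close> the exponentials defining \<^const>\<open>rho\<close> and \<^const>\<open>Phi_corr\<close>, both sides are
  expressed by \<open>\<Phi> (D\<^sup>n (q\<^sup>-\<^sup>1 p))\<close>, and the claim becomes \<open>E R = 1\<close>.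
\<close>

lemma rho_exp_pairing_Phi_star:
  assumes Z: "Z \<in> shuffle_maps" and p: "p \<in> HX1 (carrier G)"
  shows "rho G Z (exp_pairing (Phi_star G (Phi_reg G Z)) p) = Zsh G Z (q_inv G p)"
proof (rule poly_eq_divided_coeffI)
  fix m
  define \<Phi> where "\<Phi> = Phi_reg G Z"
  define N where "N = max (maxlen p) (maxlen (r_map p))"
  have N: "maxlen p \<le> N" "maxlen (r_map p) \<le> N"
    by (simp_all add: N_def)
  define E where "E = exp_fps (- corr_exponent \<Phi>)"
  define R where "R = exp_fps (corr_exponent \<Phi>)"
  have ER: "E * R = 1"
    using exp_fps_uminus [of "- corr_exponent \<Phi>"] by (simp add: E_def R_def corr_exponent_0)
  have X: "\<Phi> \<in> Xseries (carrier G)"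
    using Phi_reg_shuffle_series [OF Z] by (simp add: \<Phi>_def shuffle_series_def)
  have pX: "p \<in> HX (carrier G)"
    using p HX1_subset_HX by blast
  have "fact m *\<^sub>Q coeff (rho G Z (exp_pairing (Phi_star G \<Phi>) p)) m =
      (\<Sum>i\<le>N. E $ i * lin_ext (Phi_star G \<Phi>) ((D1 ^^ (m + i)) p))"
    using coeff_exp_op [of "exp_pairing (Phi_star G \<Phi>) p" N m E] degree_exp_pairing [of "Phi_star G \<Phi>" p] N
    by (simp add: rho_eq [OF Z] E_def \<Phi>_def divided_coeff_exp_pairing)
  also have "\<dots> = (\<Sum>i\<le>N. E $ i * (\<Sum>j\<le>N. R $ j * lin_ext \<Phi> ((D1 ^^ (m + (i + j))) (r_map p))))"
  proof (intro sum.cong refl arg_cong [where f = "\<lambda>x. _ * x"])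
    fix i
    have "lin_ext (Phi_star G \<Phi>) ((D1 ^^ (m + i)) p) =
        (\<Sum>j\<le>N. R $ j * lin_ext \<Phi> ((D1 ^^ j) (r_map ((D1 ^^ (m + i)) p))))"
      unfolding R_def using maxlen_D1_funpow [of "m + i" p] N
      by (intro lin_ext_Phi_star X HX1_D1_funpow p) linarith
    moreover have "(D1 ^^ j) (r_map ((D1 ^^ (m + i)) p)) = (D1 ^^ (m + (i + j))) (r_map p)" for j
    proof -
      have "(D1 ^^ j) (r_map ((D1 ^^ (m + i)) p)) = (D1 ^^ (j + (m + i))) (r_map p)"
        unfolding D1_funpow_r_map [OF pX, symmetric] by (simp only: funpow_add o_apply)
      also have "j + (m + i) = m + (i + j)"
        by simp
      finally show ?thesis .
    qed
    ultimately show "lin_ext (Phi_star G \<Phi>) ((D1 ^^ (m + i)) p) =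
        (\<Sum>j\<le>N. R $ j * lin_ext \<Phi> ((D1 ^^ (m + (i + j))) (r_map p)))"
      by (simp only:)
  qed
  also have "\<dots> = lin_ext \<Phi> ((D1 ^^ (m + 0)) (r_map p))"
    by (rule fps_inverse_shift [OF ER]) (use N in \<open>simp add: L.nilpotent\<close>)
  also have "\<dots> = fact m *\<^sub>Q coeff (Zsh G Z (q_inv G p)) m"
    by (simp add: q_inv_eq pX Zsh_eq_exp_pairing [OF Z] r_map_HX divided_coeff_exp_pairing \<Phi>_def)
  finally show "fact m *\<^sub>Q coeff (rho G Z (exp_pairing (Phi_star G (Phi_reg G Z)) p)) m =
      fact m *\<^sub>Q coeff (Zsh G Z (q_inv G p)) m"
    by (simp add: \<Phi>_def)
qed

lemma rho_inv_Zsh: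
  assumes Z: "Z \<in> shuffle_maps" and p: "p \<in> HX1 (carrier G)"
  shows "(inv_into UNIV (rho G Z) \<circ> Zsh G Z \<circ> q_inv G) p = exp_pairing (Phi_star G (Phi_reg G Z)) p"
proof -
  have "inj (rho G Z)"
    unfolding rho_eq [OF Z]
    by (rule inj_exp_op) (rule exp_fps_uminus, rule corr_exponent_0)
  then show ?thesis
    by (simp add: rho_exp_pairing_Phi_star [OF Z p, symmetric] inv_f_f)
qed

lemma HX1_add: "\<lbrakk>p \<in> HX1 S; q \<in> HX1 S\<rbrakk> \<Longrightarrow> p + q \<in> HX1 S"
  by (simp add: HX1_def keys_subset_add)

lemma HX1_scaleQ: "p \<in> HX1 S \<Longrightarrow> c *\<^sub>Q p \<in> HX1 S"
  using keys_scaleQ_subset [of c p] by (auto simp: HX1_def)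

text \<open>
  In one direction take the coefficient of \<open>T\<^sup>0\<close>; in the other use that \<open>D1\<close> is a derivation of
  the harmonic product.
\<close>

lemma exp_pairing_harm_iff:
  fixes \<Psi> :: "('g, 'a::comm_rat_algebra) series"
  shows "(\<forall>p\<in>HX1 (carrier G). \<forall>q\<in>HX1 (carrier G).
      exp_pairing \<Psi> (harm G p q) = exp_pairing \<Psi> p * exp_pairing \<Psi> q) \<longleftrightarrow>
    (\<forall>p\<in>HX1 (carrier G). \<forall>q\<in>HX1 (carrier G).
      lin_ext \<Psi> (harm G p q) = lin_ext \<Psi> p * lin_ext \<Psi> q)" (is "?L \<longleftrightarrow> ?R")
proof
  assume ?L
  then have "coeff (exp_pairing \<Psi> (harm G p q)) 0 = coeff (exp_pairing \<Psi> p * exp_pairing \<Psi> q) 0"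
    if "p \<in> HX1 (carrier G)" "q \<in> HX1 (carrier G)" for p q
    using that by simp
  then show ?R
    by (simp add: coeff_mult coeff_exp_pairing)
next
  assume R: ?R
  show ?L
  proof (intro ballI poly_eqI)
    fix p q n
    assume pq: "p \<in> HX1 (carrier G)" "q \<in> HX1 (carrier G)"
    have HX1_dpow: "dpow D1 i r \<in> HX1 (carrier G)" if "r \<in> HX1 (carrier G)" for i r
      using that by (simp add: dpow_def HX1_scaleQ HX1_D1_funpow)
    have "dpow D1 n (harm G p q) = (\<Sum>i\<le>n. harm G (dpow D1 i p) (dpow D1 (n - i) q))"
      by (rule dpow_leibniz [where W = "HX1 (carrier G)"])
         (auto simp: qlinear_dl HX1_dl qlinear_harm_left qlinear_harm_right pq intro: dl_harm)
    then show "coeff (exp_pairing \<Psi> (harm G p q)) n = coeff (exp_pairing \<Psi> p * exp_pairing \<Psi> q) n"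
      using R pq by (simp add: coeff_mult coeff_exp_pairing lin_ext_sum HX1_dpow)
  qed
qed

lemma Phi_star_Nil:
  assumes "\<Phi> \<in> shuffle_series"
  shows "Phi_star G \<Phi> [] = 1"
proof -
  have "q_ser G \<Phi> [] = 1"
    using assms by (simp add: shuffle_series_def q_ser_eq xwords_iff)
  moreover have "Phi_corr G \<Phi> [] = 1"
    by (simp add: Phi_corr_eq letter_ser_def exp_fps_def scaleQ_one)
  ultimately show ?thesis
    by (simp add: Phi_star_def ser_mult_def pi_Y_def)
qed

theorem harmonic_relations_iff:
  fixes Z :: "'g ncpoly \<Rightarrow> 'a::comm_rat_algebra"
  assumes Z: "Z \<in> shuffle_maps"
  shows "alg_hom_on (HX1 (carrier G)) (harm G) (of_word []) (*) [:1:]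
      (inv_into UNIV (rho G Z) \<circ> Zsh G Z \<circ> q_inv G) \<longleftrightarrow>
    Delta_harm G (Phi_star G (Phi_reg G Z)) = tensor (Phi_star G (Phi_reg G Z)) (Phi_star G (Phi_reg G Z))"
proof -
  let ?\<Psi> = "Phi_star G (Phi_reg G Z)"
  let ?f = "inv_into UNIV (rho G Z) \<circ> Zsh G Z \<circ> q_inv G"
  have "alg_hom_on (HX1 (carrier G)) (harm G) (of_word []) (*) [:1:] ?f \<longleftrightarrow>
      (\<forall>p\<in>HX1 (carrier G). \<forall>q\<in>HX1 (carrier G).
        exp_pairing ?\<Psi> (harm G p q) = exp_pairing ?\<Psi> p * exp_pairing ?\<Psi> q)"
  proof -
    have f: "?f p = exp_pairing ?\<Psi> p" if "p \<in> HX1 (carrier G)" for p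
      by (rule rho_inv_Zsh [OF Z that])
    have one: "of_word [] \<in> HX1 (carrier G)"
      by (simp add: HX1_def)
    have "qlinear_on (HX1 (carrier G)) ?f"
      by (intro qlinear_onI)
         (simp_all only: f HX1_add HX1_scaleQ qlinear_on_add [OF qlinear_exp_pairing UNIV_I UNIV_I]
            qlinear_on_scaleQ [OF qlinear_exp_pairing UNIV_I])
    moreover have "?f (of_word []) = [:1:]"
      unfolding f [OF one]
      by (intro exp_pairing_one Phi_star_Nil Phi_reg_shuffle_series Z)
    moreover have "?f (harm G p q) = exp_pairing ?\<Psi> (harm G p q)"
      if "p \<in> HX1 (carrier G)" "q \<in> HX1 (carrier G)" for p q
      by (intro f HX1_harm that) (rule is_monoid)
    ultimately show ?thesis
      unfolding alg_hom_on_def by (metis (no_types, lifting) f)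
  qed
  also have "\<dots> \<longleftrightarrow> Delta_harm G ?\<Psi> = tensor ?\<Psi> ?\<Psi>"
    unfolding exp_pairing_harm_iff
    by (rule Delta_harm_tensor_iff [symmetric]) (rule Phi_star_support)
  finally show ?thesis .
qed


section \<open>Distribution relations\<close>

lemma pow_img_subset: "pow_img G d \<subseteq> carrier G"
  by (auto simp: pow_img_def)

lemma xwords_append:
  "g \<in> S \<Longrightarrow> replicate i (X g) @ w \<in> xwords S \<longleftrightarrow> w \<in> xwords S"
  by (auto simp: xwords_iff)

lemma xwords_mono: "S \<subseteq> S' \<Longrightarrow> xwords S \<subseteq> xwords S'"
  by (fastforce simp: xwords_iff)

lemma pow_img_one: "\<one> \<in> pow_img G d"
  using imageI [of \<one> "carrier G" "\<lambda>g. g [^] d"] by (simp add: pow_img_def)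

text \<open>
  The images of letters and words under \<^const>\<open>p_sharp\<close> are \<open>p_up\<close> and \<open>p_word\<close>; the image of a
  letter \<open>a\<close> under \<^const>\<open>p_star\<close> is \<open>p_weight d a\<close> times the letter \<open>p_letter d a\<close>.
\<close>

abbreviation p_up :: "nat \<Rightarrow> 'g letter \<Rightarrow> 'g ncpoly" where
  "p_up d a \<equiv> (case a of
       X0 \<Rightarrow> of_nat (card (pow_ker G d)) *\<^sub>Q of_word [X0]
     | X h \<Rightarrow> \<Sum>g | g \<in> carrier G \<and> g [^] d = h. of_word [X g])"

definition p_weight :: "nat \<Rightarrow> 'g letter \<Rightarrow> rat" where
  "p_weight d a = (case a of X0 \<Rightarrow> of_nat (card (pow_ker G d)) | X g \<Rightarrow> 1)"

definition p_letter :: "nat \<Rightarrow> 'g letter \<Rightarrow> 'g letter" where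
  "p_letter d a = (case a of X0 \<Rightarrow> X0 | X g \<Rightarrow> X (g [^] d))"

definition p_word :: "nat \<Rightarrow> 'g xword \<Rightarrow> 'g ncpoly" where
  "p_word d w = foldr (\<lambda>a. conc (p_up d a)) w (of_word [])"

lemma p_sharp_eq: "p_sharp G d = lin_ext (p_word d)"
  unfolding p_sharp_def conc_hom_def p_word_def ..

lemma qlinear_p_sharp: "qlinear_on UNIV (p_sharp G d)"
  unfolding p_sharp_eq by (rule qlinear_lin_ext)

lemma p_word_Nil [simp]: "p_word d [] = of_word []"
  by (simp add: p_word_def)

lemma lookup_p_up_conc_Nil: "Poly_Mapping.lookup (conc (p_up d b) r) [] = 0"
  by (cases b)
     (simp_all add: lookup_sum lookup_conc_letter qlinear_on_scaleQ [OF qlinear_conc_left]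
       qlinear_sum [OF qlinear_conc_left])

lemma lookup_p_up_conc_Cons:
  "Poly_Mapping.lookup (conc (p_up d b) r) (a # w) =
     (if b = p_letter d a \<and> a \<in> insert X0 (X ` carrier G) then p_weight d a * Poly_Mapping.lookup r w
      else 0)"
proof (cases b)
  case X0
  then show ?thesis
    by (cases a) (simp_all add: lookup_conc_letter qlinear_on_scaleQ [OF qlinear_conc_left]
        p_letter_def p_weight_def)
next
  case (X h)
  have "Poly_Mapping.lookup (conc (p_up d b) r) (a # w) =
      (\<Sum>g | g \<in> carrier G \<and> g [^] d = h. if a = X g then Poly_Mapping.lookup r w else 0)"
    by (simp add: X lookup_sum lookup_conc_letter qlinear_sum [OF qlinear_conc_left])
  also have "\<dots> = (if X h = p_letter d a \<and> a \<in> insert X0 (X ` carrier G)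
      then p_weight d a * Poly_Mapping.lookup r w else 0)"
    using finite_carrier by (cases a) (auto simp: p_letter_def p_weight_def)
  finally show ?thesis
    by (simp add: X)
qed

text \<open>This recursion on the target word shows that \<^const>\<open>p_star\<close> is the transpose of \<^const>\<open>p_sharp\<close>.\<close>

lemma lookup_p_word_Cons:
  "Poly_Mapping.lookup (p_word d v) (a # w) =
     (case v of [] \<Rightarrow> 0 | b # v' \<Rightarrow>
       if b = p_letter d a \<and> a \<in> insert X0 (X ` carrier G)
       then p_weight d a * Poly_Mapping.lookup (p_word d v') w else 0)"
proof (cases v)
  case (Cons b v')
  then have "p_word d v = conc (p_up d b) (p_word d v')"
    by (simp add: p_word_def)
  then show ?thesis
    using Cons by (simp add: lookup_p_up_conc_Cons)
qed (simp add: lookup_of_word)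

lemma lookup_p_word_Nil: "Poly_Mapping.lookup (p_word d v) [] = (if v = [] then 1 else 0)"
proof (cases v)
  case (Cons b v')
  then have "p_word d v = conc (p_up d b) (p_word d v')"
    by (simp add: p_word_def)
  then show ?thesis
    using Cons by (simp add: lookup_p_up_conc_Nil)
qed (simp add: lookup_of_word)

lemma p_word_HX: "p_word d v \<in> HX (carrier G)"
proof -
  have "w \<in> xwords (carrier G)" if "Poly_Mapping.lookup (p_word d v) w \<noteq> 0" for w
    using that
  proof (induction w arbitrary: v)
    case (Cons a w)
    then show ?case
      by (auto simp: lookup_p_word_Cons xwords_iff split: list.splits if_splits)
  qed (simp add: xwords_iff)
  then show ?thesis
    by (auto simp: HX_def in_keys_iff)
qed

lemma p_sharp_HX: "p_sharp G d p \<in> HX (carrier G)"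
  using keys_lin_ext [of "p_word d" p] p_word_HX by (fastforce simp: p_sharp_eq HX_def)

text \<open>The letter \<open>X \<one>\<close> occurs with coefficient 1 in the image of \<open>X \<one>\<close> and in no other image.\<close>

lemma D1_p_sharp: "D1 (p_sharp G d p) = p_sharp G d (D1 p)"
proof (rule qlinear_eqI [where f = "\<lambda>p. D1 (p_sharp G d p)" and g = "\<lambda>p. p_sharp G d (D1 p)"])
  fix v :: "'g xword"
  have "p_letter d (X \<one>) = X \<one>" "p_weight d (X \<one>) = 1"
    by (simp_all add: p_letter_def p_weight_def)
  then have "D1 (p_word d v) = p_sharp G d (D1 (of_word v))"
    by (intro poly_mapping_eqI, cases v)
       (auto simp: lookup_p_word_Cons dl_of_word_Cons qlinear_zero [OF qlinear_p_sharp], auto simp: p_sharp_eq)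
  then show "D1 (p_sharp G d (of_word v)) = p_sharp G d (D1 (of_word v))"
    by (simp add: p_sharp_eq)
qed (rule qlinear_compose [OF qlinear_dl qlinear_p_sharp], rule qlinear_compose [OF qlinear_p_sharp qlinear_dl])

lemma D1_funpow_p_sharp: "(D1 ^^ n) (p_sharp G d p) = p_sharp G d ((D1 ^^ n) p)"
  by (induction n) (simp_all add: D1_p_sharp)

lemma i_sharp_eq: "i_sharp (p :: 'g ncpoly) = p"
proof -
  have "foldr (\<lambda>a. conc (of_word [a])) w (of_word []) = of_word w" for w :: "'g xword"
    by (induction w) (simp_all add: conc_of_word)
  then show ?thesis
    by (simp add: i_sharp_def conc_hom_def lin_ext_words)
qed

lemma ser_mult_scaled_letter:
  "ser_mult (\<lambda>w. c *\<^sub>Q ser_word [a] w) \<Theta> v =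
     (case v of [] \<Rightarrow> 0 | b # v' \<Rightarrow> if b = a then c *\<^sub>Q \<Theta> v' else 0)"
proof (cases v)
  case (Cons b v')
  have "ser_mult (\<lambda>w. c *\<^sub>Q ser_word [a] w) \<Theta> v =
      (\<Sum>i\<le>length v. if i = 1 then if b = a then c *\<^sub>Q \<Theta> v' else 0 else 0)"
    unfolding ser_mult_def ser_word_def
  proof (intro sum.cong refl)
    fix i
    assume "i \<in> {..length v}"
    show "c *\<^sub>Q (if take i v = [a] then 1 else 0) * \<Theta> (drop i v) =
        (if i = 1 then if b = a then c *\<^sub>Q \<Theta> v' else 0 else 0)"
      using \<open>i \<in> _\<close> by (cases i) (auto simp: Cons scaleQ_mult_left One_nat_def)
  qed
  then show ?thesis
    by (simp add: Cons del: sum.atMost_Suc)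
qed (simp add: ser_mult_def ser_word_def)

lemma p_star_eq:
  fixes \<Phi> :: "('g, 'a::comm_rat_algebra) series"
  assumes \<Phi>: "\<Phi> \<in> Xseries (carrier G)"
  shows "p_star G d \<Phi> v = (if v \<in> xwords (pow_img G d) then lin_ext \<Phi> (p_sharp G d (of_word v)) else 0)"
proof -
  define P where "P v = (if v \<in> xwords (pow_img G d) then p_word d v else 0)" for v
  let ?f = "\<lambda>a. case a of X0 \<Rightarrow> (\<lambda>w. of_nat (card (pow_ker G d)) *\<^sub>Q ser_word [X0] w)
      | X g \<Rightarrow> (ser_word [X (g [^] d)] :: ('g, 'a) series)"
  have f: "?f a = (\<lambda>w. p_weight d a *\<^sub>Q ser_word [p_letter d a] w)" for a
    by (cases a) (simp_all add: p_weight_def p_letter_def scaleQ_one)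
  have coeff: "foldr (\<lambda>a. ser_mult (?f a)) w (ser_word []) v = Poly_Mapping.lookup (P v) w *\<^sub>Q 1"
    if "w \<in> xwords (carrier G)" for w v
    using that
  proof (induction w arbitrary: v)
    case Nil
    then show ?case
      by (simp add: ser_word_def P_def lookup_p_word_Nil lookup_of_word scaleQ_one xwords_iff)
  next
    case (Cons a w)
    then have a: "a \<in> insert X0 (X ` carrier G)" and w: "w \<in> xwords (carrier G)"
      by (simp_all add: xwords_iff)
    then have pa: "p_letter d a \<in> insert X0 (X ` pow_img G d)"
      by (auto simp: p_letter_def pow_img_def)
    have "foldr (\<lambda>a. ser_mult (?f a)) (a # w) (ser_word []) v =
        ser_mult (?f a) (foldr (\<lambda>a. ser_mult (?f a)) w (ser_word [])) v"
      by (simp only: foldr.simps o_apply)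
    also have "\<dots> = (case v of [] \<Rightarrow> 0 | b # v' \<Rightarrow>
        if b = p_letter d a then p_weight d a *\<^sub>Q Poly_Mapping.lookup (P v') w *\<^sub>Q 1 else 0)"
      unfolding f [of a] ser_mult_scaled_letter Cons.IH [OF w] ..
    also have "\<dots> = Poly_Mapping.lookup (P v) (a # w) *\<^sub>Q 1"
      using a pa by (cases v) (auto simp: P_def lookup_p_word_Cons xwords_iff scaleQ_scaleQ lookup_of_word)
    finally show ?case .
  qed
  have "\<Phi> w * foldr (\<lambda>a. ser_mult (?f a)) w (ser_word []) v = \<Phi> w * (Poly_Mapping.lookup (P v) w *\<^sub>Q 1)" for w
  proof (cases "w \<in> xwords (carrier G)")
    case False
    then show ?thesis
      using \<Phi> by (simp add: Xseries_def)
  qed (simp only: coeff)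
  then have "p_star G d \<Phi> v = lin_ext \<Phi> (P v)"
    unfolding p_star_def ser_hom_def ser_ext_def Sum_any_lin_ext [symmetric] by presburger
  then show ?thesis
    by (simp add: P_def p_sharp_eq)
qed

lemma i_star_eq:
  fixes \<Phi> :: "('g, 'a::comm_rat_algebra) series"
  shows "i_star G d \<Phi> v = (if v \<in> xwords (pow_img G d) then \<Phi> v else 0)"
proof -
  let ?f = "\<lambda>a. case a of X0 \<Rightarrow> (ser_word [X0] :: ('g, 'a) series)
      | X g \<Rightarrow> (if g \<in> pow_img G d then ser_word [X g] else (\<lambda>_. 0))"
  have f: "?f a = (\<lambda>w. (if a \<in> insert X0 (X ` pow_img G d) then 1 else 0) *\<^sub>Q ser_word [a] w)" for a
    by (cases a) (auto simp: scaleQ_one)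
  have coeff: "foldr (\<lambda>a. ser_mult (?f a)) w (ser_word []) v =
      Poly_Mapping.lookup (if v \<in> xwords (pow_img G d) then of_word v else 0) w *\<^sub>Q 1" for w v
  proof (induction w arbitrary: v)
    case Nil
    then show ?case
      by (auto simp: ser_word_def lookup_of_word scaleQ_one xwords_iff)
  next
    case (Cons a w)
    have "foldr (\<lambda>a. ser_mult (?f a)) (a # w) (ser_word []) v =
        ser_mult (?f a) (foldr (\<lambda>a. ser_mult (?f a)) w (ser_word [])) v"
      by (simp only: foldr.simps o_apply)
    also have "\<dots> = (case v of [] \<Rightarrow> 0 | b # v' \<Rightarrow> if b = a then
        (if a \<in> insert X0 (X ` pow_img G d) then 1 else 0) *\<^sub>Q
          Poly_Mapping.lookup (if v' \<in> xwords (pow_img G d) then of_word v' else 0) w *\<^sub>Q 1 else 0)"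
      unfolding f [of a] ser_mult_scaled_letter Cons.IH ..
    also have "\<dots> = Poly_Mapping.lookup (if v \<in> xwords (pow_img G d) then of_word v else 0) (a # w) *\<^sub>Q 1"
      by (cases v) (auto simp: xwords_iff scaleQ_one lookup_of_word)
    finally show ?case .
  qed
  show ?thesis
    unfolding i_star_def ser_hom_def ser_ext_def coeff Sum_any_lin_ext by simp
qed

text \<open>
  The exponent \<open>(\<Sum>\<^sub>g \<Phi> (x\<^sub>g)) u\<close>, with \<open>g\<close> in the kernel of the power map, that appears in the
  distribution relation.
\<close>

definition ker_sum :: "nat \<Rightarrow> ('g, 'a::comm_rat_algebra) series \<Rightarrow> 'a fps" where
  "ker_sum d \<Phi> = Abs_fps (\<lambda>n. if n = 1 then \<Sum>g\<in>pow_ker G d. \<Phi> [X g] else 0)"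

lemma ser_exp_ker_sum:
  "ser_exp (\<lambda>w. if w = [X \<one>] then \<Sum>g\<in>pow_ker G d. \<Phi> [X g] else 0) =
     letter_ser (X \<one>) (exp_fps (ker_sum d \<Phi>))"
proof -
  have "(\<lambda>w. if w = [X \<one>] then \<Sum>g\<in>pow_ker G d. \<Phi> [X g] else 0) = letter_ser (X \<one>) (ker_sum d \<Phi>)"
    by (auto simp: fun_eq_iff letter_ser_def ker_sum_def One_nat_def length_Suc_conv)
  then show ?thesis
    by (simp add: ser_exp_letter_ser)
qed

text \<open>The summand of \<open>\<one>\<close>, which is absent from the exponent of \<^const>\<open>sigma\<close>, is zero for \<open>\<Phi>\<close>.\<close>

lemma sigma_eq:
  assumes Z: "Z \<in> shuffle_maps"
  shows "sigma G d Z = exp_op (exp_fps (ker_sum d (Phi_reg G Z)))"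
proof -
  have "finite (pow_ker G d)" and one: "\<one> \<in> pow_ker G d"
    using finite_carrier by (simp_all add: pow_ker_def kernel_def)
  moreover have "Phi_reg G Z [X \<one>] = 0"
    using Phi_reg_shuffle_series [OF Z] by (simp add: shuffle_series_def)
  ultimately have "(\<Sum>g\<in>pow_ker G d. Phi_reg G Z [X g]) =
      (\<Sum>g\<in>pow_ker G d - {\<one>}. Phi_reg G Z [X g])"
    by (simp add: sum.remove)
  also have "\<dots> = (\<Sum>g\<in>pow_ker G d - {\<one>}. Z (of_word [X g]))"
  proof (rule sum.cong [OF refl])
    fix g
    assume "g \<in> pow_ker G d - {\<one>}"
    then have "of_word [X g] \<in> HX0 G"
      by (auto simp: HX0_iff' HX_of_word xwords_iff dl_of_word_Cons dr_of_word_single pow_ker_def kernel_def)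
    then show "Phi_reg G Z [X g] = Z (of_word [X g])"
      using Phi_reg_HX0 [OF Z, of "of_word [X g]"] by simp
  qed
  finally show ?thesis
    by (simp add: sigma_def ker_sum_def cong: if_cong)
qed

theorem distribution_relation_iff:
  fixes Z :: "'g ncpoly \<Rightarrow> 'a::comm_rat_algebra"
  assumes Z: "Z \<in> shuffle_maps"
  shows "(\<forall>p\<in>HX (pow_img G d). Zsh G Z (p_sharp G d p) = sigma G d Z (Zsh G Z (i_sharp p))) \<longleftrightarrow>
    p_star G d (Phi_reg G Z) =
      ser_mult (ser_exp (\<lambda>w. if w = [X \<one>] then \<Sum>g\<in>pow_ker G d. Phi_reg G Z [X g] else 0))
        (i_star G d (Phi_reg G Z))" (is "?L \<longleftrightarrow> ?R")
proof -
  define \<Phi> where "\<Phi> = Phi_reg G Z"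
  define S where "S = exp_fps (ker_sum d \<Phi>)"
  let ?H = "pow_img G d"
  have X: "\<Phi> \<in> Xseries (carrier G)"
    using Phi_reg_shuffle_series [OF Z] by (simp add: \<Phi>_def shuffle_series_def)
  have HX_H: "p \<in> HX (carrier G)" if "p \<in> HX ?H" for p
    using that xwords_mono [OF pow_img_subset] by (fastforce simp: HX_def)
  have lhs: "fact m *\<^sub>Q coeff (Zsh G Z (p_sharp G d p)) m = lin_ext \<Phi> (p_sharp G d ((D1 ^^ m) p))" for p m
    by (simp add: Zsh_eq_exp_pairing [OF Z p_sharp_HX] divided_coeff_exp_pairing D1_funpow_p_sharp \<Phi>_def)
  have rhs: "fact m *\<^sub>Q coeff (sigma G d Z (Zsh G Z (i_sharp p))) m =
      (\<Sum>i\<le>N. S $ i * lin_ext \<Phi> ((D1 ^^ i) ((D1 ^^ m) p)))" if "p \<in> HX ?H" "maxlen p \<le> N" for p m N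
  proof -
    have "(D1 ^^ i) ((D1 ^^ m) p) = (D1 ^^ (m + i)) p" for i
      by (metis add.commute funpow_add o_apply)
    moreover have "degree (exp_pairing \<Phi> p) \<le> N"
      using degree_exp_pairing [of \<Phi> p] that(2) by linarith
    ultimately show ?thesis
      by (simp add: i_sharp_eq Zsh_eq_exp_pairing [OF Z HX_H [OF that(1)]] sigma_eq [OF Z] coeff_exp_op
          divided_coeff_exp_pairing S_def \<Phi>_def)
  qed
  have i_star: "lin_ext (i_star G d \<Phi>) p = lin_ext \<Phi> p" if "p \<in> HX ?H" for p
    using that by (intro lin_ext_cong) (auto simp: i_star_eq HX_def)
  have D1_HX: "(D1 ^^ n) p \<in> HX ?H" if "p \<in> HX ?H" for p n
    by (induction n) (simp_all add: that HX_dl)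
  have R_iff: "?R \<longleftrightarrow> (\<forall>v. p_star G d \<Phi> v = ser_mult (letter_ser (X \<one>) S) (i_star G d \<Phi>) v)"
    unfolding ser_exp_ker_sum fun_eq_iff by (simp add: S_def \<Phi>_def)
  have R_rhs: "ser_mult (letter_ser (X \<one>) S) (i_star G d \<Phi>) v =
      (\<Sum>i\<le>N. S $ i * lin_ext (i_star G d \<Phi>) ((D1 ^^ i) (of_word v)))" if "maxlen (of_word v) \<le> N" for v N
    using lin_ext_ser_mult_letter_ser [OF that, of "X \<one>" S "i_star G d \<Phi>"] by simp
  show ?thesis
  proof
    assume L: ?L
    show ?R
      unfolding R_iff
    proof
      fix v
      show "p_star G d \<Phi> v = ser_mult (letter_ser (X \<one>) S) (i_star G d \<Phi>) v"
      proof (cases "v \<in> xwords ?H")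
        case True
        then have v: "of_word v \<in> HX ?H"
          by (simp add: HX_of_word)
        \<comment> \<open>At \<open>T = 0\<close>, the relation for \<open>Z\<close> is the relation for \<open>\<Phi>\<close> on words in \<open>G\<^sup>d\<close>.\<close>
        with L have "fact 0 *\<^sub>Q coeff (Zsh G Z (p_sharp G d (of_word v))) 0 =
            fact 0 *\<^sub>Q coeff (sigma G d Z (Zsh G Z (i_sharp (of_word v)))) 0"
          by simp
        then show ?thesis
          using True v unfolding lhs rhs [OF v order_refl] R_rhs [OF order_refl]
          by (simp add: p_star_eq [OF X] i_star D1_HX)
      next
        case False
        \<comment> \<open>Both sides vanish, since prepending powers of \<open>x\<^sub>1\<close> stays inside the words in \<open>G\<^sup>d\<close>.\<close>
        have "i_star G d \<Phi> (drop i v) = 0" if "take i v = replicate i (X \<one>)" for i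
        proof -
          have "drop i v \<notin> xwords ?H"
            using False that append_take_drop_id [of i v] pow_img_one [of d]
            by (metis xwords_append)
          then show ?thesis
            by (simp add: i_star_eq)
        qed
        then show ?thesis
          using False by (simp add: p_star_eq [OF X] ser_mult_letter_ser cong: if_cong)
      qed
    qed
  next
    assume R: ?R
    have main: "lin_ext \<Phi> (p_sharp G d p) = (\<Sum>i\<le>N. S $ i * lin_ext \<Phi> ((D1 ^^ i) p))"
      if "p \<in> HX ?H" "maxlen p \<le> N" for p N
    proof -
      have "lin_ext \<Phi> (p_sharp G d p) = lin_ext (\<lambda>v. lin_ext \<Phi> (p_sharp G d (of_word v))) p"
        by (rule qlinear_eq_lin_ext) (rule qlinear_compose [OF qlinear_lin_ext qlinear_p_sharp])
      also have "\<dots> = lin_ext (ser_mult (letter_ser (X \<one>) S) (i_star G d \<Phi>)) p"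
      proof (rule lin_ext_cong)
        fix w
        assume "w \<in> Poly_Mapping.keys p"
        then have "w \<in> xwords ?H"
          using that(1) by (auto simp: HX_def)
        then show "lin_ext \<Phi> (p_sharp G d (of_word w)) = ser_mult (letter_ser (X \<one>) S) (i_star G d \<Phi>) w"
          using R p_star_eq [OF X, of d w] unfolding R_iff by simp
      qed
      also have "\<dots> = (\<Sum>i\<le>N. S $ i * lin_ext \<Phi> ((D1 ^^ i) p))"
        by (simp add: lin_ext_ser_mult_letter_ser [OF that(2)] i_star D1_HX that(1))
      finally show ?thesis .
    qed
    \<comment> \<open>The coefficient of \<open>T\<^sup>m / m!\<close> at \<open>p\<close> is the relation for \<open>\<Phi>\<close> at \<open>D1\<^sup>m p\<close>.\<close>
    show ?L
    proof (intro ballI poly_eq_divided_coeffI)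
      fix p m
      assume p: "p \<in> HX ?H"
      show "fact m *\<^sub>Q coeff (Zsh G Z (p_sharp G d p)) m =
          fact m *\<^sub>Q coeff (sigma G d Z (Zsh G Z (i_sharp p))) m"
        unfolding lhs rhs [OF p order_refl] by (rule main [OF D1_HX [OF p] maxlen_D1_funpow])
    qed
  qed
qed


section \<open>Restricting the bijection\<close>

lemma EDS_iff:
  "Z \<in> EDS G \<longleftrightarrow> Z \<in> shuffle_maps \<and>
    alg_hom_on (HX1 (carrier G)) (harm G) (of_word []) (*) [:1:]
      (inv_into UNIV (rho G Z) \<circ> Zsh G Z \<circ> q_inv G)"
  by (auto simp: EDS_def shuffle_maps_def alg_hom_on_def)

lemma DMR_iff:
  "\<Phi> \<in> DMR G \<longleftrightarrow> \<Phi> \<in> shuffle_series \<and>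
    Delta_harm G (Phi_star G \<Phi>) = tensor (Phi_star G \<Phi>) (Phi_star G \<Phi>)"
  by (auto simp: DMR_def shuffle_series_def Delta_sh_tensor_iff)

lemma bij_betw_filter:
  assumes "bij_betw f A B" "A' \<subseteq> A" "B' \<subseteq> B" "\<And>x. x \<in> A \<Longrightarrow> x \<in> A' \<longleftrightarrow> f x \<in> B'"
  shows "bij_betw f A' B'"
  using assms unfolding bij_betw_def inj_on_def by (auto simp: subset_iff)

theorem bij_betw_EDS:
  "bij_betw (Phi_reg G) (EDS G :: ('g ncpoly \<Rightarrow> 'a::comm_rat_algebra) set) (DMR G)"
  by (rule bij_betw_filter [OF bij_betw_shuffle])
     (auto simp: EDS_iff DMR_iff harmonic_relations_iff Phi_reg_shuffle_series)

theorem bij_betw_EDSD: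
  "bij_betw (Phi_reg G) (EDSD G :: ('g ncpoly \<Rightarrow> 'a::comm_rat_algebra) set) (DMRD G)"
proof (rule bij_betw_filter [OF bij_betw_EDS])
  fix Z :: "'g ncpoly \<Rightarrow> 'a"
  assume Z: "Z \<in> EDS G"
  then have "Phi_reg G Z \<in> DMR G" and "Z \<in> shuffle_maps"
    using bij_betw_EDS by (auto simp: bij_betw_def EDS_iff)
  then show "Z \<in> EDSD G \<longleftrightarrow> Phi_reg G Z \<in> DMRD G"
    using Z unfolding EDSD_def DMRD_def by (simp add: distribution_relation_iff)
qed (auto simp: EDSD_def DMRD_def)

end

theorem theorem3:
  fixes G :: "('g, 'm) monoid_scheme"
  assumes "comm_group G" and "finite (carrier G)" and "carrier G \<noteq> {\<one>\<^bsub>G\<^esub>}"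
  shows "bij_betw (Phi_reg G) (EDS G :: ('g ncpoly \<Rightarrow> 'a::comm_rat_algebra) set) (DMR G) \<and>
         bij_betw (Phi_reg G) (EDSD G :: ('g ncpoly \<Rightarrow> 'a) set) (DMRD G)"
proof -
  interpret finite_comm_group G
    using assms by (simp add: finite_comm_group_def finite_comm_group_axioms_def)
  show ?thesis
    using bij_betw_EDS bij_betw_EDSD by blast
qed

end
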